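(* Let $p\in\{3,4,6\}$ (types $\mathrm A_2,\mathrm B_2,\mathrm G_2$), $N=\lfloor p/2\rfloor\in\{1,2,3\}$, and $k_p=6,4,3$ for $p=3,4,6$ respectively. Use the notation of the context. 1. Set $\lambda_p(\tau):=\eta(\tau)\,\eta(N\tau)$. Then: (i) $\lambda_p$ is a modular form of weight $1$ of the group $\Gamma_1(N)$ with respect to the character $\vartheta_p$. (ii) The power $\delta_p:=\lambda_p^{k_p}$ is a generator of the module of anti-invariant modular forms, i.e. of the $M_*(\Gamma_1(N))$-module of holomorphic modular forms of $\Gamma_1(N)$ with character $\theta_p=\vartheta_p^{k_p}$. (iii) The power $\lambda_p^{2k_p}$ corresponds, up to a non-zero constant factor, to the reduced discriminant form $\Delta_p^{\mathrm{red}}$: there is a non-zero constant $C$ with $\Delta_p^{\mathrm{red}}(g_s,g_l)=C\,\lambda_p(\tau)^{2k_p}\,\omega_0^{-2k_p}$ on $\widetilde{\mathbb H}$, $\tau=\omega_1/\omega_0$. 2. The discriminant form $\Delta_p$ corresponds, up to a non-zero constant factor, to the modular discriminant $q\prod_{n=1}^\infty(1-q^n)^{24}$: there is a non-zero constant $C'$ with $\Delta_p(g_s,g_l)=C'\,q\prod_{n=1}^\infty(1-q^n)^{24}\,\omega_0^{-12}$ on $\widetilde{\mathbb H}$, where $q=\exp(2\pi\sqrt{-1}\,\tau)$, $\tau=\omega_1/\omega_0$.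
   Context: $\eta(\tau)=q^{1/24}\prod_{n\ge1}(1-q^n)$, $q=\exp(2\pi\sqrt{-1}\tau)$, is the Dedekind eta function. $\Gamma_1(N)=\{\begin{pmatrix}a&b\\c&d\end{pmatrix}\in \mathrm{SL}_2(\mathbb Z): a\equiv d\equiv1,\ c\equiv0 \bmod N\}$; for $N=1,2,3$ it is generated by $A=\begin{pmatrix}1&0\\-N&1\end{pmatrix}$ and $B=\begin{pmatrix}1&1\\0&1\end{pmatrix}$. The character $\vartheta_p:\Gamma_1(N)\to\mathbb C^\times$ is the (well-defined) character with $A,B\mapsto\exp(\pi\sqrt{-1}/k_p)$; $\theta_p:=\vartheta_p^{k_p}:\Gamma_1(N)\to\{\pm1\}$ sends $A,B\mapsto-1$. A modular form $f$ of weight $k$ with character $\chi$ satisfies $f\big(\frac{a\tau+b}{c\tau+d}\big)=\chi(\gamma)(c\tau+d)^kf(\tau)$ for $\gamma=\begin{pmatrix}a&b\\c&d\end{pmatrix}\in\Gamma_1(N)$ and is holomorphic on the upper half plane and at the cusps. Discriminants: $\Delta_3=g_s^3-27g_l^2$, $\Delta_4=(8g_l+g_s^2)(-8g_l+g_s^2)^2$, $\Delta_6=(g_l+2g_s^3)(-g_l+2g_s^3)^3$; reduced discriminants: $\Delta_3^{\mathrm{red}}=g_s^3-27g_l^2$, $\Delta_4^{\mathrm{red}}=g_s^4-64g_l^2$, $\Delta_6^{\mathrm{red}}=4g_s^6-g_l^2$. These are the discriminants of the families of elliptic curves $y^2=4x^3-g_sx-g_l$, $y^2=x^4-g_sx^2+g_l+g_s^2/8$,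 $x(y^2-x^2)+g_s(3x^2+y^2)-g_l-2g_s^3=0$ respectively. Here $g_s,g_l$ are regarded as functions on $\widetilde{\mathbb H}=\{(\omega_0,\omega_1)\in\mathbb C^2:\mathrm{Im}(\omega_1/\omega_0)>0\}$ (the inverse of the period map of the family). Explicitly, with $\Omega=\mathbb Z\omega_0+\mathbb Z\omega_1$, $\mathfrak p,\zeta$ the Weierstrass functions of $\Omega$, and for $m\ge3$ $G_m(0)=\sum_{0\ne\omega\in\Omega}\omega^{-m}$, $G_m(a)=\sum_{\omega\in\Omega}(\omega+a)^{-m}$ for $a\notin\Omega$: - $p=3$: $g_s=\frac{15}4G_4(0)$, $g_l=\frac{35}{16}G_6(0)$; - $p=4$: $g_s=\frac32\mathfrak p(\frac12\omega_0)$, $g_l=\frac5{32}\mathfrak p(\frac12\omega_0)^2+\frac58G_4(0)-\frac58G_4(\frac12\omega_0)$; - $p=6$: $g_s=\zeta(\frac13\omega_0)-\frac23\zeta(\frac12\omega_0)$, $g_l=2g_s^3-G_3(\frac13\omega_0)$. A modular form $s(\tau)$ of weight $k$ corresponds to the function $\omega_0^{-k}s(\omega_1/\omega_0)$ on $\widetilde{\mathbb H}$. *)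

theory Defs
  imports
    "HOL-Complex_Analysis.Complex_Analysis"
    "HOL-Number_Theory.Cong"
    "HOL-Library.FuncSet"
    "HOL-Library.Function_Algebras"
    "HOL-Library.Poly_Mapping"
begin

definition upper_half_plane :: "complex set" where
  "upper_half_plane = {\<tau>. Im \<tau> > 0}"

definition SL2Z :: "(int^2^2) set" where
  "SL2Z = {\<gamma>. det \<gamma> = 1}"

definition Gamma1 :: "nat \<Rightarrow> (int^2^2) set" where
  "Gamma1 N = {\<gamma> \<in> SL2Z. [\<gamma>$1$1 = 1] (mod int N) \<and> [\<gamma>$2$2 = 1] (mod int N) \<and> [\<gamma>$2$1 = 0] (mod int N)}"

definition mat_A :: "nat \<Rightarrow> int^2^2" where
  "mat_A N = vector [vector [1, 0], vector [- int N, 1]]"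

definition mat_B :: "int^2^2" where
  "mat_B = vector [vector [1, 1], vector [0, 1]]"

definition moebius :: "int^2^2 \<Rightarrow> complex \<Rightarrow> complex" where
  "moebius \<gamma> \<tau> =
     (of_int (\<gamma>$1$1) * \<tau> + of_int (\<gamma>$1$2)) / (of_int (\<gamma>$2$1) * \<tau> + of_int (\<gamma>$2$2))"

definition aut_factor :: "int^2^2 \<Rightarrow> complex \<Rightarrow> complex" where
  "aut_factor \<gamma> \<tau> = of_int (\<gamma>$2$1) * \<tau> + of_int (\<gamma>$2$2)"

definition is_character :: "(int^2^2) set \<Rightarrow> (int^2^2 \<Rightarrow> complex) \<Rightarrow> bool" where
  "is_character \<Gamma> \<psi> \<longleftrightarrow>
     (\<forall>\<gamma>\<in>\<Gamma>. \<psi> \<gamma> \<noteq> 0) \<and> (\<forall>\<gamma>\<in>\<Gamma>. \<forall>\<gamma>'\<in>\<Gamma>. \<psi> (\<gamma> ** \<gamma>') = \<psi> \<gamma> * \<psi> \<gamma>')"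

(* Every cusp is moved to infinity by some gamma in SL2(Z).  Holomorphy at that cusp means that the
   transformed function is a power series in the local parameter exp(2 pi i tau / h) for some
   h > 0; g is the function of the local parameter, including its value at the cusp. *)
definition holomorphic_at_cusps :: "int \<Rightarrow> (complex \<Rightarrow> complex) \<Rightarrow> bool" where
  "holomorphic_at_cusps k f \<longleftrightarrow>
     (\<forall>\<gamma>\<in>SL2Z. \<exists>h::nat. h > 0 \<and>
        (\<exists>g. g holomorphic_on ball 0 1 \<and>
             (\<forall>\<tau>\<in>upper_half_plane.
                aut_factor \<gamma> \<tau> powi (- k) * f (moebius \<gamma> \<tau>)
                  = g (exp (2 * pi * \<i> * \<tau> / of_nat h)))))"

(* A function on the upper half plane is represented by its extension by 0 to the whole complex
   plane, so that equality of functions is equality on the upper half plane. *)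
definition modular_form ::
    "int \<Rightarrow> (int^2^2) set \<Rightarrow> (int^2^2 \<Rightarrow> complex) \<Rightarrow> (complex \<Rightarrow> complex) \<Rightarrow> bool" where
  "modular_form k \<Gamma> \<psi> f \<longleftrightarrow>
     is_character \<Gamma> \<psi> \<and>
     (\<forall>\<tau>. \<tau> \<notin> upper_half_plane \<longrightarrow> f \<tau> = 0) \<and>
     f holomorphic_on upper_half_plane \<and>
     (\<forall>\<gamma>\<in>\<Gamma>. \<forall>\<tau>\<in>upper_half_plane.
        f (moebius \<gamma> \<tau>) = \<psi> \<gamma> * aut_factor \<gamma> \<tau> powi k * f \<tau>) \<and>
     holomorphic_at_cusps k f"

(* The direct sum over all weights k of the spaces of modular forms of weight k with character psi,
   as finitely supported families indexed by the weight.  The product of poly_mappings is the graded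
   product: pointwise multiplication of functions, addition of weights. *)
definition graded_modular_forms ::
    "(int^2^2) set \<Rightarrow> (int^2^2 \<Rightarrow> complex) \<Rightarrow> (int \<Rightarrow>\<^sub>0 (complex \<Rightarrow> complex)) set" where
  "graded_modular_forms \<Gamma> \<psi> = {F. \<forall>k. modular_form k \<Gamma> \<psi> (Poly_Mapping.lookup F k)}"

definition module_generator :: "'r::times set \<Rightarrow> 'r set \<Rightarrow> 'r \<Rightarrow> bool" where
  "module_generator R M x \<longleftrightarrow> x \<in> M \<and> M = {r * x | r. r \<in> R}"

definition dedekind_eta :: "complex \<Rightarrow> complex" where
  "dedekind_eta \<tau> =
     (if \<tau> \<in> upper_half_plane
      then exp (2 * pi * \<i> * \<tau> / 24) * prodinf (\<lambda>n. 1 - exp (2 * pi * \<i> * \<tau>) ^ Suc n)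
      else 0)"

(* In the definitions below that depend on p, only p = 3, 4, 6 is meaningful; the last branch is
   the case p = 6. *)
definition level :: "nat \<Rightarrow> nat" where
  "level p = p div 2"

definition wt :: "nat \<Rightarrow> nat" where
  "wt p = (if p = 3 then 6 else if p = 4 then 4 else 3)"

(* Characters of Gamma1(N) are extended by undefined outside Gamma1(N), so that the description by
   the values on the generators A and B determines the function uniquely.  Uniqueness
   holds because A and B generate Gamma1(N) for N = 1, 2, 3; such a character exists because
   lambda_form p, which has no zeros, transforms with it. *)
definition vartheta :: "nat \<Rightarrow> int^2^2 \<Rightarrow> complex" where
  "vartheta p = (THE \<psi>. \<psi> \<in> extensional (Gamma1 (level p)) \<and>
                          is_character (Gamma1 (level p)) \<psi> \<and>
                          \<psi> (mat_A (level p)) = exp (pi * \<i> / of_nat (wt p)) \<and>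
                          \<psi> mat_B = exp (pi * \<i> / of_nat (wt p)))"

definition theta_char :: "nat \<Rightarrow> int^2^2 \<Rightarrow> complex" where
  "theta_char p \<gamma> = vartheta p \<gamma> ^ wt p"

definition lambda_form :: "nat \<Rightarrow> complex \<Rightarrow> complex" where
  "lambda_form p \<tau> = dedekind_eta \<tau> * dedekind_eta (of_nat (level p) * \<tau>)"

definition delta_form :: "nat \<Rightarrow> complex \<Rightarrow> complex" where
  "delta_form p \<tau> = lambda_form p \<tau> ^ wt p"

definition H_tilde :: "(complex \<times> complex) set" where
  "H_tilde = {(\<omega>0, \<omega>1). Im (\<omega>1 / \<omega>0) > 0}"

definition period_lattice :: "complex \<times> complex \<Rightarrow> complex set" where
  "period_lattice = (\<lambda>(\<omega>0, \<omega>1). {of_int m * \<omega>0 + of_int n * \<omega>1 | m n. True})"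

(* For a in the lattice, this is only meant for a = 0. *)
definition eisenstein_G :: "nat \<Rightarrow> complex set \<Rightarrow> complex \<Rightarrow> complex" where
  "eisenstein_G m \<Omega> a =
     (if a = 0 then (\<Sum>\<^sub>\<infinity>\<omega>\<in>\<Omega> - {0}. 1 / \<omega> ^ m) else (\<Sum>\<^sub>\<infinity>\<omega>\<in>\<Omega>. 1 / (\<omega> + a) ^ m))"

definition weierstrass_p :: "complex set \<Rightarrow> complex \<Rightarrow> complex" where
  "weierstrass_p \<Omega> z = 1 / z^2 + (\<Sum>\<^sub>\<infinity>\<omega>\<in>\<Omega> - {0}. 1 / (z - \<omega>)^2 - 1 / \<omega>^2)"

definition weierstrass_zeta :: "complex set \<Rightarrow> complex \<Rightarrow> complex" where
  "weierstrass_zeta \<Omega> z = 1 / z + (\<Sum>\<^sub>\<infinity>\<omega>\<in>\<Omega> - {0}. 1 / (z - \<omega>) + 1 / \<omega> + z / \<omega>^2)"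

definition g_s :: "nat \<Rightarrow> complex \<times> complex \<Rightarrow> complex" where
  "g_s p w = (let \<Omega> = period_lattice w; \<omega>0 = fst w in
     if p = 3 then 15 / 4 * eisenstein_G 4 \<Omega> 0
     else if p = 4 then 3 / 2 * weierstrass_p \<Omega> (\<omega>0 / 2)
     else weierstrass_zeta \<Omega> (\<omega>0 / 3) - 2 / 3 * weierstrass_zeta \<Omega> (\<omega>0 / 2))"

definition g_l :: "nat \<Rightarrow> complex \<times> complex \<Rightarrow> complex" where
  "g_l p w = (let \<Omega> = period_lattice w; \<omega>0 = fst w in
     if p = 3 then 35 / 16 * eisenstein_G 6 \<Omega> 0
     else if p = 4 then
       5 / 32 * weierstrass_p \<Omega> (\<omega>0 / 2) ^ 2
         + 5 / 8 * eisenstein_G 4 \<Omega> 0 - 5 / 8 * eisenstein_G 4 \<Omega> (\<omega>0 / 2)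
     else 2 * g_s p w ^ 3 - eisenstein_G 3 \<Omega> (\<omega>0 / 3))"

definition discr :: "nat \<Rightarrow> complex \<Rightarrow> complex \<Rightarrow> complex" where
  "discr p s l =
     (if p = 3 then s^3 - 27 * l^2
      else if p = 4 then (8 * l + s^2) * (- 8 * l + s^2)^2
      else (l + 2 * s^3) * (- l + 2 * s^3)^3)"

definition discr_red :: "nat \<Rightarrow> complex \<Rightarrow> complex \<Rightarrow> complex" where
  "discr_red p s l =
     (if p = 3 then s^3 - 27 * l^2
      else if p = 4 then s^4 - 64 * l^2
      else 4 * s^6 - l^2)"

definition modular_discr :: "complex \<Rightarrow> complex" where
  "modular_discr \<tau> =
     exp (2 * pi * \<i> * \<tau>) * prodinf (\<lambda>n. (1 - exp (2 * pi * \<i> * \<tau>) ^ Suc n) ^ 24)"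

end

theory Submission imports Defs begin

text \<open>
  On a fixed lattice, an elliptic function without poles is constant. Comparing divisors,
  \<open>\<wp>(z) - \<wp>(a)\<close> and \<open>\<wp>'(z)\<close> are therefore quotients of theta products, which turns the differences of the
  half-period values, and \<open>\<wp>'\<close> at the points of order three, into \<open>q\<close>-products. In particular
  \<open>g\<^sub>2\<^sup>3 - 27 g\<^sub>3\<^sup>2\<close> is \<open>(2\<pi>)\<^sup>1\<^sup>2 q \<Prod>(1 - q\<^sup>n)\<^sup>2\<^sup>4\<close>; being a lattice function, it gives the behaviour of
  \<open>\<eta>\<^sup>2\<^sup>4\<close>, and by continuity that of \<open>\<eta>\<close>, under \<open>\<tau> \<mapsto> -1/\<tau>\<close>. For type \<open>G\<^sub>2\<close>, the function \<open>\<zeta>\<close> minus the logarithmic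
  derivative of the theta product is linear, and the addition formula at a point of order three expresses its
  coordinates through \<open>g\<^sub>s\<close> and \<open>G\<^sub>3\<close>, so both discriminants factor into the same \<open>q\<close>-products.

  The inversion formula for \<open>\<eta>\<close> yields a Fricke relation for \<open>\<lambda>\<^sub>p\<close>, hence its transformation under the generators
  \<open>A\<close> and \<open>B\<close>, and the multiplier of the non-vanishing function \<open>\<lambda>\<^sub>p\<close> is the character. An
  anti-invariant form is antiperiodic at both cusps (infinity and 0), so it vanishes there at least to the order
  of \<open>\<delta>\<^sub>p\<close>, and division by \<open>\<delta>\<^sub>p\<close> stays holomorphic.
\<close>

subsection \<open>q-Pochhammer products\<close>

text \<open>With \<open>D = g_2^3 - 27 g_3^2\<close>, every full discriminant is a rational multiple
  of \<open>D\<close>. Put \<open>Y = G_4(1/2)\<close>, \<open>G = G_3(1/3)\<close>,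
  \<open>s = g_s\<close>, and let \<open>e\<close> be the value of the p-function at 1/2. Then
  \<open>D = 432 Y^2 (3 e^2 - 4 Y)\<close>, which serves p = 4, and
  \<open>D = 432 G^3 (4 s^3 - G)\<close>, which serves p = 6. The reduced discriminants have the
  same factors, but contain \<open>Y\<close> or \<open>G\<close> only once. So, besides the product
  for \<open>D\<close>, only those for \<open>Y\<close> and \<open>G\<close> are needed.

  For p = 6, \<open>g_s\<close> is made of zeta values, and the quasi-period of zeta is essentially
  an Eisenstein series of weight two. It is never evaluated: in
  \<open>zeta(1/3) - 2/3 zeta(1/2)\<close> a linear term cancels, as 1/3 = 2/3 times 1/2.

  No relations between the generators \<open>A\<close> and \<open>B\<close> have to be checked.
  Generation gives uniqueness of a character, and existence is read off from
  \<open>lambda_form p\<close>.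

  The arithmetic behind the table of N and k_p is \<open>(1 + N) k_p = 12\<close>. It makes
  \<open>delta_form p\<close> start with exactly q^(1/2), the smallest exponent that antiperiodicity
  allows.\<close>

definition qpoch :: "complex \<Rightarrow> complex \<Rightarrow> complex" where
  "qpoch x q = prodinf (\<lambda>n. 1 - x * q ^ n)"

lemma convergent_prod_qpoch:
  fixes x q :: complex
  assumes "norm q < 1"
  shows "convergent_prod (\<lambda>n. 1 - x * q ^ n)"
proof -
  have "summable (\<lambda>n. norm x * norm q ^ n)"
    using assms by (intro summable_mult summable_geometric) auto
  then have "abs_convergent_prod (\<lambda>n. 1 - x * q ^ n)"
    by (intro summable_imp_abs_convergent_prod) (simp add: norm_mult norm_power)
  then show ?thesis
    by (rule abs_convergent_prod_imp_convergent_prod)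
qed

lemma qpoch_tendsto:
  assumes "norm q < 1"
  shows "(\<lambda>n. \<Prod>i<n. 1 - x * q ^ i) \<longlonglongrightarrow> qpoch x q"
  using convergent_prod_LIMSEQ[OF convergent_prod_qpoch[OF assms]]
  unfolding qpoch_def LIMSEQ_lessThan_iff_atMost .

lemma qpoch_eq_0_iff:
  assumes "norm q < 1"
  shows "qpoch x q = 0 \<longleftrightarrow> (\<exists>n. x * q ^ n = 1)"
  using has_prod_eq_0_iff[OF convergent_prod_has_prod[OF convergent_prod_qpoch[OF assms]], of x]
  unfolding qpoch_def by (auto simp: image_iff)

lemma qpoch_nonzero:
  assumes "norm q < 1" "norm x < 1"
  shows "qpoch x q \<noteq> 0"
proof -
  have "norm (x * q ^ n) < 1" for n
  proof -
    have "norm (x * q ^ n) \<le> norm x * 1"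
      unfolding norm_mult norm_power using assms by (intro mult_left_mono power_le_one) auto
    then show ?thesis using assms by simp
  qed
  then show ?thesis
    unfolding qpoch_eq_0_iff[OF assms(1)] by (metis norm_one order_less_irrefl)
qed

lemma qpoch_rec:
  assumes "norm q < 1"
  shows "qpoch x q = (1 - x) * qpoch (x * q) q"
proof (rule LIMSEQ_unique)
  show "(\<lambda>n. \<Prod>i<Suc n. 1 - x * q ^ i) \<longlonglongrightarrow> qpoch x q"
    using qpoch_tendsto[OF assms] by (rule LIMSEQ_Suc)
  have "(\<lambda>n. (1 - x) * (\<Prod>i<n. 1 - (x * q) * q ^ i)) \<longlonglongrightarrow> (1 - x) * qpoch (x * q) q"
    by (intro tendsto_intros qpoch_tendsto assms)
  then show "(\<lambda>n. \<Prod>i<Suc n. 1 - x * q ^ i) \<longlonglongrightarrow> (1 - x) * qpoch (x * q) q"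
    by (subst prod.lessThan_Suc_shift) (simp add: mult.assoc)
qed

lemma qpoch_square:
  assumes "norm q < 1"
  shows "qpoch x q * qpoch (- x) q = qpoch (x^2) (q^2)"
proof -
  have "norm (q^2) < 1"
    using assms by (simp add: norm_power power_less_one_iff)
  moreover have "(1 - x * q ^ n) * (1 - (- x) * q ^ n) = 1 - x^2 * (q^2) ^ n" for n
    by (simp add: algebra_simps power2_eq_square power_mult_distrib flip: power_mult)
  ultimately show ?thesis
    unfolding qpoch_def
    using assms convergent_prod_qpoch[OF assms] by (subst prodinf_mult) (blast, blast, simp)
qed

text \<open>The hypothesis makes 1, \<open>\<rho>\<close>, \<open>\<rho>^2\<close> the three cube
  roots of unity, so the identity already holds for each index of the product.\<close>

lemma qpoch_cube:
  assumes "norm q < 1" "\<rho>^2 + \<rho> + 1 = 0"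
  shows "qpoch x q * qpoch (\<rho> * x) q * qpoch (\<rho>^2 * x) q = qpoch (x^3) (q^3)"
proof -
  have "norm (q^3) < 1"
    using assms by (simp add: norm_power power_less_one_iff)
  have *: "(1 - y) * (1 - \<rho> * y) * (1 - \<rho>^2 * y) = 1 - y^3" for y
    using assms(2) by algebra
  have "(1 - x * q ^ n) * (1 - (\<rho> * x) * q ^ n) * (1 - (\<rho>^2 * x) * q ^ n) = 1 - x^3 * (q^3) ^ n" for n
    using *[of "x * q ^ n"] by (simp add: mult_ac power_mult_distrib flip: power_mult)
  then show ?thesis
    unfolding qpoch_def using convergent_prod_qpoch[OF assms(1)]
    by (simp only: prodinf_mult convergent_prod_mult)
qed

text \<open>Indices are sorted by parity. Only partial products of even length are compared, a
  subsequence of a convergent sequence.\<close>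

lemma qpoch_even_odd:
  assumes "norm q < 1"
  shows "qpoch x q = qpoch x (q^2) * qpoch (x * q) (q^2)"
proof (rule LIMSEQ_unique)
  show "(\<lambda>n. \<Prod>i<2*n. 1 - x * q ^ i) \<longlonglongrightarrow> qpoch x q"
    using filterlim_compose[OF qpoch_tendsto[OF assms], of "\<lambda>n. 2 * n" sequentially x]
      mult_nat_left_at_top[of 2] by simp
  have q2: "norm (q^2) < 1"
    using assms by (simp add: norm_power power_less_one_iff)
  have eq: "(\<Prod>i<2*n. 1 - x * q ^ i) = (\<Prod>i<n. 1 - x * (q^2) ^ i) * (\<Prod>i<n. 1 - (x * q) * (q^2) ^ i)" for n
    by (induction n) (simp_all add: power_mult algebra_simps flip: power_mult)
  show "(\<lambda>n. \<Prod>i<2*n. 1 - x * q ^ i) \<longlonglongrightarrow> qpoch x (q^2) * qpoch (x * q) (q^2)"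
    unfolding eq by (intro tendsto_intros qpoch_tendsto q2)
qed

text \<open>On a closed disc inside \<open>A\<close> the summable bound makes the partial products
  converge uniformly, and a uniform limit of holomorphic functions is holomorphic. Holomorphy is
  local, so discs suffice.\<close>

lemma holomorphic_on_prodinf:
  fixes f :: "nat \<Rightarrow> complex \<Rightarrow> complex"
  assumes "open A"
    and hol: "\<And>n. f n holomorphic_on A"
    and bound: "\<And>K. compact K \<Longrightarrow> K \<subseteq> A \<Longrightarrow> \<exists>M. summable M \<and> (\<forall>n. \<forall>x\<in>K. norm (f n x - 1) \<le> M n)"
  shows "(\<lambda>x. prodinf (\<lambda>n. f n x)) holomorphic_on A"
proof -
  have lim: "(\<lambda>n. \<Prod>i<n. f i x) \<longlonglongrightarrow> prodinf (\<lambda>n. f n x)" if "x \<in> A" for x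
  proof -
    obtain M where M: "summable M" "\<And>n. norm (f n x - 1) \<le> M n"
      using bound[of "{x}"] \<open>x \<in> A\<close> by auto
    have "summable (\<lambda>n. norm (f n x - 1))"
      by (rule summable_comparison_test'[OF M(1)]) (use M(2) in auto)
    then have "convergent_prod (\<lambda>n. f n x)"
      by (intro abs_convergent_prod_imp_convergent_prod summable_imp_abs_convergent_prod)
    from convergent_prod_LIMSEQ[OF this] show ?thesis
      unfolding LIMSEQ_lessThan_iff_atMost .
  qed
  have "(\<lambda>x. prodinf (\<lambda>n. f n x)) holomorphic_on ball z r" if r: "cball z r \<subseteq> A" for z r
  proof -
    have "uniformly_convergent_on (cball z r) (\<lambda>N x. \<Prod>n<N. f n x)"
    proof (rule uniformly_convergent_on_prod')
      show "continuous_on (cball z r) (f n)" for n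
        using holomorphic_on_imp_continuous_on[OF holomorphic_on_subset[OF hol r]] .
      obtain M where M: "summable M" "\<And>n x. x \<in> cball z r \<Longrightarrow> norm (f n x - 1) \<le> M n"
        using bound[of "cball z r"] r by auto
      show "uniformly_convergent_on (cball z r) (\<lambda>N x. \<Sum>n<N. norm (f n x - 1))"
        by (rule Weierstrass_m_test'[OF _ M(1)]) (use M(2) in auto)
    qed auto
    then obtain g where g: "uniform_limit (cball z r) (\<lambda>N x. \<Prod>n<N. f n x) g sequentially"
      by (auto simp: uniformly_convergent_on_def)
    have geq: "g x = prodinf (\<lambda>n. f n x)" if "x \<in> cball z r" for x
      using LIMSEQ_unique[OF tendsto_uniform_limitI[OF g that] lim] that r by auto
    have "g holomorphic_on ball z r"
    proof (rule holomorphic_uniform_limit[OF _ g])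
      show "\<forall>\<^sub>F n in sequentially. continuous_on (cball z r) (\<lambda>x. \<Prod>n<n. f n x) \<and>
              (\<lambda>x. \<Prod>n<n. f n x) holomorphic_on ball z r"
        using hol r ball_subset_cball[of z r]
        by (intro always_eventually allI conjI holomorphic_on_imp_continuous_on holomorphic_intros)
           (blast intro: holomorphic_on_subset)+
    qed auto
    then show ?thesis
      by (rule holomorphic_transform) (use geq in auto)
  qed
  then show ?thesis
    using \<open>open A\<close> unfolding holomorphic_on_def
    by (metis at_within_open centre_in_ball holomorphic_on_def holomorphic_on_imp_differentiable_at
        open_ball open_contains_cball_eq)
qed

lemma holomorphic_qpoch_left:
  assumes "norm q < 1" "f holomorphic_on A"
  shows "(\<lambda>z. qpoch (f z) q) holomorphic_on A"
proof -
  have "(\<lambda>x. qpoch x q) holomorphic_on UNIV"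
    unfolding qpoch_def
  proof (rule holomorphic_on_prodinf)
    fix K :: "complex set" assume "compact K"
    then obtain B where B: "\<And>x. x \<in> K \<Longrightarrow> norm x \<le> B"
      using compact_imp_bounded bounded_iff by metis
    show "\<exists>M. summable M \<and> (\<forall>n. \<forall>x\<in>K. norm ((1 - x * q ^ n) - 1) \<le> M n)"
    proof (intro exI[of _ "\<lambda>n. B * norm q ^ n"] conjI allI ballI)
      show "summable (\<lambda>n. B * norm q ^ n)"
        using assms by (intro summable_mult summable_geometric) auto
      show "norm ((1 - x * q ^ n) - 1) \<le> B * norm q ^ n" if "x \<in> K" for n x
        using B[OF that] by (simp add: norm_mult norm_power mult_right_mono)
    qed
  qed (auto intro!: holomorphic_intros)
  then show ?thesis
    using holomorphic_on_compose_gen[OF assms(2), of "\<lambda>x. qpoch x q" UNIV] by (simp add: o_def)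
qed

abbreviation euler_phi :: "complex \<Rightarrow> complex" where
  "euler_phi q \<equiv> qpoch q q"

lemma holomorphic_euler_phi: "euler_phi holomorphic_on ball 0 1"
  unfolding qpoch_def
proof (rule holomorphic_on_prodinf)
  fix K :: "complex set" assume K: "compact K" "K \<subseteq> ball 0 1"
  have "\<exists>r<1. \<forall>x\<in>K. norm x \<le> r"
  proof (cases "K = {}")
    case False
    then obtain y where "y \<in> K" "\<forall>x\<in>K. norm x \<le> norm y"
      using continuous_attains_sup[OF K(1), of norm] by (auto intro: continuous_intros)
    with K(2) show ?thesis by (intro exI[of _ "norm y"]) auto
  qed (auto intro: exI[of _ 0])
  then obtain r where r: "r < 1" "\<And>x. x \<in> K \<Longrightarrow> norm x \<le> r" by blast
  define s where "s = max r 0"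
  have s: "s < 1" "s \<ge> 0" "\<And>x. x \<in> K \<Longrightarrow> norm x \<le> s"
    using r by (auto simp: s_def le_max_iff_disj)
  show "\<exists>M. summable M \<and> (\<forall>n. \<forall>x\<in>K. norm ((1 - x * x ^ n) - 1) \<le> M n)"
  proof (intro exI[of _ "\<lambda>n. s * s ^ n"] conjI allI ballI)
    show "summable (\<lambda>n. s * s ^ n)"
      using s by (intro summable_mult summable_geometric) auto
    show "norm ((1 - x * x ^ n) - 1) \<le> s * s ^ n" if "x \<in> K" for n x
      using s(3)[OF that] s(2) by (simp add: norm_mult norm_power mult_mono power_mono)
  qed
qed (auto intro!: holomorphic_intros)

lemma euler_phi_nonzero: "norm q < 1 \<Longrightarrow> euler_phi q \<noteq> 0"
  by (rule qpoch_nonzero)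

lemma euler_phi_minus:
  assumes "norm q < 1"
  shows "euler_phi q * qpoch (- q) q = euler_phi (q^2)"
  using qpoch_square[OF assms, of q] by simp

text \<open>Euler's identity between partitions into odd parts and partitions into distinct parts.
  It is what makes the product of the three theta values at the half periods a plain number.\<close>

lemma euler_odd_distinct:
  assumes "norm q < 1"
  shows "qpoch q (q^2) * qpoch (- q) q = 1"
proof -
  have q2: "norm (q^2) < 1"
    using assms by (simp add: norm_power power_less_one_iff)
  have "qpoch q (q^2) * euler_phi (q^2) * qpoch (- q) q = euler_phi (q^2)"
    using euler_phi_minus[OF assms] qpoch_even_odd[OF assms, of q]
    by (simp add: power2_eq_square)
  then show ?thesis
    using euler_phi_nonzero[OF q2] by (simp add: mult_ac)
qed

subsection \<open>The theta product\<close>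

text \<open>The product of Jacobi's triple product identity without its factor
  \<open>euler_phi q\<close>, in the multiplicative coordinate \<open>w\<close>.\<close>

definition theta :: "complex \<Rightarrow> complex \<Rightarrow> complex" where
  "theta q w = qpoch w q * qpoch (q / w) q"

lemma theta_1: "norm q < 1 \<Longrightarrow> theta q 1 = 0"
  unfolding theta_def by (subst qpoch_rec) auto

text \<open>Once the factor \<open>1 - w\<close> is split off, the rest is symmetric under inversion
  of \<open>w\<close>, and \<open>1 - 1 / w = - (1 - w) / w\<close>.\<close>

lemma theta_inverse:
  assumes "norm q < 1" "w \<noteq> 0"
  shows "theta q (1 / w) = - theta q w / w"
proof -
  have "theta q (1 / w) = (1 - 1 / w) * qpoch (q / w) q * qpoch (w * q) q"
    unfolding theta_def by (subst qpoch_rec[OF assms(1), of "1 / w"]) (simp add: mult_ac)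
  moreover have "theta q w = (1 - w) * qpoch (w * q) q * qpoch (q / w) q"
    unfolding theta_def by (subst qpoch_rec[OF assms(1), of w]) simp
  ultimately have "w * theta q (1 / w) = - theta q w"
    using assms(2) by (simp add: divide_simps) algebra
  then show ?thesis
    using assms(2) by (simp add: field_simps)
qed

text \<open>The two factors of \<open>theta q (q * w)\<close> are those of
  \<open>theta q (1 / w)\<close> in the other order.\<close>

lemma theta_shift:
  assumes "norm q < 1" "w \<noteq> 0" "q \<noteq> 0"
  shows "theta q (q * w) = - theta q w / w"
  using theta_inverse[OF assms(1,2)] assms(2,3) by (simp add: theta_def mult_ac)

lemma theta_eq_0:
  assumes "norm q < 1" "q \<noteq> 0" "w \<noteq> 0" "theta q w = 0"
  shows "\<exists>n::int. w = q powi n"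
proof -
  consider n where "w * q ^ n = 1" | n where "q / w * q ^ n = 1"
    using assms(4) unfolding theta_def by (auto simp: qpoch_eq_0_iff[OF assms(1)])
  then show ?thesis
  proof cases
    case 1
    then have "w = q powi (- int n)"
      using assms(2) by (simp add: power_int_minus field_simps)
    then show ?thesis by blast
  next
    case 2
    then have "w = q powi int (Suc n)"
      using assms(2,3) by (simp add: field_simps del: of_nat_Suc)
    then show ?thesis by blast
  qed
qed

lemma theta_minus_1:
  assumes "norm q < 1"
  shows "theta q (-1) * (euler_phi q)^2 = 2 * (euler_phi (q^2))^2"
proof -
  have "theta q (-1) = 2 * qpoch (- q) q ^ 2"
    unfolding theta_def by (subst qpoch_rec[OF assms]) (simp add: power2_eq_square)
  then show ?thesis
    by (simp add: algebra_simps power_mult_distrib flip: euler_phi_minus[OF assms])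
qed

text \<open>The arguments \<open>s\<close>, \<open>- s\<close>, \<open>-1\<close> are the
  exponentials of the three half periods. As \<open>q / s = s\<close>, the first two values are
  squares; together they give the product over odd powers of \<open>q\<close>, and Euler's identity
  cancels it against the value at -1.\<close>

lemma theta_half_periods:
  assumes "norm q < 1" "s^2 = q" "s \<noteq> 0"
  shows "theta q s * theta q (- s) * theta q (-1) = 2"
proof -
  have s: "norm s < 1"
    using assms(1,2) by (metis norm_power norm_ge_zero power_less_one_iff zero_less_numeral)
  have qs: "q / s = s" "q / (- s) = - s"
    using assms(2,3) by (auto simp: power2_eq_square field_simps)
  have m1: "theta q (-1) = 2 * qpoch (- q) q ^ 2"
    unfolding theta_def by (subst qpoch_rec[OF assms(1)]) (simp add: power2_eq_square)
  have "theta q s * theta q (- s) = (qpoch s q * qpoch (- s) q)^2"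
    unfolding theta_def qs by (simp add: power2_eq_square mult_ac)
  also have "\<dots> = (qpoch q (q^2))^2"
    using qpoch_square[OF assms(1), of s] assms(2) by simp
  finally have "theta q s * theta q (- s) * theta q (-1) = 2 * (qpoch q (q^2) * qpoch (- q) q)^2"
    unfolding m1 by (simp add: power_mult_distrib)
  then show ?thesis
    using euler_odd_distinct[OF assms(1)] by simp
qed

text \<open>Since \<open>q / \<rho> = \<rho>^2 * q\<close>, the theta value lacks only one of the
  three factors of \<open>qpoch_cube\<close>, and multiplication by \<open>euler_phi q\<close>
  supplies it.\<close>

lemma theta_cube_root_1:
  assumes "norm q < 1" "\<rho>^2 + \<rho> + 1 = 0"
  shows "theta q \<rho> * euler_phi q = (1 - \<rho>) * euler_phi (q^3)"
proof -
  have "\<rho> \<noteq> 0" "\<rho>^3 = 1"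
    using assms(2) by auto algebra
  then have r: "q / \<rho> = \<rho>^2 * q"
    by (simp add: field_simps power2_eq_square power3_eq_cube)
  have "theta q \<rho> * euler_phi q = (1 - \<rho>) * (euler_phi q * qpoch (\<rho> * q) q * qpoch (\<rho>^2 * q) q)"
    unfolding theta_def r by (subst qpoch_rec[OF assms(1), of \<rho>]) simp
  then show ?thesis
    using qpoch_cube[OF assms, of q] by simp
qed

subsection \<open>Lattice sums\<close>

abbreviation lat :: "complex \<Rightarrow> complex set" where
  "lat \<tau> \<equiv> period_lattice (1, \<tau>)"

lemma lat_eq: "lat \<tau> = range (\<lambda>(m::int, n::int). of_int m + of_int n * \<tau>)"
  unfolding period_lattice_def by (auto simp: image_iff)

lemma lattice_norm_lower_bound:
  assumes "Im \<tau> > 0"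
  obtains c where "c > 0" "\<And>m n :: int. c * (of_int m^2 + of_int n^2) \<le> norm (of_int m + of_int n * \<tau>)^2"
proof -
  define x y where "x = Re \<tau>" and "y = Im \<tau>"
  have y: "y > 0" using assms by (simp add: y_def)
  \<comment> \<open>\<open>C\<close> has to dominate both coefficients in
    \<open>(a - b x)^2 + b^2 \<le> 2 a^2 + (2 x^2 + 1) b^2\<close>, measured against
    \<open>a^2 + y^2 b^2\<close>.\<close>
  define C where "C = 2 + (2 * x^2 + 1) / y^2"
  have C: "C > 0" "C \<ge> 2" "C * y^2 \<ge> 2 * x^2 + 1"
    using y by (auto simp: C_def field_simps add_nonneg_pos)
  have "1 / C * (of_int m^2 + of_int n^2) \<le> norm (of_int m + of_int n * \<tau>)^2" for m n :: int
  proof -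
    define a b where "a = of_int m + of_int n * x" and "b = (of_int n :: real)"
    have "norm (of_int m + of_int n * \<tau>)^2 = a^2 + b^2 * y^2"
      unfolding cmod_power2 by (simp add: a_def b_def x_def y_def power_mult_distrib)
    moreover have "of_int m = a - b * x"
      by (simp add: a_def b_def)
    moreover have "(a - b * x)^2 + b^2 \<le> C * (a^2 + b^2 * y^2)"
    proof -
      have "(a - b * x)^2 + b^2 \<le> 2 * a^2 + b^2 * (2 * x^2 + 1)"
        using zero_le_power2[of "a + b * x"] by (simp add: power2_eq_square algebra_simps)
      also have "\<dots> \<le> C * a^2 + b^2 * (C * y^2)"
        using C by (intro add_mono mult_right_mono mult_left_mono) auto
      finally show ?thesis by (simp add: algebra_simps)
    qed
    ultimately have "(of_int m)^2 + (of_int n)^2 \<le> C * norm (of_int m + of_int n * \<tau>)^2"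
      by (simp flip: b_def)
    then show ?thesis
      using C(1) by (simp add: divide_simps mult.commute)
  qed
  then show ?thesis
    using that[of "1 / C"] C(1) by simp
qed

lemma summable_on_int_powr: "(\<lambda>m::int. (1 + of_int \<bar>m\<bar>) powr (- 3/2) :: real) summable_on UNIV"
proof -
  have "summable (\<lambda>n. of_nat (Suc n) powr (- 3/2) :: real)"
    by (subst summable_Suc_iff) (simp add: summable_real_powr_iff)
  then have s: "(\<lambda>n::nat. (1 + real n) powr (- 3/2)) summable_on UNIV"
    by (subst summable_on_UNIV_nonneg_real_iff) (auto simp: add.commute)
  have 1: "(\<lambda>m::int. (1 + of_int \<bar>m\<bar>) powr (- 3/2) :: real) summable_on range int"
    by (subst summable_on_reindex) (use s in \<open>auto simp: o_def\<close>)
  have 2: "(\<lambda>m::int. (1 + of_int \<bar>m\<bar>) powr (- 3/2) :: real) summable_on range (\<lambda>n. - int n)"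
    by (subst summable_on_reindex) (use s in \<open>auto simp: o_def inj_on_def\<close>)
  have "(\<lambda>m::int. (1 + of_int \<bar>m\<bar>) powr (- 3/2) :: real) summable_on range (\<lambda>n. - int n) - range int"
    by (rule summable_on_subset_banach[OF 2]) auto
  from summable_on_Un_disjoint[OF 1 this] have
    "(\<lambda>m::int. (1 + of_int \<bar>m\<bar>) powr (- 3/2) :: real) summable_on range int \<union> (range (\<lambda>n. - int n) - range int)"
    by auto
  moreover have "range int \<union> (range (\<lambda>n. - int n) - range int) = UNIV"
  proof -
    have "m \<in> range int \<union> range (\<lambda>n. - int n)" for m
      by (cases m rule: int_cases2) auto
    then show ?thesis by auto
  qed
  ultimately show ?thesis by metis
qed

text \<open>The double sum is dominated by a product of two sums over the integers:
  \<open>(1 + \<bar>m\<bar>) (1 + \<bar>n\<bar>) \<le> 4 (m^2 + n^2)\<close> off the origin, so the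
  inverse cube of the norm is at most a multiple of two factors with exponent -3/2, each
  summable.\<close>

lemma summable_lattice_cube:
  assumes "Im \<tau> > 0"
  shows "(\<lambda>w. 1 / norm w ^ 3) summable_on (lat \<tau> - {0})"
proof -
  obtain c where c: "c > 0" "\<And>m n :: int. c * (of_int m^2 + of_int n^2) \<le> norm (of_int m + of_int n * \<tau>)^2"
    using lattice_norm_lower_bound[OF assms] by blast
  define f where "f = (\<lambda>(m::int, n::int). of_int m + of_int n * \<tau>)"
  define g where "g = (\<lambda>m::int. (1 + of_int \<bar>m\<bar>) powr (- 3/2) :: real)"
  have g0: "g m \<ge> 0" for m by (simp add: g_def)
  have inj: "inj f"
  proof (rule injI)
    fix a b assume ab: "f a = f b"
    obtain m n k l where ml: "a = (m, n)" "b = (k, l)" by fastforce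
    have "c * (of_int (m - k)^2 + of_int (n - l)^2) \<le> norm (f a - f b)^2"
    proof -
      have "f a - f b = of_int (m - k) + of_int (n - l) * \<tau>"
        by (simp add: f_def ml algebra_simps)
      then show ?thesis using c(2)[of "m - k" "n - l"] by metis
    qed
    then have "c * (of_int (m - k)^2 + of_int (n - l)^2) \<le> 0"
      unfolding ab by (simp only: diff_self norm_zero zero_power2)
    then have "real_of_int (m - k)^2 + of_int (n - l)^2 \<le> 0"
      using c(1) by (simp only: mult_le_0_iff) linarith
    then have "real_of_int (m - k) = 0 \<and> real_of_int (n - l) = 0"
      by (metis sum_power2_gt_zero_iff not_le)
    then have "m = k" "n = l" by linarith+
    then show "a = b" by (simp add: ml)
  qed
  have f0: "f a = 0 \<longleftrightarrow> a = (0, 0)" for a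
    using inj_eq[OF inj, of a "(0, 0)"] by (simp add: f_def)
  have "(\<lambda>(m, n). g m * g n) summable_on UNIV \<times> UNIV"
  proof (rule summable_on_SigmaI)
    show "((\<lambda>n. (\<lambda>(m, n). g m * g n) (m, n)) has_sum g m * infsum g UNIV) UNIV" for m
      unfolding case_prod_conv
      by (intro has_sum_cmult_right has_sum_infsum) (use summable_on_int_powr in \<open>simp add: g_def\<close>)
    show "(\<lambda>m. g m * infsum g UNIV) summable_on UNIV"
      by (intro summable_on_cmult_left) (use summable_on_int_powr in \<open>simp add: g_def\<close>)
  qed (auto simp: g0)
  then have "(\<lambda>(m, n). (4 / c) powr (3/2) * (g m * g n)) summable_on UNIV - {(0, 0)}"
    using summable_on_cmult_right[of "\<lambda>(m, n). g m * g n" "UNIV - {(0, 0)}" "(4 / c) powr (3/2)"]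
          summable_on_subset_banach[of "\<lambda>(m, n). g m * g n" UNIV "UNIV - {(0, 0)}"]
    by (simp add: case_prod_unfold)
  then have "(\<lambda>a. 1 / norm (f a) ^ 3) summable_on UNIV - {(0, 0)}"
  proof (rule summable_on_comparison_test)
    fix a :: "int \<times> int" assume "a \<in> UNIV - {(0, 0)}"
    then obtain m n where a: "a = (m, n)" "m \<noteq> 0 \<or> n \<noteq> 0" by (cases a) auto
    define N where "N = norm (f a)"
    have N: "N > 0" using f0[of a] a by (auto simp: N_def)
    define u v where "u = real_of_int \<bar>m\<bar>" and "v = real_of_int \<bar>n\<bar>"
    have "u \<ge> 0" "v \<ge> 0" by (auto simp: u_def v_def)
    have "\<bar>m\<bar> \<ge> 1 \<or> \<bar>n\<bar> \<ge> 1" using a(2) by linarith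
    then have uv: "u \<ge> 1 \<or> v \<ge> 1" unfolding u_def v_def by linarith
    have ineq: "(1 + u) * (1 + v) \<le> 4 * (u^2 + v^2)"
    proof -
      have "1 \<le> u^2 + v^2"
        using uv \<open>u \<ge> 0\<close> \<open>v \<ge> 0\<close> by (metis add_increasing add_increasing2 one_le_power zero_le_power2)
      moreover have "2 * u \<le> 1 + u^2" "2 * v \<le> 1 + v^2" "2 * (u * v) \<le> u^2 + v^2"
        using zero_le_power2[of "u - 1"] zero_le_power2[of "v - 1"] zero_le_power2[of "u - v"]
        by (simp_all add: power2_eq_square algebra_simps)
      ultimately show ?thesis by (simp add: algebra_simps)
    qed
    have "c * (u^2 + v^2) \<le> N^2"
      using c(2)[of m n] by (simp add: N_def f_def a u_def v_def)
    then have "(1 + u) * (1 + v) \<le> 4 / c * N^2"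
    proof -
      have "4 * (u^2 + v^2) = 4 / c * (c * (u^2 + v^2))" using c(1) by simp
      also have "\<dots> \<le> 4 / c * N^2"
        using c(1) \<open>c * (u^2 + v^2) \<le> N^2\<close> by (intro mult_left_mono) auto
      finally show ?thesis using ineq by simp
    qed
    then have "((1 + u) * (1 + v)) powr (3/2) \<le> (4 / c * N^2) powr (3/2)"
      using \<open>u \<ge> 0\<close> \<open>v \<ge> 0\<close> by (intro powr_mono2) auto
    also have "\<dots> = (4 / c) powr (3/2) * (N^2) powr (3/2)"
      by (rule powr_mult)
    also have "(N^2) powr (3/2) = N ^ 3"
      using N powr_powr[of N 2 "3/2"] by (simp flip: powr_numeral)
    finally have "((1 + u) * (1 + v)) powr (3/2) \<le> (4 / c) powr (3/2) * N ^ 3" .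
    moreover have "g m * g n = 1 / ((1 + u) * (1 + v)) powr (3/2)"
      using \<open>u \<ge> 0\<close> \<open>v \<ge> 0\<close> by (simp add: g_def u_def v_def powr_mult powr_minus_divide)
    moreover have "((1 + u) * (1 + v)) powr (3/2) > 0"
      using \<open>u \<ge> 0\<close> \<open>v \<ge> 0\<close> by simp
    moreover have "1 / N ^ 3 \<le> K * (1 / P)" if "P \<le> K * N ^ 3" "P > 0" for P K :: real
      using that N by (simp add: field_simps)
    ultimately show "1 / norm (f a) ^ 3 \<le> (case a of (m, n) \<Rightarrow> (4 / c) powr (3/2) * (g m * g n))"
      unfolding N_def[unfolded a(1), symmetric] a(1) case_prod_conv by presburger
  qed auto
  then have "(\<lambda>w. 1 / norm w ^ 3) summable_on f ` (UNIV - {(0, 0)})"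
    by (subst summable_on_reindex) (use inj in \<open>auto simp: o_def inj_on_def\<close>)
  also have "f ` (UNIV - {(0, 0)}) = lat \<tau> - {0}"
    using f0 unfolding lat_eq f_def[symmetric] by (auto simp: image_iff)
  finally show ?thesis .
qed

lemma higher_deriv_sum_complex:
  fixes f :: "'a \<Rightarrow> complex \<Rightarrow> complex"
  assumes "finite X" "\<And>x. x \<in> X \<Longrightarrow> f x holomorphic_on S" "open S" "z \<in> S"
  shows "(deriv ^^ n) (\<lambda>z. \<Sum>x\<in>X. f x z) z = (\<Sum>x\<in>X. (deriv ^^ n) (f x) z)"
  using assms(1,2)
proof (induction X)
  case (insert x X)
  then show ?case
    by (simp add: higher_deriv_add[OF _ _ assms(3,4)] holomorphic_on_sum)
qed simp

lemma lat_zero [simp]: "0 \<in> lat \<tau>"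
  unfolding lat_eq by (auto intro!: image_eqI[of _ _ "(0, 0)"])

lemma lat_diff: "x \<in> lat \<tau> \<Longrightarrow> y \<in> lat \<tau> \<Longrightarrow> x - y \<in> lat \<tau>"
proof -
  assume "x \<in> lat \<tau>" "y \<in> lat \<tau>"
  then obtain m n k l where "x = of_int m + of_int n * \<tau>" "y = of_int k + of_int l * \<tau>"
    unfolding lat_eq by auto
  then have "x - y = of_int (m - k) + of_int (n - l) * \<tau>"
    by (simp add: algebra_simps)
  then show ?thesis unfolding lat_eq by (intro image_eqI[of _ _ "(m - k, n - l)"]) auto
qed

lemma lat_uminus_iff [simp]: "- x \<in> lat \<tau> \<longleftrightarrow> x \<in> lat \<tau>"
  using lat_diff[of 0 \<tau> x] lat_diff[of 0 \<tau> "- x"] by auto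

lemma lat_add_iff: "y \<in> lat \<tau> \<Longrightarrow> x + y \<in> lat \<tau> \<longleftrightarrow> x \<in> lat \<tau>"
  using lat_diff[of x \<tau> "- y"] lat_diff[of "x + y" \<tau> y] by auto

lemma lat_periods: "1 \<in> lat \<tau>" "\<tau> \<in> lat \<tau>"
  unfolding lat_eq by (rule image_eqI[of _ _ "(1, 0)"]; simp) (rule image_eqI[of _ _ "(0, 1)"]; simp)

section \<open>The regular part of the zeta function and termwise differentiation\<close>

definition zterm :: "complex \<Rightarrow> complex \<Rightarrow> complex" where
  "zterm w z = 1 / (z - w) + 1 / w + z / w^2"

text \<open>Closed form of the \<open>n\<close>-th derivative of \<open>zterm w\<close>. The
  correction terms form a polynomial of degree one in \<open>z\<close>, so they survive only in
  orders 0 and 1.\<close>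

definition zterm_deriv :: "nat \<Rightarrow> complex \<Rightarrow> complex \<Rightarrow> complex" where
  "zterm_deriv n w z = (if n = 0 then zterm w z else if n = 1 then - 1 / (z - w)^2 + 1 / w^2
     else (-1) ^ n * fact n / (z - w) ^ Suc n)"

lemma zterm_deriv_deriv:
  assumes "z \<noteq> w"
  shows "(zterm_deriv n w has_field_derivative zterm_deriv (Suc n) w z) (at z)"
proof -
  have gen: "((\<lambda>z. (-1) ^ n * fact n / (z - w) ^ Suc n) has_field_derivative
      (-1) ^ Suc n * fact (Suc n) / (z - w) ^ Suc (Suc n)) (at z)" for n
  proof -
    have "((\<lambda>z. (-1) ^ n * fact n / (z - w) ^ Suc n) has_field_derivative
        - ((-1) ^ n * fact n * (of_nat (Suc n) * (z - w) ^ n)) / ((z - w) ^ Suc n)^2) (at z)"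
    proof -
      have "((\<lambda>z. (z - w) ^ Suc n) has_field_derivative of_nat (Suc n) * (z - w) ^ n) (at z)"
        by (auto intro!: derivative_eq_intros simp del: power_Suc)
      from DERIV_divide[OF DERIV_const this, of "(-1) ^ n * fact n"] show ?thesis
        using assms by (simp add: power2_eq_square del: power_Suc)
    qed
    also have "- ((-1) ^ n * fact n * (of_nat (Suc n) * (z - w) ^ n)) / ((z - w) ^ Suc n)^2
        = (-1) ^ Suc n * fact (Suc n) / (z - w) ^ Suc (Suc n)"
      using assms by (simp add: divide_simps power2_eq_square)
    finally show ?thesis .
  qed
  consider "n = 0" | "n = 1" | k where "n = Suc (Suc k)"
    by (metis One_nat_def not0_implies_Suc)
  then show ?thesis
  proof cases
    case 1
    then show ?thesis unfolding zterm_deriv_def zterm_def using assms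
      by (cases "w = 0") (auto intro!: derivative_eq_intros simp: power2_eq_square)
  next
    case 2
    have "zterm_deriv 1 w = (\<lambda>z. (-1) ^ 1 * fact 1 / (z - w) ^ Suc 1 + 1 / w^2)"
      by (simp add: zterm_deriv_def fun_eq_iff power2_eq_square)
    with 2 DERIV_add[OF gen[of 1] DERIV_const[of "1 / w^2"]] show ?thesis
      by (simp add: zterm_deriv_def)
  next
    case 3
    then have "zterm_deriv n w = (\<lambda>z. (-1) ^ n * fact n / (z - w) ^ Suc n)"
      "zterm_deriv (Suc n) w z = (-1) ^ Suc n * fact (Suc n) / (z - w) ^ Suc (Suc n)"
      by (simp_all only: zterm_deriv_def fun_eq_iff) simp_all
    with gen[of n] show ?thesis by simp
  qed
qed

context
  fixes \<tau> :: complex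
  assumes Im: "Im \<tau> > 0"
begin

lemma lat_coords_unique:
  fixes x y :: real
  assumes "of_real x + of_real y * \<tau> \<in> lat \<tau>"
  shows "x \<in> \<int>" "y \<in> \<int>"
proof -
  obtain m n :: int where mn: "of_real x + of_real y * \<tau> = of_int m + of_int n * \<tau>"
    using assms unfolding lat_eq by auto
  from arg_cong[OF this, of Im] have "y = of_int n"
    using Im by simp
  moreover from arg_cong[OF mn, of Re] calculation have "x = of_int m" by simp
  ultimately show "x \<in> \<int>" "y \<in> \<int>" by auto
qed

lemma lat_separated: obtains e where "e > 0" "\<And>x y. x \<in> lat \<tau> \<Longrightarrow> y \<in> lat \<tau> \<Longrightarrow> dist x y < e \<Longrightarrow> x = y"
proof -
  obtain c where c: "c > 0" "\<And>m n :: int. c * (of_int m^2 + of_int n^2) \<le> norm (of_int m + of_int n * \<tau>)^2"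
    using lattice_norm_lower_bound[OF Im] by blast
  have "x = y" if xy: "x \<in> lat \<tau>" "y \<in> lat \<tau>" "dist x y < sqrt c" for x y
  proof -
    obtain m n :: int where mn: "x - y = of_int m + of_int n * \<tau>"
      using lat_diff[OF xy(1,2)] unfolding lat_eq by auto
    have lt: "norm (x - y)^2 < (sqrt c)^2"
      using xy(3) c(1) by (intro power_strict_mono) (auto simp: dist_norm)
    then have "c * (of_int m^2 + of_int n^2) < c * 1"
      using c(2)[of m n] lt real_sqrt_pow2[of c] c(1) unfolding mn by linarith
    then have "real_of_int (m^2 + n^2) < 1"
      unfolding mult_less_cancel_left_pos[OF c(1)] by simp
    then have "m^2 + n^2 < 1" by linarith
    then have "m = 0" "n = 0"
      using zero_le_power2[of m] zero_le_power2[of n]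
      by (smt (verit) zero_less_power2)+
    then show ?thesis using mn by simp
  qed
  then show ?thesis using that[of "sqrt c"] c(1) by auto
qed

lemma closed_lat_subset: "S \<subseteq> lat \<tau> \<Longrightarrow> closed S"
proof -
  assume S: "S \<subseteq> lat \<tau>"
  obtain e where "e > 0" "\<And>x y. x \<in> lat \<tau> \<Longrightarrow> y \<in> lat \<tau> \<Longrightarrow> dist x y < e \<Longrightarrow> x = y"
    using lat_separated by blast
  with S show "closed S" by (intro discrete_imp_closed[of e]) (auto simp: dist_commute)
qed

lemma open_minus_lat: "open (- lat \<tau>)" "open (- (lat \<tau> - {0}))"
  using closed_lat_subset[of "lat \<tau>"] closed_lat_subset[of "lat \<tau> - {0}"] open_Compl by blast+

lemma countable_lat: "countable (lat \<tau>)"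
  unfolding lat_eq by auto

lemma connected_minus_lat: "connected (- lat \<tau>)"
  by (intro path_connected_imp_connected path_connected_complement_countable countable_lat) auto

text \<open>Zeta without its pole at 0. The p-function, \<open>G_m(a)\<close> and
  \<open>G_m(0)\<close> are all expressed by derivatives of this one function, so that
  differentiation under a lattice sum is justified only once.\<close>

definition zsum :: "complex \<Rightarrow> complex" where
  "zsum z = (\<Sum>\<^sub>\<infinity>w\<in>lat \<tau> - {0}. zterm w z)"

lemma weierstrass_zeta_zsum: "weierstrass_zeta (lat \<tau>) z = 1 / z + zsum z"
  by (simp add: weierstrass_zeta_def zsum_def zterm_def)

text \<open>The corrections combine to \<open>zterm w z = z^2 / (w^2 (z - w))\<close>, which is of
  order \<open>norm w ^ (-3)\<close> as soon as \<open>z - w\<close> is comparable with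
  \<open>w\<close>.\<close>

lemma zterm_bound:
  assumes "z0 \<notin> lat \<tau> - {0}"
  obtains r C where "r > 0" "cball z0 r \<subseteq> - (lat \<tau> - {0})"
    "\<And>z w. z \<in> cball z0 r \<Longrightarrow> w \<in> lat \<tau> - {0} \<Longrightarrow> norm (zterm w z) \<le> C * (1 / norm w ^ 3)"
proof -
  obtain d where d: "d > 0" "cball z0 d \<subseteq> - (lat \<tau> - {0})"
    using open_minus_lat(2) assms by (meson ComplI open_contains_cball)
  define r where "r = d / 2"
  define R where "R = norm z0 + d"
  \<comment> \<open>This gives \<open>norm (z - w) \<ge> \<delta> * norm w\<close>: the bound 1/2
    serves the lattice points with \<open>norm w \<ge> 2 R\<close>, and \<open>r / (2 R)\<close> the
    remaining ones, which stay at distance \<open>r\<close> from \<open>z\<close>.\<close>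
  define \<delta> where "\<delta> = min (1/2) (r / (2 * R))"
  have pos: "r > 0" "R > 0" "\<delta> > 0"
    using d by (auto simp: r_def R_def \<delta>_def add_nonneg_pos)
  have "norm (zterm w z) \<le> (R^2 / \<delta>) * (1 / norm w ^ 3)"
    if z: "z \<in> cball z0 r" and w: "w \<in> lat \<tau> - {0}" for z w
  proof -
    have zR: "norm z \<le> R"
      using z d norm_triangle_ineq[of "z - z0" z0]
      by (simp add: R_def r_def dist_norm norm_minus_commute)
    have "norm (w - z0) > d"
      using d(2) w by (force simp: dist_norm norm_minus_commute not_le)
    then have zw: "norm (z - w) \<ge> r"
      using z norm_triangle_ineq[of "w - z" "z - z0"]
      by (simp add: r_def dist_norm norm_minus_commute)
    have dw: "norm (z - w) \<ge> \<delta> * norm w"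
    proof (cases "norm w \<ge> 2 * R")
      case True
      have "norm w \<le> norm (z - w) + norm z"
        using norm_triangle_ineq[of "w - z" z] by (simp add: norm_minus_commute)
      moreover have "\<delta> * norm w \<le> 1/2 * norm w"
        by (intro mult_right_mono) (auto simp: \<delta>_def)
      ultimately show ?thesis using True zR by linarith
    next
      case False
      have "\<delta> * norm w \<le> (r / (2 * R)) * (2 * R)"
        using False pos by (intro mult_mono) (auto simp: \<delta>_def)
      then show ?thesis using zw pos by simp
    qed
    have w0: "norm w > 0" using w by auto
    have "z - w \<noteq> 0" using zw pos by auto
    then have "zterm w z = z^2 / (w^2 * (z - w))"
      using w0 by (simp add: zterm_def divide_simps power2_eq_square) (simp add: algebra_simps)
    then have "norm (zterm w z) = norm z^2 / (norm w^2 * norm (z - w))"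
      by (simp add: norm_divide norm_mult norm_power)
    also have "\<dots> \<le> R^2 / (norm w^2 * (\<delta> * norm w))"
      using zR dw w0 pos by (intro frac_le power_mono mult_left_mono) auto
    finally show ?thesis by (simp add: power2_eq_square power3_eq_cube mult_ac)
  qed
  moreover have "cball z0 r \<subseteq> - (lat \<tau> - {0})"
    using d by (intro order_trans[OF _ d(2)] subset_cball) (auto simp: r_def)
  ultimately show ?thesis
    using that[of r "R^2 / \<delta>"] pos(1) by blast
qed

lemma higher_deriv_zterm: "z \<noteq> w \<Longrightarrow> (deriv ^^ n) (zterm w) z = zterm_deriv n w z"
proof (induction n arbitrary: z)
  case (Suc n)
  have "\<forall>\<^sub>F x in nhds z. (deriv ^^ n) (zterm w) x = zterm_deriv n w x"
  proof (rule eventually_mono)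
    show "\<forall>\<^sub>F x in nhds z. x \<in> - {w}"
      by (rule eventually_nhds_in_open) (use Suc.prems in auto)
  qed (use Suc.IH in auto)
  then have "deriv ((deriv ^^ n) (zterm w)) z = deriv (zterm_deriv n w) z"
    by (intro deriv_cong_ev) auto
  then show ?case using DERIV_imp_deriv[OF zterm_deriv_deriv[OF Suc.prems]] by simp
qed (simp add: zterm_deriv_def)

lemma zterm_holomorphic: "w \<in> lat \<tau> - {0} \<Longrightarrow> S \<subseteq> - (lat \<tau> - {0}) \<Longrightarrow> zterm w holomorphic_on S"
  unfolding zterm_def by (intro holomorphic_intros) auto

text \<open>The M-test is applied along the net of finite subsets of the lattice. Locally uniform
  convergence along it passes to all derivatives, and the outcome is an unconditional sum, the form
  in which the Eisenstein series are defined.\<close>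

lemma zsum_main:
  assumes "z0 \<notin> lat \<tau> - {0}"
  shows zsum_differentiable: "zsum field_differentiable (at z0)"
    and zsum_higher_deriv: "((\<lambda>w. zterm_deriv n w z0) has_sum (deriv ^^ n) zsum z0) (lat \<tau> - {0})"
proof -
  obtain r C where r: "r > 0" "cball z0 r \<subseteq> - (lat \<tau> - {0})"
    and C: "\<And>z w. z \<in> cball z0 r \<Longrightarrow> w \<in> lat \<tau> - {0} \<Longrightarrow> norm (zterm w z) \<le> C * (1 / norm w ^ 3)"
    using zterm_bound[OF assms] by blast
  have lim: "uniform_limit (cball z0 r) (\<lambda>X z. \<Sum>w\<in>X. zterm w z) zsum (finite_subsets_at_top (lat \<tau> - {0}))"
    unfolding zsum_def
    by (rule Weierstrass_m_test_general[OF C]) (auto simp only: intro!: summable_on_cmult_right summable_lattice_cube Im)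
  have ev: "\<forall>\<^sub>F X in finite_subsets_at_top (lat \<tau> - {0}). finite X \<and> X \<subseteq> lat \<tau> - {0}"
    by (intro eventually_finite_subsets_at_top_weakI) auto
  have hol: "(\<lambda>z. \<Sum>w\<in>X. zterm w z) holomorphic_on cball z0 r" if "X \<subseteq> lat \<tau> - {0}" for X
    using that r(2) by (intro holomorphic_on_sum zterm_holomorphic) auto
  have "zsum holomorphic_on ball z0 r"
  proof (rule holomorphic_uniform_limit[OF _ lim])
    show "\<forall>\<^sub>F X in finite_subsets_at_top (lat \<tau> - {0}).
       continuous_on (cball z0 r) (\<lambda>z. \<Sum>w\<in>X. zterm w z) \<and> (\<lambda>z. \<Sum>w\<in>X. zterm w z) holomorphic_on ball z0 r"
      using ev
    proof eventually_elim
      case (elim X)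
      then have "(\<lambda>z. \<Sum>w\<in>X. zterm w z) holomorphic_on cball z0 r"
        by (intro hol) auto
      then show ?case
        using holomorphic_on_imp_continuous_on holomorphic_on_subset ball_subset_cball by blast
    qed
  qed auto
  then show "zsum field_differentiable (at z0)"
    using r(1) by (auto intro: holomorphic_on_imp_differentiable_at)
  have "((\<lambda>X. (deriv ^^ n) (\<lambda>z. \<Sum>w\<in>X. zterm w z) z0) \<longlongrightarrow> (deriv ^^ n) zsum z0)
          (finite_subsets_at_top (lat \<tau> - {0}))"
  proof (rule higher_deriv_complex_uniform_limit)
    show "uniform_limit (ball z0 r) (\<lambda>X z. \<Sum>w\<in>X. zterm w z) zsum (finite_subsets_at_top (lat \<tau> - {0}))"
      by (rule uniform_limit_on_subset[OF lim]) auto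
    show "\<forall>\<^sub>F X in finite_subsets_at_top (lat \<tau> - {0}). (\<lambda>z. \<Sum>w\<in>X. zterm w z) holomorphic_on ball z0 r"
      using ev
    proof eventually_elim
      case (elim X)
      then have "(\<lambda>z. \<Sum>w\<in>X. zterm w z) holomorphic_on cball z0 r"
        by (intro hol) auto
      then show ?case
        using holomorphic_on_subset ball_subset_cball by blast
    qed
  qed (use r in auto)
  moreover have "\<forall>\<^sub>F X in finite_subsets_at_top (lat \<tau> - {0}).
      (deriv ^^ n) (\<lambda>z. \<Sum>w\<in>X. zterm w z) z0 = (\<Sum>w\<in>X. zterm_deriv n w z0)"
    using ev
  proof eventually_elim
    case (elim X)
    have "(deriv ^^ n) (\<lambda>z. \<Sum>w\<in>X. zterm w z) z0 = (\<Sum>w\<in>X. (deriv ^^ n) (zterm w) z0)"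
      by (rule higher_deriv_sum_complex[of _ _ "ball z0 r"])
         (use elim r(1) order_trans[OF ball_subset_cball r(2)] in \<open>auto intro!: zterm_holomorphic\<close>)
    also have "\<dots> = (\<Sum>w\<in>X. zterm_deriv n w z0)"
      using elim assms by (intro sum.cong refl higher_deriv_zterm) auto
    finally show ?case .
  qed
  ultimately show "((\<lambda>w. zterm_deriv n w z0) has_sum (deriv ^^ n) zsum z0) (lat \<tau> - {0})"
    unfolding has_sum_def by (rule Lim_transform_eventually)
qed

lemma zsum_holomorphic: "zsum holomorphic_on - (lat \<tau> - {0})"
  using zsum_differentiable
  by (auto simp: holomorphic_on_def intro: field_differentiable_at_within)

lemma weierstrass_p_zsum:
  assumes "z \<notin> lat \<tau>"
  shows "weierstrass_p (lat \<tau>) z = 1 / z^2 - deriv zsum z"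
proof -
  have "((\<lambda>w. - zterm_deriv 1 w z) has_sum - (deriv ^^ 1) zsum z) (lat \<tau> - {0})"
    using assms by (intro has_sum_uminusI zsum_higher_deriv) auto
  then have "((\<lambda>w. 1 / (z - w)^2 - 1 / w^2) has_sum - deriv zsum z) (lat \<tau> - {0})"
    by (simp add: zterm_deriv_def)
  then show ?thesis
    by (simp add: weierstrass_p_def infsumI)
qed

lemma eisenstein_G_zsum_has_sum:
  assumes "z \<notin> lat \<tau>" "n \<ge> 2"
  shows "((\<lambda>w. 1 / (w + z) ^ Suc n) has_sum
           (1 / z ^ Suc n + (-1) ^ n / fact n * (deriv ^^ n) zsum z)) (lat \<tau>)"
proof -
  have "((\<lambda>w. (-1) ^ n / fact n * zterm_deriv n w z) has_sum (-1) ^ n / fact n * (deriv ^^ n) zsum z) (lat \<tau> - {0})"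
    using assms by (intro has_sum_cmult_right zsum_higher_deriv) auto
  then have "((\<lambda>w. 1 / (z - w) ^ Suc n) has_sum (-1) ^ n / fact n * (deriv ^^ n) zsum z) (lat \<tau> - {0})"
    using assms by (simp add: zterm_deriv_def flip: power_mult_distrib)
  then have "((\<lambda>w. 1 / (z - w) ^ Suc n) has_sum
      (1 / z ^ Suc n + (-1) ^ n / fact n * (deriv ^^ n) zsum z)) (insert 0 (lat \<tau> - {0}))"
    using has_sum_insert[of 0 "lat \<tau> - {0}" "\<lambda>w. 1 / (z - w) ^ Suc n"] by simp
  moreover have "insert 0 (lat \<tau> - {0}) = lat \<tau>"
    by auto
  ultimately have "((\<lambda>w. 1 / (z - w) ^ Suc n) has_sum
      (1 / z ^ Suc n + (-1) ^ n / fact n * (deriv ^^ n) zsum z)) (lat \<tau>)"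
    by simp
  \<comment> \<open>The reflection \<open>w \<mapsto> - w\<close> of the lattice replaces
    \<open>z - w\<close> by \<open>w + z\<close>.\<close>
  also have "?this \<longleftrightarrow> ?thesis"
    by (rule has_sum_reindex_bij_witness[of _ uminus uminus]) auto
  finally show ?thesis .
qed

lemma eisenstein_G_zsum:
  assumes "z \<notin> lat \<tau>" "n \<ge> 2"
  shows "eisenstein_G (Suc n) (lat \<tau>) z = 1 / z ^ Suc n + (-1) ^ n / fact n * (deriv ^^ n) zsum z"
proof -
  have "z \<noteq> 0" using assms(1) by auto
  then show ?thesis
    unfolding eisenstein_G_def using infsumI[OF eisenstein_G_zsum_has_sum[OF assms]] by simp
qed

lemma eisenstein_G_zsum_0:
  assumes "n \<ge> 2"
  shows "eisenstein_G (Suc n) (lat \<tau>) 0 = - (deriv ^^ n) zsum 0 / fact n"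
proof -
  have "((\<lambda>w. - (1 / fact n) * zterm_deriv n w 0) has_sum - (1 / fact n) * (deriv ^^ n) zsum 0) (lat \<tau> - {0})"
    by (intro has_sum_cmult_right zsum_higher_deriv) auto
  moreover have "- (1 / fact n) * zterm_deriv n w 0 = 1 / w ^ Suc n" for w
    using assms by (cases "even n") (simp_all add: zterm_deriv_def)
  ultimately have "((\<lambda>w. 1 / w ^ Suc n) has_sum - (1 / fact n) * (deriv ^^ n) zsum 0) (lat \<tau> - {0})"
    by simp
  from infsumI[OF this] show ?thesis
    by (simp add: eisenstein_G_def)
qed

lemma zsum_odd: "zsum (- z) = - zsum z"
proof -
  have "zsum (- z) = (\<Sum>\<^sub>\<infinity>w\<in>lat \<tau> - {0}. - zterm w z)"
    unfolding zsum_def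
  proof (rule infsum_reindex_bij_witness[of _ uminus uminus])
    fix w assume w: "w \<in> lat \<tau> - {0}"
    have "- z - w = - (z + w)" by simp
    then show "- zterm (- w) z = zterm w (- z)"
      unfolding zterm_def by (simp only: minus_divide_right[symmetric]) simp
  qed auto
  then show ?thesis by (simp add: zsum_def infsum_uminus)
qed

end

subsection \<open>Elliptic functions\<close>

text \<open>The tail of the power series is divided by \<open>z ^ n\<close>. The holomorphic
  cofactor \<open>g\<close> is the form in which cancelled poles and orders of vanishing are used
  later.\<close>

lemma holomorphic_taylor_remainder:
  assumes "f holomorphic_on ball 0 r"
  obtains g where "g holomorphic_on ball 0 r"
    "\<And>z. z \<in> ball 0 r \<Longrightarrow> f z = (\<Sum>i<n. (deriv ^^ i) f 0 / fact i * z ^ i) + z ^ n * g z"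
proof -
  define a where "a = (\<lambda>i. (deriv ^^ i) f 0 / fact i)"
  define g where "g = (\<lambda>z. suminf (\<lambda>i. a (i + n) * z ^ i))"
  have sums: "(\<lambda>i. a i * z ^ i) sums f z" if "z \<in> ball 0 r" for z
    using holomorphic_power_series[OF assms that] by (simp add: a_def)
  have sm: "summable (\<lambda>i. a (i + n) * z ^ i)" if "z \<in> ball 0 r" for z
  proof (cases "z = 0")
    case False
    have "summable (\<lambda>i. a (i + n) * z ^ (i + n))"
      using sums_summable[OF sums[OF that]] summable_ignore_initial_segment by blast
    then have "summable (\<lambda>i. (1 / z ^ n) * (a (i + n) * z ^ (i + n)))"
      by (rule summable_mult)
    then show ?thesis using False by (simp add: power_add field_simps)
  qed (auto intro: summable_finite[of "{0}"])
  have "(\<lambda>i. a (i + n) * (z - 0) ^ i) sums g z" if "z \<in> ball 0 r" for z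
    using summable_sums[OF sm[OF that]] by (simp add: g_def)
  then have "g holomorphic_on ball 0 r"
    by (rule power_series_holomorphic)
  moreover have "f z = (\<Sum>i<n. a i * z ^ i) + z ^ n * g z" if "z \<in> ball 0 r" for z
  proof -
    have "f z = suminf (\<lambda>i. a (i + n) * z ^ (i + n)) + (\<Sum>i<n. a i * z ^ i)"
      using suminf_split_initial_segment[OF sums_summable[OF sums[OF that]], of n]
            sums_unique[OF sums[OF that]] by simp
    also have "suminf (\<lambda>i. a (i + n) * z ^ (i + n)) = z ^ n * g z"
      unfolding g_def using suminf_mult[OF sm[OF that], of "z ^ n"] by (simp add: power_add mult_ac)
    finally show ?thesis by simp
  qed
  ultimately show ?thesis using that by (simp add: a_def)
qed

text \<open>Two evaluations of the derivatives of \<open>f (- z)\<close> at 0. For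
  \<open>s = 1\<close> the odd derivatives vanish, for \<open>s = -1\<close> the even ones.\<close>

lemma higher_deriv_parity:
  fixes f :: "complex \<Rightarrow> complex"
  assumes "f holomorphic_on ball 0 r" "r > 0" "\<And>z. z \<in> ball 0 r \<Longrightarrow> f (- z) = s * f z"
  shows "(-1) ^ n * (deriv ^^ n) f 0 = s * (deriv ^^ n) f 0"
proof -
  have hol: "(\<lambda>z. f (- 1 * z)) holomorphic_on ball 0 r"
  proof (rule holomorphic_on_compose_gen[where f = "\<lambda>z. - 1 * z" and g = f and t = "ball 0 r", unfolded o_def])
    show "(\<lambda>z. - 1 * z :: complex) holomorphic_on ball 0 r"
      by (intro holomorphic_intros)
  qed (use assms(1) in auto)
  have "(-1) ^ n * (deriv ^^ n) f (- 1 * 0) = (deriv ^^ n) (\<lambda>z. f (- 1 * z)) 0"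
    by (rule higher_deriv_compose_linear[OF assms(1), symmetric, of "ball 0 r"]) (use assms(2) in auto)
  also have "\<dots> = (deriv ^^ n) (\<lambda>z. s * f z) 0"
    by (rule higher_deriv_transform_within_open[OF hol _ open_ball])
       (use assms in \<open>auto intro!: holomorphic_intros\<close>)
  also have "\<dots> = s * (deriv ^^ n) f 0"
    by (rule higher_deriv_cmult[OF assms(1)]) (use assms(2) in auto)
  finally show ?thesis by simp
qed

text \<open>Periodicity is known only on \<open>S\<close>, so membership in \<open>S\<close> is
  carried through the induction along with the value.\<close>

lemma periodic_of_int:
  fixes h :: "complex \<Rightarrow> 'a"
  assumes "\<And>z. z \<in> S \<Longrightarrow> h (z + p) = h z" "\<And>z. z + p \<in> S \<longleftrightarrow> z \<in> S" "z \<in> S"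
  shows "z + of_int m * p \<in> S \<and> h (z + of_int m * p) = h z"
proof (induction m rule: int_induct[of _ 0])
  case (step1 i)
  then show ?case
    using assms(1)[of "z + of_int i * p"] assms(2)[of "z + of_int i * p"] by (simp add: algebra_simps)
next
  case (step2 i)
  then show ?case
    using assms(1)[of "z + of_int (i - 1) * p"] assms(2)[of "z + of_int (i - 1) * p"]
    by (simp add: algebra_simps)
qed (use assms(3) in simp)

lemma half_not_int: "(1/2 :: real) \<notin> \<int>" and third_not_int: "(1/3 :: real) \<notin> \<int>"
proof -
  have "real_of_int (2 * k) \<noteq> 1" "real_of_int (3 * k) \<noteq> 1" for k
    by (simp_all only: of_int_eq_1_iff) presburger+
  then show "(1/2 :: real) \<notin> \<int>" "(1/3 :: real) \<notin> \<int>"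
    by (auto elim!: Ints_cases simp: divide_eq_eq)
qed

context
  fixes \<tau> :: complex
  assumes Im: "Im \<tau> > 0"
begin

lemma lattice_periodic:
  fixes h :: "complex \<Rightarrow> complex"
  assumes "\<And>z. z \<notin> lat \<tau> \<Longrightarrow> h (z + 1) = h z" "\<And>z. z \<notin> lat \<tau> \<Longrightarrow> h (z + \<tau>) = h z"
    and "z \<notin> lat \<tau>" "w \<in> lat \<tau>"
  shows "h (z + w) = h z"
proof -
  obtain m n :: int where w: "w = of_int m + of_int n * \<tau>"
    using assms(4) unfolding lat_eq by auto
  have 1: "z + of_int m * 1 \<in> - lat \<tau> \<and> h (z + of_int m * 1) = h z"
    by (rule periodic_of_int) (use assms lat_add_iff lat_periods in auto)
  moreover have "h (z + of_int m * 1 + of_int n * \<tau>) = h (z + of_int m * 1)"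
    by (rule periodic_of_int[of "- lat \<tau>", THEN conjunct2])
       (use 1 assms lat_add_iff lat_periods in auto)
  ultimately show ?thesis by (simp add: w algebra_simps)
qed

text \<open>Liouville's theorem for elliptic functions. That the poles cancel is expressed by
  agreement near 0 with a holomorphic germ \<open>g\<close>; this also identifies the constant, so
  that a vanishing \<open>g 0\<close> proves an identity.\<close>

lemma elliptic_constant:
  assumes hol: "h holomorphic_on - lat \<tau>"
    and per: "\<And>z. z \<notin> lat \<tau> \<Longrightarrow> h (z + 1) = h z" "\<And>z. z \<notin> lat \<tau> \<Longrightarrow> h (z + \<tau>) = h z"
    and r: "r > 0" "g holomorphic_on ball 0 r"
    and near: "\<And>z. z \<in> ball 0 r \<Longrightarrow> z \<notin> lat \<tau> \<Longrightarrow> h z = g z"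
    and "z \<notin> lat \<tau>"
  shows "h z = g 0"
proof -
  have Lper: "h (z + w) = h z" if "z \<notin> lat \<tau>" "w \<in> lat \<tau>" for z w
    by (rule lattice_periodic) (use per that in auto)
  \<comment> \<open>The entire extension: by periodicity \<open>h\<close> looks near every lattice
    point as it does near 0, so the single value \<open>g 0\<close> fills all gaps.\<close>
  define H where "H = (\<lambda>z. if z \<in> lat \<tau> then g 0 else h z)"
  obtain e where e: "e > 0" "\<And>x y. x \<in> lat \<tau> \<Longrightarrow> y \<in> lat \<tau> \<Longrightarrow> dist x y < e \<Longrightarrow> x = y"
    using lat_separated[OF Im] by blast
  have HD: "H field_differentiable (at z)" for z
  proof (cases "z \<in> lat \<tau>")
    case False
    have "H holomorphic_on - lat \<tau>"
      by (rule holomorphic_transform[OF hol]) (auto simp: H_def)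
    then show ?thesis
      using False open_minus_lat(1)[OF Im] by (auto intro: holomorphic_on_imp_differentiable_at)
  next
    case True
    define s where "s = min e r"
    have "(\<lambda>x. g (x - z)) holomorphic_on ball z s"
    proof (rule holomorphic_on_compose_gen[where f = "\<lambda>x. x - z" and g = g and t = "ball 0 r", unfolded o_def])
      show "(\<lambda>x. x - z) holomorphic_on ball z s"
        by (intro holomorphic_intros)
    qed (use r(2) in \<open>auto simp: s_def dist_norm norm_minus_commute\<close>)
    moreover have "H x = g (x - z)" if x: "x \<in> ball z s" for x
    proof (cases "x = z")
      case True
      then show ?thesis using \<open>z \<in> lat \<tau>\<close> by (simp add: H_def)
    next
      case False
      then have xl: "x \<notin> lat \<tau>"
        using e(2)[OF _ True, of x] x by (auto simp: s_def dist_commute)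
      have xz: "x - z \<notin> lat \<tau>"
        using xl lat_add_iff[OF True, of "x - z"] by simp
      have "h x = h (x - z)"
        using Lper[OF xz True] by simp
      then show ?thesis
        using near[of "x - z"] xz xl x by (simp add: H_def s_def dist_norm norm_minus_commute)
    qed
    ultimately have "H holomorphic_on ball z s"
      by (metis (no_types, lifting) holomorphic_transform)
    then show ?thesis
      using e(1) r(1) by (auto simp: s_def intro: holomorphic_on_imp_differentiable_at)
  qed
  then have Hhol: "H holomorphic_on UNIV"
    by (auto simp: holomorphic_on_def intro: field_differentiable_at_within)
  have HP: "H (z + w) = H z" if "w \<in> lat \<tau>" for z w
    using Lper[of z w] that lat_add_iff[OF that, of z] by (auto simp: H_def)
  define K where "K = (\<lambda>(s, t). of_real s + of_real t * \<tau>) ` ({0..1} \<times> {0..1::real})"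
  have "compact K"
    unfolding K_def case_prod_unfold
    by (intro compact_continuous_image continuous_intros compact_Times) auto
  then have "bounded (H ` K)"
    by (intro compact_imp_bounded compact_continuous_image holomorphic_on_imp_continuous_on
              holomorphic_on_subset[OF Hhol]) auto
  moreover have "range H \<subseteq> H ` K"
  proof
    fix y assume "y \<in> range H"
    then obtain z where z: "y = H z" by auto
    define t where "t = Im z / Im \<tau>"
    define s where "s = Re z - t * Re \<tau>"
    have "z = of_real s + of_real t * \<tau>"
      using Im by (simp add: complex_eq_iff s_def t_def)
    then have eq: "(of_real (frac s) + of_real (frac t) * \<tau>) + (of_int \<lfloor>s\<rfloor> + of_int \<lfloor>t\<rfloor> * \<tau>) = z"
      by (simp add: frac_def algebra_simps)
    have "of_int \<lfloor>s\<rfloor> + of_int \<lfloor>t\<rfloor> * \<tau> \<in> lat \<tau>"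
      unfolding lat_eq by (rule image_eqI[of _ _ "(\<lfloor>s\<rfloor>, \<lfloor>t\<rfloor>)"]) auto
    from HP[OF this, of "of_real (frac s) + of_real (frac t) * \<tau>"]
    have "y = H (of_real (frac s) + of_real (frac t) * \<tau>)"
      by (simp only: eq z)
    moreover have "of_real (frac s) + of_real (frac t) * \<tau> \<in> K"
      unfolding K_def using frac_lt_1[of s] frac_lt_1[of t]
      by (intro image_eqI[of _ _ "(frac s, frac t)"]) auto
    ultimately show "y \<in> H ` K" by blast
  qed
  ultimately have "bounded (range H)"
    by (rule bounded_subset)
  then obtain c where "\<And>z. H z = c"
    using Liouville_theorem[OF Hhol] by (auto simp: constant_on_def)
  then show ?thesis
    using \<open>z \<notin> lat \<tau>\<close> lat_zero by (metis H_def)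
qed

section \<open>Derivatives, symmetries and periods of the Weierstrass functions\<close>

lemma minus_lat_differentiable:
  assumes "z \<notin> lat \<tau>"
  shows "((deriv ^^ n) (zsum \<tau>) has_field_derivative (deriv ^^ Suc n) (zsum \<tau>) z) (at z)"
  using has_field_derivative_higher_deriv[OF zsum_holomorphic[OF Im] open_minus_lat(2)[OF Im], of z n]
    assms by auto

lemma has_field_derivative_eisenstein_G:
  assumes "z \<notin> lat \<tau>" "n \<ge> 2"
  shows "(eisenstein_G (Suc n) (lat \<tau>) has_field_derivative
            - of_nat (Suc n) * eisenstein_G (Suc (Suc n)) (lat \<tau>) z) (at z)"
proof (rule has_field_derivative_transform_within_open)
  let ?f = "\<lambda>z. 1 / z ^ Suc n + (-1) ^ n / fact n * (deriv ^^ n) (zsum \<tau>) z"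
  have z: "z \<noteq> 0" using assms(1) lat_zero by auto
  have 1: "((\<lambda>z. 1 / z ^ Suc n) has_field_derivative - of_nat (Suc n) / z ^ Suc (Suc n)) (at z)"
  proof -
    have "((\<lambda>z. z ^ Suc n) has_field_derivative of_nat (Suc n) * z ^ n) (at z)"
      by (auto intro!: derivative_eq_intros simp del: power_Suc)
    from DERIV_divide[OF DERIV_const this, of 1] z
    have "((\<lambda>z. 1 / z ^ Suc n) has_field_derivative
        - (of_nat (Suc n) * z ^ n) / (z ^ Suc n * z ^ Suc n)) (at z)"
      by (simp del: power_Suc of_nat_Suc)
    also have "- (of_nat (Suc n) * z ^ n) / (z ^ Suc n * z ^ Suc n) = - of_nat (Suc n) / z ^ Suc (Suc n)"
      using z by (simp add: divide_simps)
    finally show ?thesis .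
  qed
  have "(?f has_field_derivative
      - of_nat (Suc n) / z ^ Suc (Suc n) + (-1) ^ n / fact n * (deriv ^^ Suc n) (zsum \<tau>) z) (at z)"
    by (intro DERIV_add 1 DERIV_cmult minus_lat_differentiable assms)
  also have "- of_nat (Suc n) / z ^ Suc (Suc n) + (-1) ^ n / fact n * (deriv ^^ Suc n) (zsum \<tau>) z
     = - of_nat (Suc n) * eisenstein_G (Suc (Suc n)) (lat \<tau>) z"
  proof -
    have *: "- N / Z + s / F * D = - N * (1 / Z + (-1) * s / (N * F) * D)" if "N \<noteq> 0" for N Z s F D :: complex
      using that by (simp add: field_simps)
    have G: "eisenstein_G (Suc (Suc n)) (lat \<tau>) z =
        1 / z ^ Suc (Suc n) + (-1) * (-1) ^ n / (of_nat (Suc n) * fact n) * (deriv ^^ Suc n) (zsum \<tau>) z"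
      using eisenstein_G_zsum[OF Im assms(1), of "Suc n"] assms(2)
      unfolding fact_Suc power_Suc[of "-1"] by simp
    show ?thesis
      unfolding G by (rule *) (simp del: of_nat_Suc)
  qed
  finally show "(?f has_field_derivative - of_nat (Suc n) * eisenstein_G (Suc (Suc n)) (lat \<tau>) z) (at z)" .
  show "?f w = eisenstein_G (Suc n) (lat \<tau>) w" if "w \<in> - lat \<tau>" for w
    using eisenstein_G_zsum[OF Im _ assms(2), of w] that by simp
qed (use assms open_minus_lat(1)[OF Im] in auto)

lemma has_field_derivative_weierstrass_p:
  assumes "z \<notin> lat \<tau>"
  shows "(weierstrass_p (lat \<tau>) has_field_derivative - 2 * eisenstein_G 3 (lat \<tau>) z) (at z)"
proof (rule has_field_derivative_transform_within_open)
  let ?f = "\<lambda>z. 1 / z^2 - (deriv ^^ 1) (zsum \<tau>) z"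
  have z: "z \<noteq> 0" using assms(1) lat_zero by auto
  have "(?f has_field_derivative - 2 / z^3 - (deriv ^^ Suc 1) (zsum \<tau>) z) (at z)"
    using z by (intro DERIV_diff minus_lat_differentiable assms)
               (auto intro!: derivative_eq_intros simp: field_simps eval_nat_numeral)
  also have "- 2 / z^3 - (deriv ^^ Suc 1) (zsum \<tau>) z = - 2 * eisenstein_G 3 (lat \<tau>) z"
    using eisenstein_G_zsum[OF Im assms, of 2] by (simp add: eval_nat_numeral)
  finally show "(?f has_field_derivative - 2 * eisenstein_G 3 (lat \<tau>) z) (at z)" .
  show "?f w = weierstrass_p (lat \<tau>) w" if "w \<in> - lat \<tau>" for w
    using weierstrass_p_zsum[OF Im, of w] that by simp
qed (use assms open_minus_lat(1)[OF Im] in auto)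

lemma has_field_derivative_weierstrass_zeta:
  assumes "z \<notin> lat \<tau>"
  shows "(weierstrass_zeta (lat \<tau>) has_field_derivative - weierstrass_p (lat \<tau>) z) (at z)"
proof -
  have z: "z \<noteq> 0" using assms(1) lat_zero by auto
  have "((\<lambda>z. 1 / z + (deriv ^^ 0) (zsum \<tau>) z) has_field_derivative - 1 / z^2 + (deriv ^^ Suc 0) (zsum \<tau>) z) (at z)"
    using z by (intro DERIV_add minus_lat_differentiable assms)
               (auto intro!: derivative_eq_intros simp: field_simps eval_nat_numeral)
  then show ?thesis
    by (simp add: weierstrass_p_zsum[OF Im assms] weierstrass_zeta_zsum[OF Im, abs_def])
qed

lemma eisenstein_G_periodic:
  assumes "z \<notin> lat \<tau>" "w \<in> lat \<tau>"
  shows "eisenstein_G n (lat \<tau>) (z + w) = eisenstein_G n (lat \<tau>) z"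
proof -
  have "z \<noteq> 0" "z + w \<noteq> 0"
    using assms lat_zero lat_add_iff[OF assms(2), of z] by auto
  moreover have "(\<Sum>\<^sub>\<infinity>x\<in>lat \<tau>. 1 / (x + (z + w)) ^ n) = (\<Sum>\<^sub>\<infinity>x\<in>lat \<tau>. 1 / (x + z) ^ n)"
    by (rule infsum_reindex_bij_witness[of _ "\<lambda>x. x - w" "\<lambda>x. x + w"])
       (use assms lat_diff lat_add_iff in \<open>auto simp: algebra_simps\<close>)
  ultimately show ?thesis by (simp add: eisenstein_G_def)
qed

lemma eisenstein_G_minus:
  assumes "z \<notin> lat \<tau>"
  shows "eisenstein_G n (lat \<tau>) (- z) = (-1) ^ n * eisenstein_G n (lat \<tau>) z"
proof -
  have "(\<Sum>\<^sub>\<infinity>x\<in>lat \<tau>. 1 / (x + - z) ^ n) = (\<Sum>\<^sub>\<infinity>x\<in>lat \<tau>. (-1) ^ n * (1 / (x + z) ^ n))"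
  proof (rule infsum_reindex_bij_witness[of _ uminus uminus])
    fix x assume "x \<in> lat \<tau>"
    have "- x + z = (-1) * (x + - z)" by simp
    then show "(-1) ^ n * (1 / (- x + z) ^ n) = 1 / (x + - z) ^ n"
      by (simp only: power_mult_distrib) simp
  qed (use Im in auto)
  also have "\<dots> = (-1) ^ n * (\<Sum>\<^sub>\<infinity>x\<in>lat \<tau>. 1 / (x + z) ^ n)"
    by (rule infsum_cmult_right')
  finally show ?thesis
    using assms lat_zero by (auto simp: eisenstein_G_def)
qed

lemma weierstrass_p_minus: "weierstrass_p (lat \<tau>) (- z) = weierstrass_p (lat \<tau>) z"
proof -
  have "(\<Sum>\<^sub>\<infinity>x\<in>lat \<tau> - {0}. 1 / (- z - x)^2 - 1 / x^2) = (\<Sum>\<^sub>\<infinity>x\<in>lat \<tau> - {0}. 1 / (z - x)^2 - 1 / x^2)"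
    by (rule infsum_reindex_bij_witness[of _ uminus uminus])
       (use Im in \<open>auto simp: power2_commute add.commute\<close>)
  then show ?thesis by (simp add: weierstrass_p_def)
qed

lemma weierstrass_zeta_minus: "weierstrass_zeta (lat \<tau>) (- z) = - weierstrass_zeta (lat \<tau>) z"
  by (simp add: weierstrass_zeta_zsum[OF Im] zsum_odd[OF Im])

lemma not_in_lat:
  "of_real x + of_real y * \<tau> \<notin> lat \<tau>" if "x \<notin> \<int> \<or> y \<notin> \<int>" for x y :: real
  using lat_coords_unique[OF Im, of x y] that by auto

lemma constant_on_minus_lat:
  assumes "\<And>z. z \<notin> lat \<tau> \<Longrightarrow> (f has_field_derivative 0) (at z)"
  obtains c where "\<And>z. z \<notin> lat \<tau> \<Longrightarrow> f z = c"
proof -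
  have "\<exists>c. \<forall>z\<in>- lat \<tau>. f z = c"
    using connected_minus_lat[OF Im] open_minus_lat(1)[OF Im]
  proof (rule DERIV_zero_connected_constant[of _ "{}"])
    show "continuous_on (- lat \<tau>) f"
      using assms by (intro continuous_at_imp_continuous_on) (auto intro: DERIV_isCont)
  qed (use assms in auto)
  then show ?thesis using that by auto
qed

text \<open>The corrected series cannot simply be reindexed by a translation. Its derivative can, so
  the increment along \<open>w\<close> is constant; at \<open>- (w / 2)\<close> evenness shows that
  it is 0, and there \<open>w / 2\<close> has to avoid the lattice.\<close>

lemma weierstrass_p_half_period:
  assumes "w \<in> lat \<tau>" "w / 2 \<notin> lat \<tau>" "z \<notin> lat \<tau>"
  shows "weierstrass_p (lat \<tau>) (z + w) = weierstrass_p (lat \<tau>) z"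
proof -
  let ?f = "\<lambda>z. weierstrass_p (lat \<tau>) (z + w) - weierstrass_p (lat \<tau>) z"
  have "(?f has_field_derivative 0) (at z)" if "z \<notin> lat \<tau>" for z
  proof -
    have zw: "z + w \<notin> lat \<tau>" using that lat_add_iff[OF assms(1)] by simp
    have "(?f has_field_derivative (- 2 * eisenstein_G 3 (lat \<tau>) (z + w) * 1 - - 2 * eisenstein_G 3 (lat \<tau>) z)) (at z)"
      by (intro DERIV_diff DERIV_chain2[OF has_field_derivative_weierstrass_p]
            has_field_derivative_weierstrass_p that zw) (auto intro!: derivative_eq_intros)
    then show ?thesis using eisenstein_G_periodic[OF that assms(1)] by simp
  qed
  then obtain c where c: "\<And>z. z \<notin> lat \<tau> \<Longrightarrow> ?f z = c"
    using constant_on_minus_lat by blast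
  have "- (w / 2) + w = w / 2" by simp
  then have "c = 0"
    using c[of "- (w / 2)"] assms(2) weierstrass_p_minus[of "w / 2"] Im by (simp only: lat_uminus_iff) simp
  then show ?thesis using c[OF assms(3)] by simp
qed

lemma weierstrass_p_periodic:
  assumes "z \<notin> lat \<tau>"
  shows "weierstrass_p (lat \<tau>) (z + 1) = weierstrass_p (lat \<tau>) z"
    and "weierstrass_p (lat \<tau>) (z + \<tau>) = weierstrass_p (lat \<tau>) z"
  using weierstrass_p_half_period[OF lat_periods(1) _ assms]
        weierstrass_p_half_period[OF lat_periods(2) _ assms]
        not_in_lat[of "1/2" 0] not_in_lat[of 0 "1/2"] half_not_int by auto

text \<open>Oddness removes the even coefficients, and the correction terms of zeta remove the
  linear one. Order 7 leaves enough terms to determine the constant term of the cube of the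
  p-function.\<close>

lemma zsum_taylor:
  obtains r R where "r > 0" "ball 0 r \<inter> lat \<tau> = {0}" "R holomorphic_on ball 0 r"
    "\<And>z. z \<in> ball 0 r \<Longrightarrow>
       zsum \<tau> z = - eisenstein_G 4 (lat \<tau>) 0 * z^3 - eisenstein_G 6 (lat \<tau>) 0 * z^5 + z^7 * R z"
proof -
  obtain r where r: "r > 0" "ball 0 r \<subseteq> - (lat \<tau> - {0})"
    by (rule openE[OF open_minus_lat(2)[OF Im], of 0]) auto
  have hol: "zsum \<tau> holomorphic_on ball 0 r"
    using holomorphic_on_subset[OF zsum_holomorphic[OF Im] r(2)] .
  obtain R where R: "R holomorphic_on ball 0 r"
    "\<And>z. z \<in> ball 0 r \<Longrightarrow> zsum \<tau> z = (\<Sum>i<7. (deriv ^^ i) (zsum \<tau>) 0 / fact i * z ^ i) + z ^ 7 * R z"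
    by (rule holomorphic_taylor_remainder[OF hol, of 7]) blast
  have even: "(deriv ^^ n) (zsum \<tau>) 0 = 0" if "even n" for n
    using higher_deriv_parity[OF hol r(1), of "-1" n] that by (simp add: zsum_odd[OF Im])
  have "(deriv ^^ 1) (zsum \<tau>) 0 = 0"
  proof (rule has_sum_unique)
    show "((\<lambda>w. zterm_deriv 1 w 0) has_sum (deriv ^^ 1) (zsum \<tau>) 0) (lat \<tau> - {0})"
      by (rule zsum_higher_deriv[OF Im]) simp
    show "((\<lambda>w. zterm_deriv 1 w 0) has_sum 0) (lat \<tau> - {0})"
      by (rule has_sum_0) (simp add: zterm_deriv_def)
  qed
  moreover have "(deriv ^^ 3) (zsum \<tau>) 0 / fact 3 = - eisenstein_G 4 (lat \<tau>) 0"
    using eisenstein_G_zsum_0[OF Im, of 3] by (simp add: eval_nat_numeral)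
  moreover have "(deriv ^^ 5) (zsum \<tau>) 0 / fact 5 = - eisenstein_G 6 (lat \<tau>) 0"
    using eisenstein_G_zsum_0[OF Im, of 5] by (simp add: eval_nat_numeral)
  moreover have S7: "(\<Sum>i<7. a i * z ^ i) = a 0 + a 1 * z + a 2 * z^2 + a 3 * z^3 + a 4 * z^4 + a 5 * z^5 + a 6 * z^6"
    for a and z :: complex
  proof -
    have "{..<7::nat} = {0, 1, 2, 3, 4, 5, 6}" by auto
    then show ?thesis by simp
  qed
  ultimately have "zsum \<tau> z = - eisenstein_G 4 (lat \<tau>) 0 * z^3 - eisenstein_G 6 (lat \<tau>) 0 * z^5 + z^7 * R z"
    if "z \<in> ball 0 r" for z
    using R(2)[OF that, unfolded S7] even[of 0] even[of 2] even[of 4] even[of 6] by simp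
  moreover have "ball 0 r \<inter> lat \<tau> = {0}"
    using r lat_zero by auto
  ultimately show ?thesis using that[of r R] r R by blast
qed

end

text \<open>A remainder \<open>z ^ Suc n * R z\<close> keeps its shape under differentiation, with
  the power lowered by one and a new holomorphic cofactor.\<close>

lemma has_field_derivative_power_times:
  fixes R :: "complex \<Rightarrow> complex"
  assumes "R holomorphic_on ball 0 r" "z \<in> ball 0 r"
  shows "((\<lambda>z. z ^ Suc n * R z) has_field_derivative z ^ n * (of_nat (Suc n) * R z + z * deriv R z)) (at z)"
proof -
  have 1: "(R has_field_derivative deriv R z) (at z)"
    using assms by (auto intro: holomorphic_derivI)
  have 2: "((\<lambda>z. z ^ Suc n) has_field_derivative of_nat (Suc n) * z ^ n) (at z)"
    by (auto intro!: derivative_eq_intros simp del: power_Suc)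
  show ?thesis
    using DERIV_mult[OF 2 1] by (rule DERIV_cong) (simp add: algebra_simps)
qed

context
  fixes \<tau> :: complex
  assumes Im: "Im \<tau> > 0"
begin

text \<open>Expansions at 0 of the p-function, its first derivative \<open>- 2 G_3\<close> and its
  second derivative \<open>6 G_4\<close>, with explicit remainders, obtained by differentiating that
  of \<open>zsum\<close> three times.\<close>

lemma zsum_derivs_taylor:
  obtains r S U V where "r > 0"
    "S holomorphic_on ball 0 r" "U holomorphic_on ball 0 r" "V holomorphic_on ball 0 r"
    "\<And>z. z \<in> ball 0 r \<Longrightarrow> z \<notin> lat \<tau> \<Longrightarrow>
       weierstrass_p (lat \<tau>) z = 1 / z^2 +
         z^2 * (3 * eisenstein_G 4 (lat \<tau>) 0 + 5 * eisenstein_G 6 (lat \<tau>) 0 * z^2 - z^4 * S z)"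
    "\<And>z. z \<in> ball 0 r \<Longrightarrow> z \<notin> lat \<tau> \<Longrightarrow>
       - 2 * eisenstein_G 3 (lat \<tau>) z = - 2 / z^3 +
         z * (6 * eisenstein_G 4 (lat \<tau>) 0 + 20 * eisenstein_G 6 (lat \<tau>) 0 * z^2 - z^4 * U z)"
    "\<And>z. z \<in> ball 0 r \<Longrightarrow> z \<notin> lat \<tau> \<Longrightarrow>
       6 * eisenstein_G 4 (lat \<tau>) z = 6 / z^4 +
         (6 * eisenstein_G 4 (lat \<tau>) 0 + 60 * eisenstein_G 6 (lat \<tau>) 0 * z^2 - z^4 * V z)"
proof -
  define A B where "A = eisenstein_G 4 (lat \<tau>) 0" and "B = eisenstein_G 6 (lat \<tau>) 0"
  obtain r R where r: "r > 0" "ball 0 r \<inter> lat \<tau> = {0}" and R: "R holomorphic_on ball 0 r"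
    and Z: "\<And>z. z \<in> ball 0 r \<Longrightarrow> zsum \<tau> z = - A * z^3 - B * z^5 + z^7 * R z"
    by (rule zsum_taylor[OF Im, folded A_def B_def]) (rule that; assumption)
  define S where "S = (\<lambda>z. of_nat (Suc 6) * R z + z * deriv R z)"
  define U where "U = (\<lambda>z. of_nat (Suc 5) * S z + z * deriv S z)"
  define V where "V = (\<lambda>z. of_nat (Suc 4) * U z + z * deriv U z)"
  have S: "S holomorphic_on ball 0 r"
    unfolding S_def using R by (auto intro!: holomorphic_intros)
  have U: "U holomorphic_on ball 0 r"
    unfolding U_def using S by (auto intro!: holomorphic_intros)
  have V: "V holomorphic_on ball 0 r"
    unfolding V_def using U by (auto intro!: holomorphic_intros)
  have d1: "((\<lambda>z. - A * z^3 - B * z^5 + z^Suc 6 * R z) has_field_derivative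
      - 3 * A * z^2 - 5 * B * z^4 + z^6 * S z) (at z)" if "z \<in> ball 0 r" for z
    unfolding S_def
    by (rule DERIV_add[OF _ has_field_derivative_power_times[OF R that]]) (auto intro!: derivative_eq_intros)
  have 1: "deriv (zsum \<tau>) z = - 3 * A * z^2 - 5 * B * z^4 + z^6 * S z" if "z \<in> ball 0 r" for z
    by (rule DERIV_imp_deriv, rule has_field_derivative_transform_within_open[OF d1[OF that] open_ball that]) (auto simp: Z)
  have d2: "((\<lambda>z. - 3 * A * z^2 - 5 * B * z^4 + z^Suc 5 * S z) has_field_derivative
      - 6 * A * z - 20 * B * z^3 + z^5 * U z) (at z)" if "z \<in> ball 0 r" for z
    unfolding U_def
    by (rule DERIV_add[OF _ has_field_derivative_power_times[OF S that]]) (auto intro!: derivative_eq_intros)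
  have 2: "deriv (deriv (zsum \<tau>)) z = - 6 * A * z - 20 * B * z^3 + z^5 * U z" if "z \<in> ball 0 r" for z
    by (rule DERIV_imp_deriv, rule has_field_derivative_transform_within_open[OF d2[OF that] open_ball that]) (auto simp: 1)
  have d3: "((\<lambda>z. - 6 * A * z - 20 * B * z^3 + z^Suc 4 * U z) has_field_derivative
      - 6 * A - 60 * B * z^2 + z^4 * V z) (at z)" if "z \<in> ball 0 r" for z
    unfolding V_def
    by (rule DERIV_add[OF _ has_field_derivative_power_times[OF U that]]) (auto intro!: derivative_eq_intros)
  have 3: "deriv (deriv (deriv (zsum \<tau>))) z = - 6 * A - 60 * B * z^2 + z^4 * V z" if "z \<in> ball 0 r" for z
    by (rule DERIV_imp_deriv, rule has_field_derivative_transform_within_open[OF d3[OF that] open_ball that]) (auto simp: 2)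
  show ?thesis
  proof (rule that[OF r(1) S U V])
    fix z assume z: "z \<in> ball 0 r" "z \<notin> lat \<tau>"
    have f2: "(deriv ^^ 2) f = deriv (deriv f)" and f3: "(deriv ^^ 3) f = deriv (deriv (deriv f))" for f :: "complex \<Rightarrow> complex"
      by (simp_all add: numeral_2_eq_2 numeral_3_eq_3)
    have "weierstrass_p (lat \<tau>) z = 1 / z^2 - (- 3 * A * z^2 - 5 * B * z^4 + z^6 * S z)"
      using weierstrass_p_zsum[OF Im z(2)] 1[OF z(1)] by simp
    also have "\<dots> = 1 / z^2 + z^2 * (3 * A + 5 * B * z^2 - z^4 * S z)"
      by (simp add: algebra_simps eval_nat_numeral)
    finally show "weierstrass_p (lat \<tau>) z = 1 / z^2 +
         z^2 * (3 * eisenstein_G 4 (lat \<tau>) 0 + 5 * eisenstein_G 6 (lat \<tau>) 0 * z^2 - z^4 * S z)"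
      unfolding A_def B_def .
    have "eisenstein_G 3 (lat \<tau>) z = 1 / z^3 + deriv (deriv (zsum \<tau>)) z / 2"
      using eisenstein_G_zsum[OF Im z(2), of 2] f2[of "zsum \<tau>"] by simp
    then have "- 2 * eisenstein_G 3 (lat \<tau>) z = - 2 / z^3 - deriv (deriv (zsum \<tau>)) z"
      by simp
    also have "\<dots> = - 2 / z^3 - (- 6 * A * z - 20 * B * z^3 + z^5 * U z)"
      unfolding 2[OF z(1)] ..
    also have "\<dots> = - 2 / z^3 + z * (6 * A + 20 * B * z^2 - z^4 * U z)"
      by (simp add: algebra_simps eval_nat_numeral)
    finally show "- 2 * eisenstein_G 3 (lat \<tau>) z = - 2 / z^3 +
         z * (6 * eisenstein_G 4 (lat \<tau>) 0 + 20 * eisenstein_G 6 (lat \<tau>) 0 * z^2 - z^4 * U z)"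
      unfolding A_def B_def .
    have "eisenstein_G 4 (lat \<tau>) z = 1 / z^4 - deriv (deriv (deriv (zsum \<tau>))) z / 6"
      using eisenstein_G_zsum[OF Im z(2), of 3] f3[of "zsum \<tau>"] by (simp add: fact_numeral)
    then have "6 * eisenstein_G 4 (lat \<tau>) z = 6 / z^4 - deriv (deriv (deriv (zsum \<tau>))) z"
      by simp
    also have "\<dots> = 6 / z^4 - (- 6 * A - 60 * B * z^2 + z^4 * V z)"
      unfolding 3[OF z(1)] ..
    also have "\<dots> = 6 / z^4 + (6 * A + 60 * B * z^2 - z^4 * V z)"
      by simp
    finally show "6 * eisenstein_G 4 (lat \<tau>) z = 6 / z^4 +
         (6 * eisenstein_G 4 (lat \<tau>) 0 + 60 * eisenstein_G 6 (lat \<tau>) 0 * z^2 - z^4 * V z)"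
      unfolding A_def B_def .
  qed
qed

lemma weierstrass_p_holomorphic: "weierstrass_p (lat \<tau>) holomorphic_on - lat \<tau>"
  unfolding holomorphic_on_open[OF open_minus_lat(1)[OF Im]]
  using has_field_derivative_weierstrass_p[OF Im] by blast

lemma eisenstein_G_holomorphic:
  assumes "n \<ge> 3"
  shows "eisenstein_G n (lat \<tau>) holomorphic_on - lat \<tau>"
proof -
  obtain k where k: "n = Suc k" "k \<ge> 2"
    using assms by (cases n) auto
  show ?thesis
    unfolding k(1) holomorphic_on_open[OF open_minus_lat(1)[OF Im]]
    using has_field_derivative_eisenstein_G[OF Im _ k(2)] by blast
qed

text \<open>In terms of the p-function these are
  \<open>\<wp>'^2 = 4 \<wp>^3 - g_2 \<wp> - g_3\<close> and
  \<open>\<wp>'' = 6 \<wp>^2 - g_2 / 2\<close>, with \<open>g_2 = 60 G_4(0)\<close> and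
  \<open>g_3 = 140 G_6(0)\<close>. Either time the difference of the sides has no pole and its germ
  vanishes at 0. The second is proved directly, because deriving it from the first would mean
  dividing by \<open>\<wp>'\<close>.\<close>

lemma weierstrass_ode:
  assumes "z \<notin> lat \<tau>"
  shows "(2 * eisenstein_G 3 (lat \<tau>) z)^2 = 4 * weierstrass_p (lat \<tau>) z ^ 3
      - 60 * eisenstein_G 4 (lat \<tau>) 0 * weierstrass_p (lat \<tau>) z - 140 * eisenstein_G 6 (lat \<tau>) 0"
    and "eisenstein_G 4 (lat \<tau>) z = weierstrass_p (lat \<tau>) z ^ 2 - 5 * eisenstein_G 4 (lat \<tau>) 0"
proof -
  define A B where "A = eisenstein_G 4 (lat \<tau>) 0" and "B = eisenstein_G 6 (lat \<tau>) 0"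
  obtain r S U V where r: "r > 0" and
    hol: "S holomorphic_on ball 0 r" "U holomorphic_on ball 0 r" "V holomorphic_on ball 0 r" and
    p: "\<And>z. z \<in> ball 0 r \<Longrightarrow> z \<notin> lat \<tau> \<Longrightarrow>
       weierstrass_p (lat \<tau>) z = 1 / z^2 + z^2 * (3 * A + 5 * B * z^2 - z^4 * S z)" and
    p': "\<And>z. z \<in> ball 0 r \<Longrightarrow> z \<notin> lat \<tau> \<Longrightarrow>
       - 2 * eisenstein_G 3 (lat \<tau>) z = - 2 / z^3 + z * (6 * A + 20 * B * z^2 - z^4 * U z)" and
    p'': "\<And>z. z \<in> ball 0 r \<Longrightarrow> z \<notin> lat \<tau> \<Longrightarrow>
       6 * eisenstein_G 4 (lat \<tau>) z = 6 / z^4 + (6 * A + 60 * B * z^2 - z^4 * V z)"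
    by (rule zsum_derivs_taylor[folded A_def B_def]) (rule that; assumption)
  have per: "eisenstein_G n (lat \<tau>) (z + 1) = eisenstein_G n (lat \<tau>) z"
    "eisenstein_G n (lat \<tau>) (z + \<tau>) = eisenstein_G n (lat \<tau>) z" if "z \<notin> lat \<tau>" for n z
    using eisenstein_G_periodic[OF Im that] lat_periods by auto
  let ?a = "\<lambda>z. 3 * A + 5 * B * z^2 - z^4 * S z"
  let ?b = "\<lambda>z. 6 * A + 20 * B * z^2 - z^4 * U z"
  let ?g = "\<lambda>z. z^2 * (4 * U z + 12 * S z) + z^2 * ((?b z)^2 - 12 * (?a z)^2 + 60 * A * ?a z) - 4 * z^6 * (?a z)^3"
  let ?h = "\<lambda>z. (- 2 * eisenstein_G 3 (lat \<tau>) z)^2 - 4 * weierstrass_p (lat \<tau>) z ^ 3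
      + 60 * A * weierstrass_p (lat \<tau>) z + 140 * B"
  have "?h z = ?g 0"
  proof (rule elliptic_constant[OF Im _ _ _ r _ _ assms, of ?h ?g])
    show "?h holomorphic_on - lat \<tau>"
      by (intro holomorphic_intros weierstrass_p_holomorphic eisenstein_G_holomorphic) auto
    show "?g holomorphic_on ball 0 r"
      using hol by (intro holomorphic_intros) auto
    fix z assume z: "z \<in> ball 0 r" "z \<notin> lat \<tau>"
    then have "z \<noteq> 0" using lat_zero by auto
    have alg: "(- 2 / z^3 + z * b)^2 - 4 * (1 / z^2 + z^2 * a)^3 + 60 * A * (1 / z^2 + z^2 * a) + 140 * B
       = z^2 * (4 * u + 12 * s) + z^2 * (b^2 - 12 * a^2 + 60 * A * a) - 4 * z^6 * a^3"
      if "a = 3 * A + 5 * B * z^2 - z^4 * s" "b = 6 * A + 20 * B * z^2 - z^4 * u" for a b s u :: complex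
    proof -
      have "(- 2 / z^3 + z * b)^2 - 4 * (1 / z^2 + z^2 * a)^3 + 60 * A * (1 / z^2 + z^2 * a) + 140 * B
         = (60 * A - 4 * b - 12 * a) / z^2 + 140 * B + z^2 * (b^2 - 12 * a^2 + 60 * A * a) - 4 * z^6 * a^3"
      proof -
        have "(- 2 / z^3 + z * b)^2 = 4 / z^6 - 4 * b / z^2 + z^2 * b^2"
          using \<open>z \<noteq> 0\<close> by (simp add: eval_nat_numeral field_simps)
        moreover have "(1 / z^2 + z^2 * a)^3 = 1 / z^6 + 3 * a / z^2 + 3 * z^2 * a^2 + z^6 * a^3"
          using \<open>z \<noteq> 0\<close> by (simp add: eval_nat_numeral field_simps)
        ultimately show ?thesis
          by (simp add: algebra_simps add_divide_distrib diff_divide_distrib)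
      qed
      \<comment> \<open>The remaining double pole cancels since 60 - 4 times 6 - 12 times 3 is 0;
        the next coefficient, - 4 times 20 - 12 times 5, is -140 and meets the summand
        \<open>140 * B\<close>.\<close>
      also have "60 * A - 4 * b - 12 * a = z^2 * (- 140 * B + z^2 * (4 * u + 12 * s))"
        unfolding that by (simp add: algebra_simps eval_nat_numeral)
      also have "z^2 * (- 140 * B + z^2 * (4 * u + 12 * s)) / z^2 = - 140 * B + z^2 * (4 * u + 12 * s)"
        using \<open>z \<noteq> 0\<close> by simp
      finally show ?thesis
        by (simp add: algebra_simps)
    qed
    show "?h z = ?g z"
      unfolding p[OF z] p'[OF z] by (rule alg) auto
  qed (use per weierstrass_p_periodic[OF Im] in auto)
  then show "(2 * eisenstein_G 3 (lat \<tau>) z)^2 = 4 * weierstrass_p (lat \<tau>) z ^ 3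
      - 60 * eisenstein_G 4 (lat \<tau>) 0 * weierstrass_p (lat \<tau>) z - 140 * eisenstein_G 6 (lat \<tau>) 0"
    by (simp add: A_def B_def algebra_simps)
  let ?c = "\<lambda>z. 6 * A + 60 * B * z^2 - z^4 * V z"
  let ?g = "\<lambda>z. ?c z - 12 * ?a z - 6 * z^4 * (?a z)^2 + 30 * A"
  let ?h = "\<lambda>z. 6 * eisenstein_G 4 (lat \<tau>) z - 6 * weierstrass_p (lat \<tau>) z ^ 2 + 30 * A"
  have "?h z = ?g 0"
  proof (rule elliptic_constant[OF Im _ _ _ r _ _ assms, of ?h ?g])
    show "?h holomorphic_on - lat \<tau>"
      by (intro holomorphic_intros weierstrass_p_holomorphic eisenstein_G_holomorphic) auto
    show "?g holomorphic_on ball 0 r"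
      using hol by (intro holomorphic_intros) auto
    fix z assume z: "z \<in> ball 0 r" "z \<notin> lat \<tau>"
    then have "z \<noteq> 0" using lat_zero by auto
    then have alg: "6 / z^4 + c - 6 * (1 / z^2 + z^2 * a)^2 + 30 * A = c - 12 * a - 6 * z^4 * a^2 + 30 * A" for a c
      by (simp add: power2_eq_square eval_nat_numeral divide_simps) (simp add: algebra_simps)
    show "?h z = ?g z"
      unfolding p[OF z] p''[OF z] by (rule alg)
  qed (use per weierstrass_p_periodic[OF Im] in auto)
  then have "6 * eisenstein_G 4 (lat \<tau>) z = 6 * (weierstrass_p (lat \<tau>) z ^ 2 - 5 * A)"
    by (simp add: algebra_simps)
  then show "eisenstein_G 4 (lat \<tau>) z = weierstrass_p (lat \<tau>) z ^ 2 - 5 * eisenstein_G 4 (lat \<tau>) 0"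
    unfolding A_def by (simp only: mult_cancel_left) simp
qed

end

subsection \<open>Product formulas for the Weierstrass functions\<close>

text \<open>The exponential is that of the local parameter q, with \<open>2 * pi * \<i>\<close>, not
  the classical nome with \<open>pi * \<i>\<close>.\<close>

definition nome :: "complex \<Rightarrow> complex" where
  "nome z = exp (2 * pi * \<i> * z)"

lemma nome_nonzero [simp]: "nome z \<noteq> 0"
  by (simp add: nome_def)

lemma nome_add: "nome (x + y) = nome x * nome y"
  by (simp add: nome_def distrib_left exp_add)

lemma nome_minus: "nome (- x) = 1 / nome x"
  by (simp add: nome_def exp_minus field_simps)

lemma nome_diff: "nome (x - y) = nome x / nome y"
  using nome_add[of x "- y"] by (simp add: nome_minus)

lemma nome_of_nat_mult: "nome (of_nat n * x) = nome x ^ n"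
  by (simp add: nome_def mult_ac flip: exp_of_nat_mult)

lemma nome_0 [simp]: "nome 0 = 1"
  by (simp add: nome_def)

lemma nome_1 [simp]: "nome 1 = 1"
  using exp_two_pi_i' by (simp add: nome_def)

lemma nome_half [simp]: "nome (1 / 2) = - 1"
  by (simp add: nome_def exp_pi_i' mult_ac)

lemma nome_eq_1_iff: "nome z = 1 \<longleftrightarrow> z \<in> \<int>"
proof
  assume "nome z = 1"
  then obtain n :: int where "2 * pi * \<i> * z = 0 + (of_int (2 * n) * pi) * \<i>"
    unfolding nome_def using exp_eq[of "2 * pi * \<i> * z" 0] by auto
  then have "z = of_int n"
    by (simp add: field_simps)
  then show "z \<in> \<int>" by simp
next
  assume "z \<in> \<int>"
  then obtain n :: int where "z = of_int n" by (auto elim: Ints_cases)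
  then show "nome z = 1"
    unfolding nome_def by (simp add: exp_eq_1 mult_ac)
qed

lemma norm_nome_less_1: "Im \<tau> > 0 \<Longrightarrow> norm (nome \<tau>) < 1"
  by (simp add: nome_def)

lemma holomorphic_nome [holomorphic_intros]: "f holomorphic_on A \<Longrightarrow> (\<lambda>z. nome (f z)) holomorphic_on A"
  unfolding nome_def by (intro holomorphic_intros)

lemma has_field_derivative_nome: "(nome has_field_derivative 2 * pi * \<i> * nome z) (at z)"
  unfolding nome_def[abs_def] by (auto intro!: derivative_eq_intros)

definition lat_theta :: "complex \<Rightarrow> complex \<Rightarrow> complex" where
  "lat_theta \<tau> z = theta (nome \<tau>) (nome z)"

context
  fixes \<tau> :: complex
  assumes Im: "Im \<tau> > 0"
begin

lemma lat_theta_holomorphic: "f holomorphic_on A \<Longrightarrow> (\<lambda>z. lat_theta \<tau> (f z)) holomorphic_on A"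
  unfolding lat_theta_def theta_def
  by (intro holomorphic_intros holomorphic_qpoch_left norm_nome_less_1 Im) auto

lemma lat_theta_plus_1: "lat_theta \<tau> (z + 1) = lat_theta \<tau> z"
  by (simp add: lat_theta_def nome_add)

lemma lat_theta_minus: "lat_theta \<tau> (- z) = - lat_theta \<tau> z / nome z"
  using theta_inverse[OF norm_nome_less_1[OF Im], of "nome z"]
  by (simp add: lat_theta_def nome_minus)

lemma lat_theta_plus_tau: "lat_theta \<tau> (z + \<tau>) = - lat_theta \<tau> z / nome z"
  using theta_shift[OF norm_nome_less_1[OF Im], of "nome z"]
  by (simp add: lat_theta_def nome_add mult.commute)

lemma lat_theta_0: "lat_theta \<tau> 0 = 0"
  by (simp add: lat_theta_def theta_1 norm_nome_less_1 Im)

lemma lat_theta_nonzero: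
  assumes "z \<notin> lat \<tau>"
  shows "lat_theta \<tau> z \<noteq> 0"
proof
  assume "lat_theta \<tau> z = 0"
  then obtain n :: int where n: "nome z = nome \<tau> powi n"
    using theta_eq_0[OF norm_nome_less_1[OF Im] nome_nonzero nome_nonzero]
    unfolding lat_theta_def by blast
  have "nome \<tau> powi n = nome (of_int n * \<tau>)"
    by (simp add: nome_def exp_power_int mult_ac)
  with n have "nome (z - of_int n * \<tau>) = 1"
    by (simp add: nome_diff)
  then obtain m :: int where "z - of_int n * \<tau> = of_int m"
    by (auto simp: nome_eq_1_iff elim: Ints_cases)
  then have "z = of_int m + of_int n * \<tau>"
    by (simp add: algebra_simps)
  then have "z \<in> lat \<tau>"
    unfolding lat_eq by auto
  with assms show False by simp
qed

lemma lat_theta_has_field_derivative: "(lat_theta \<tau> has_field_derivative deriv (lat_theta \<tau>) z) (at z)"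
  using holomorphic_derivI[OF lat_theta_holomorphic[of "\<lambda>z. z" UNIV]] by simp

text \<open>Only the factor \<open>1 - nome z\<close> vanishes at 0. Its derivative there is
  multiplied by the remaining product, which at 0 is the square of \<open>euler_phi\<close>.\<close>

lemma lat_theta_deriv_0: "deriv (lat_theta \<tau>) 0 = - 2 * pi * \<i> * euler_phi (nome \<tau>) ^ 2"
proof -
  define q where "q = nome \<tau>"
  have q: "norm q < 1" using norm_nome_less_1[OF Im] by (simp add: q_def)
  define V where "V = (\<lambda>z. qpoch (nome z * q) q * qpoch (q / nome z) q)"
  have "V holomorphic_on UNIV"
    unfolding V_def by (intro holomorphic_intros holomorphic_qpoch_left q) auto
  then have V: "(V has_field_derivative deriv V 0) (at 0)"
    by (auto intro: holomorphic_derivI)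
  have "lat_theta \<tau> = (\<lambda>z. (1 - nome z) * V z)"
    unfolding lat_theta_def theta_def V_def q_def[symmetric] fun_eq_iff
    by (subst qpoch_rec[OF q]) simp
  moreover have "((\<lambda>z. (1 - nome z) * V z) has_field_derivative
      - (2 * pi * \<i>) * V 0) (at 0)"
    by (rule derivative_eq_intros has_field_derivative_nome V refl)+ simp
  ultimately have "deriv (lat_theta \<tau>) 0 = - (2 * pi * \<i>) * V 0"
    by (simp add: DERIV_imp_deriv)
  then show ?thesis
    by (simp add: V_def q_def power2_eq_square)
qed

lemma lat_theta_deriv_0_nonzero: "deriv (lat_theta \<tau>) 0 \<noteq> 0"
  unfolding lat_theta_deriv_0 using euler_phi_nonzero[OF norm_nome_less_1[OF Im]] by simp

text \<open>The zero at 0 is simple; the zero-free cofactor \<open>U\<close> allows quotients of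
  theta values to be expanded at 0.\<close>

lemma lat_theta_near_0:
  obtains r U where "r > 0" "ball 0 r \<inter> lat \<tau> = {0}" "U holomorphic_on ball 0 r"
    "\<And>z. z \<in> ball 0 r \<Longrightarrow> lat_theta \<tau> z = z * U z" "\<And>z. z \<in> ball 0 r \<Longrightarrow> U z \<noteq> 0"
    "U 0 = deriv (lat_theta \<tau>) 0"
proof -
  obtain r R where r: "r > 0" "ball 0 r \<inter> lat \<tau> = {0}"
    by (rule zsum_taylor[OF Im]) (rule that; assumption)
  have hol: "lat_theta \<tau> holomorphic_on ball 0 r"
    using lat_theta_holomorphic[of "\<lambda>z. z"] by simp
  obtain U where U: "U holomorphic_on ball 0 r"
    "\<And>z. z \<in> ball 0 r \<Longrightarrow> lat_theta \<tau> z = (\<Sum>i<1. (deriv ^^ i) (lat_theta \<tau>) 0 / fact i * z ^ i) + z ^ 1 * U z"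
    by (rule holomorphic_taylor_remainder[OF hol, of 1]) (rule that; assumption)
  have zU: "lat_theta \<tau> z = z * U z" if "z \<in> ball 0 r" for z
    using U(2)[OF that] by (simp add: lat_theta_0)
  have "((\<lambda>z. z * U z) has_field_derivative U 0) (at 0)"
  proof -
    have "(U has_field_derivative deriv U 0) (at 0)"
      using U(1) r(1) by (auto intro: holomorphic_derivI)
    from DERIV_mult[OF DERIV_ident this] show ?thesis by simp
  qed
  then have "(lat_theta \<tau> has_field_derivative U 0) (at 0)"
    by (rule has_field_derivative_transform_within_open[OF _ open_ball[of 0 r]]) (use r(1) zU in auto)
  then have U0: "U 0 = deriv (lat_theta \<tau>) 0"
    by (simp add: DERIV_imp_deriv)
  have Unz: "U z \<noteq> 0" if "z \<in> ball 0 r" for z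
  proof (cases "z = 0")
    case True
    then show ?thesis using U0 lat_theta_deriv_0_nonzero by simp
  next
    case False
    then have "z \<notin> lat \<tau>" using r(2) that by blast
    from lat_theta_nonzero[OF this] show ?thesis using zU[OF that] by auto
  qed
  show ?thesis by (rule that[OF r U(1) zU Unz U0])
qed

text \<open>The multipliers of \<open>T (z + a) * T (z - a)\<close> under translation by
  \<open>\<tau>\<close> cancel against those of \<open>T z ^ 2\<close>, so \<open>F\<close> is
  elliptic. It is even, so its double pole at 0 has no residue, and subtracting \<open>c * F\<close>
  from the p-function removes the pole altogether. The constant that remains is found at
  \<open>z = a\<close>, where \<open>F\<close> vanishes.\<close>

lemma weierstrass_p_diff:
  assumes "a \<notin> lat \<tau>" "z \<notin> lat \<tau>"
  shows "weierstrass_p (lat \<tau>) z - weierstrass_p (lat \<tau>) a =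
    4 * pi^2 * euler_phi (nome \<tau>) ^ 4 * nome a * lat_theta \<tau> (z + a) * lat_theta \<tau> (z - a)
      / (lat_theta \<tau> a ^ 2 * lat_theta \<tau> z ^ 2)"
proof -
  define P where "P = euler_phi (nome \<tau>)"
  define T where "T = lat_theta \<tau>"
  have P: "P \<noteq> 0"
    unfolding P_def by (rule euler_phi_nonzero[OF norm_nome_less_1[OF Im]])
  have Ta: "T a \<noteq> 0" using lat_theta_nonzero[OF assms(1)] by (simp add: T_def)
  \<comment> \<open>Chosen so that \<open>c * F\<close> has principal part \<open>1 / z^2\<close>:
    the leading coefficient of \<open>F\<close> is \<open>T a * T (- a) / T'(0)^2\<close>, with
    \<open>T (- a) = - T a / nome a\<close>.\<close>
  define c where "c = 4 * pi^2 * P ^ 4 * nome a / T a ^ 2"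
  obtain r1 U where r1: "r1 > 0" "ball 0 r1 \<inter> lat \<tau> = {0}" "U holomorphic_on ball 0 r1"
    and U: "\<And>z. z \<in> ball 0 r1 \<Longrightarrow> T z = z * U z" "\<And>z. z \<in> ball 0 r1 \<Longrightarrow> U z \<noteq> 0"
      "U 0 = deriv T 0"
    by (rule lat_theta_near_0[folded T_def]) (rule that; assumption)
  obtain r2 R where r2: "r2 > 0" "R holomorphic_on ball 0 r2" and
    p: "\<And>z. z \<in> ball 0 r2 \<Longrightarrow> z \<notin> lat \<tau> \<Longrightarrow> weierstrass_p (lat \<tau>) z = 1 / z^2 + R z"
  proof -
    obtain r S where rS: "r > 0" "S holomorphic_on ball 0 r"
      "\<And>z. z \<in> ball 0 r \<Longrightarrow> z \<notin> lat \<tau> \<Longrightarrow> weierstrass_p (lat \<tau>) z = 1 / z^2 +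
        z^2 * (3 * eisenstein_G 4 (lat \<tau>) 0 + 5 * eisenstein_G 6 (lat \<tau>) 0 * z^2 - z^4 * S z)"
      by (rule zsum_derivs_taylor[OF Im]) (rule that; assumption)
    show thesis
      by (rule that[OF rS(1) _ rS(3)]) (use rS(2) in \<open>auto intro!: holomorphic_intros\<close>)
  qed
  define r where "r = min r1 r2"
  have r: "r > 0" "ball 0 r \<subseteq> ball 0 r1" "ball 0 r \<subseteq> ball 0 r2"
    using r1(1) r2(1) by (auto simp: r_def)
  have Thol: "(\<lambda>z. T (f z)) holomorphic_on A" if "f holomorphic_on A" for f A
    using lat_theta_holomorphic[OF that] by (simp add: T_def)
  define F where "F = (\<lambda>z. T (z + a) * T (z - a) / T z ^ 2)"
  define K where "K = (\<lambda>z. T (z + a) * T (z - a) / U z ^ 2)"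
  have Tm: "T (- z) = - T z / nome z" for z
    by (simp add: T_def lat_theta_minus)
  have Fm: "F (- z) = F z" for z
  proof -
    have "T (- z + a) = - T (z - a) / (nome z / nome a)" "T (- z - a) = - T (z + a) / (nome z * nome a)"
      using Tm[of "z - a"] Tm[of "z + a"] by (simp_all add: nome_add nome_diff)
    then show ?thesis
      unfolding F_def Tm[of z] by (simp add: power_divide power2_eq_square)
  qed
  have KF: "K z = z^2 * F z" if "z \<in> ball 0 r1" "z \<noteq> 0" for z
    using U(1,2)[OF that(1)] that(2) by (simp add: K_def F_def power_mult_distrib)
  have Kh: "K holomorphic_on ball 0 r1"
    unfolding K_def using U(2) r1(3) by (intro holomorphic_intros Thol) auto
  have Keven: "K (- z) = 1 * K z" if "z \<in> ball 0 r1" for z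
    using KF[of z] KF[of "- z"] that Fm[of z] by (cases "z = 0") auto
  have K': "(deriv ^^ 1) K 0 = 0"
    using higher_deriv_parity[OF Kh r1(1) Keven, of 1] by simp
  obtain K2 where K2: "K2 holomorphic_on ball 0 r1"
    "\<And>z. z \<in> ball 0 r1 \<Longrightarrow> K z = (\<Sum>i<2. (deriv ^^ i) K 0 / fact i * z ^ i) + z ^ 2 * K2 z"
    by (rule holomorphic_taylor_remainder[OF Kh, of 2]) (rule that; assumption)
  have Kexp: "K z = K 0 + z^2 * K2 z" if "z \<in> ball 0 r1" for z
    using K2(2)[OF that] K' by (simp add: numeral_2_eq_2)
  have T0: "deriv T 0 = - 2 * pi * \<i> * P ^ 2"
    by (simp add: T_def P_def lat_theta_deriv_0)
  have K0: "c * K 0 = 1"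
    using Ta P Tm[of a] unfolding c_def K_def U(3) T0
    by (simp add: field_simps power2_eq_square eval_nat_numeral)
  let ?h = "\<lambda>z. weierstrass_p (lat \<tau>) z - c * F z"
  let ?g = "\<lambda>z. R z - c * K2 z"
  have const: "?h z = ?g 0" if "z \<notin> lat \<tau>" for z
  proof (rule elliptic_constant[OF Im _ _ _ r(1) _ _ that, of ?h ?g])
    show "?h holomorphic_on - lat \<tau>"
      unfolding F_def using lat_theta_nonzero
      by (intro holomorphic_intros weierstrass_p_holomorphic Im Thol) (auto simp: T_def)
    show "?g holomorphic_on ball 0 r"
      using holomorphic_on_subset[OF r2(2) r(3)] holomorphic_on_subset[OF K2(1) r(2)]
      by (intro holomorphic_intros)
    show "?h (z + 1) = ?h z" if "z \<notin> lat \<tau>" for z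
    proof -
      have "T (z + 1 + a) = T (z + a)" "T (z + 1 - a) = T (z - a)" "T (z + 1) = T z"
        using lat_theta_plus_1[of "z + a"] lat_theta_plus_1[of "z - a"] lat_theta_plus_1[of z]
        by (simp_all add: T_def algebra_simps)
      then show ?thesis
        using weierstrass_p_periodic[OF Im that] by (simp add: F_def)
    qed
    show "?h (z + \<tau>) = ?h z" if "z \<notin> lat \<tau>" for z
    proof -
      have "T (z + \<tau> + a) = - T (z + a) / (nome z * nome a)" "T (z + \<tau> - a) = - T (z - a) / (nome z / nome a)"
        "T (z + \<tau>) = - T z / nome z"
        using lat_theta_plus_tau[of "z + a"] lat_theta_plus_tau[of "z - a"] lat_theta_plus_tau[of z]
        by (simp_all add: T_def algebra_simps nome_add nome_diff)
      then have "F (z + \<tau>) = F z"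
        by (simp add: F_def power_divide power2_eq_square)
      then show ?thesis
        using weierstrass_p_periodic[OF Im that] by simp
    qed
    show "?h z = ?g z" if z: "z \<in> ball 0 r" "z \<notin> lat \<tau>" for z
    proof -
      have "z \<noteq> 0" using z(2) lat_zero by auto
      have zr: "z \<in> ball 0 r1" "z \<in> ball 0 r2" using z(1) r(2,3) by blast+
      have "z^2 * F z = K 0 + z^2 * K2 z"
        using KF[OF zr(1) \<open>z \<noteq> 0\<close>] Kexp[OF zr(1)] by simp
      then have "c * (z^2 * F z) = c * (K 0 + z^2 * K2 z)"
        by (rule arg_cong)
      then have "z^2 * (c * F z) = c * K 0 + z^2 * (c * K2 z)"
        by (simp only: distrib_left mult.left_commute)
      then have "c * F z = 1 / z^2 + c * K2 z"
        using \<open>z \<noteq> 0\<close> unfolding K0 by (simp add: field_simps)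
      then show ?thesis using p[OF zr(2) z(2)] by simp
    qed
  qed
  have "F a = 0"
    using lat_theta_0 by (simp add: F_def T_def)
  moreover have "?h z = ?h a"
    unfolding const[OF assms(1)] const[OF assms(2)] ..
  ultimately have "weierstrass_p (lat \<tau>) z - weierstrass_p (lat \<tau>) a = c * F z"
    by (simp add: diff_eq_eq)
  then show ?thesis
    by (simp add: c_def F_def T_def P_def)
qed

text \<open>The formula of \<open>weierstrass_p_diff\<close> is differentiated at
  \<open>z = a\<close>. Since \<open>T (z - a)\<close> vanishes there, only the term containing its
  derivative remains.\<close>

lemma weierstrass_p_deriv_product:
  assumes "a \<notin> lat \<tau>"
  shows "2 * eisenstein_G 3 (lat \<tau>) a =
    8 * pi^3 * \<i> * euler_phi (nome \<tau>) ^ 6 * nome a * lat_theta \<tau> (2 * a) / lat_theta \<tau> a ^ 4"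
proof -
  define P where "P = euler_phi (nome \<tau>)"
  define T where "T = lat_theta \<tau>"
  have Ta: "T a \<noteq> 0" using lat_theta_nonzero[OF assms(1)] by (simp add: T_def)
  define C where "C = 4 * pi^2 * P ^ 4 * nome a / T a ^ 2"
  define G where "G = (\<lambda>z. weierstrass_p (lat \<tau>) a + C * T (z + a) / T z ^ 2 * T (z - a))"
  have peq: "G z = weierstrass_p (lat \<tau>) z" if "z \<in> - lat \<tau>" for z
    using weierstrass_p_diff[OF assms, of z] that by (simp add: G_def C_def P_def T_def field_simps)
  have Td: "(T has_field_derivative deriv T z) (at z)" for z
    using lat_theta_has_field_derivative by (simp add: T_def)
  have "((\<lambda>z. C * T (z + a) / T z ^ 2) holomorphic_on - lat \<tau>)"
    using lat_theta_nonzero by (auto simp: T_def intro!: holomorphic_intros lat_theta_holomorphic)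
  then have "((\<lambda>z. C * T (z + a) / T z ^ 2) has_field_derivative
      deriv (\<lambda>z. C * T (z + a) / T z ^ 2) a) (at a)"
    using assms open_minus_lat(1)[OF Im] by (auto intro: holomorphic_derivI)
  moreover have "((\<lambda>z. T (z - a)) has_field_derivative deriv T 0) (at a)"
  proof -
    have "((\<lambda>z. z - a) has_field_derivative 1) (at a)"
      by (auto intro!: derivative_eq_intros)
    with DERIV_chain2[of T "deriv T 0" "\<lambda>z. z - a" a 1] Td[of 0] show ?thesis by simp
  qed
  ultimately have "((\<lambda>z. (C * T (z + a) / T z ^ 2) * T (z - a)) has_field_derivative
      deriv (\<lambda>z. C * T (z + a) / T z ^ 2) a * T (a - a) + deriv T 0 * (C * T (a + a) / T a ^ 2)) (at a)"
    by (rule DERIV_mult)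
  then have "((\<lambda>z. (C * T (z + a) / T z ^ 2) * T (z - a)) has_field_derivative
      deriv T 0 * (C * T (2 * a) / T a ^ 2)) (at a)"
    by (simp add: T_def lat_theta_0)
  then have "(G has_field_derivative 0 + deriv T 0 * (C * T (2 * a) / T a ^ 2)) (at a)"
    unfolding G_def by (intro DERIV_add DERIV_const)
  then have "(weierstrass_p (lat \<tau>) has_field_derivative 0 + deriv T 0 * (C * T (2 * a) / T a ^ 2)) (at a)"
    by (rule has_field_derivative_transform_within_open[OF _ open_minus_lat(1)[OF Im]]) (use assms peq in auto)
  from DERIV_unique[OF this has_field_derivative_weierstrass_p[OF Im assms]]
  have "- 2 * eisenstein_G 3 (lat \<tau>) a = deriv T 0 * (C * T (2 * a) / T a ^ 2)"
    by simp
  then show ?thesis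
    unfolding C_def T_def P_def lat_theta_deriv_0
    by (simp add: field_simps eval_nat_numeral)
qed

end

lemma deriv_shift:
  fixes f :: "complex \<Rightarrow> complex"
  assumes "f holomorphic_on S" "open S" "z \<in> S" "z + p \<in> S" "\<And>z. z \<in> S \<Longrightarrow> f (z + p) = f z + k"
  shows "deriv f (z + p) = deriv f z"
proof -
  have d: "(f has_field_derivative deriv f x) (at x)" if "x \<in> S" for x
    using assms(1,2) that by (rule holomorphic_derivI)
  have "((\<lambda>x. f (x + p)) has_field_derivative deriv f (z + p) * 1) (at z)"
    by (rule DERIV_chain2[where g = "\<lambda>x. x + p", OF d[OF assms(4)]]) (auto intro!: derivative_eq_intros)
  then have "((\<lambda>x. f x + k) has_field_derivative deriv f (z + p) * 1) (at z)"
    by (rule has_field_derivative_transform_within_open[OF _ assms(2,3)]) (use assms(5) in auto)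
  moreover have "((\<lambda>x. f x + k) has_field_derivative deriv f z) (at z)"
    using DERIV_add[OF d[OF assms(3)] DERIV_const[of k]] by simp
  ultimately show ?thesis
    using DERIV_unique by fastforce
qed

text \<open>Vieta's formulas without factoring a polynomial: subtracting the equations in pairs and
  cancelling differences of roots gives two expressions for \<open>g\<close>, and comparing them the
  sum of the roots.\<close>

lemma depressed_cubic_roots:
  fixes a b c g h :: complex
  assumes "a \<noteq> b" "a \<noteq> c" "b \<noteq> c"
    and "4 * a^3 - g * a - h = 0" "4 * b^3 - g * b - h = 0" "4 * c^3 - g * c - h = 0"
  shows "a + b + c = 0" "g = - 4 * (a * b + a * c + b * c)" "h = 4 * a * b * c"
proof -
  have "(a - b) * (4 * (a^2 + a * b + b^2) - g) = 0" "(a - c) * (4 * (a^2 + a * c + c^2) - g) = 0"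
    using assms(4-6) by algebra+
  then have g: "g = 4 * (a^2 + a * b + b^2)" "g = 4 * (a^2 + a * c + c^2)"
    using assms(1,2) by auto
  then have "(b - c) * (a + b + c) = 0"
    by algebra
  then show s: "a + b + c = 0"
    using assms(3) by auto
  show g': "g = - 4 * (a * b + a * c + b * c)"
    using g(1) s by algebra
  show "h = 4 * a * b * c"
    using g' s assms(4) by algebra
qed

section \<open>Values at the half periods and at one third of a period\<close>

context
  fixes \<tau> :: complex
  assumes Im: "Im \<tau> > 0"
begin

lemma half_periods_not_in_lat: "1 / 2 \<notin> lat \<tau>" "\<tau> / 2 \<notin> lat \<tau>" "(1 + \<tau>) / 2 \<notin> lat \<tau>"
  using not_in_lat[OF Im, of "1/2" 0] not_in_lat[OF Im, of 0 "1/2"] not_in_lat[OF Im, of "1/2" "1/2"] half_not_int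
  by (auto simp: field_simps)

lemma third_period_not_in_lat: "1 / 3 \<notin> lat \<tau>"
  using not_in_lat[OF Im, of "1/3" 0] third_not_int by auto

lemma eisenstein_G3_half_period:
  assumes "z \<notin> lat \<tau>" "2 * z \<in> lat \<tau>"
  shows "eisenstein_G 3 (lat \<tau>) z = 0"
proof -
  have "eisenstein_G 3 (lat \<tau>) (- z + 2 * z) = eisenstein_G 3 (lat \<tau>) (- z)"
    using assms by (intro eisenstein_G_periodic Im) auto
  then show ?thesis
    using eisenstein_G_minus[OF Im assms(1), of 3] by simp
qed

lemma half_period_roots:
  assumes "z \<notin> lat \<tau>" "2 * z \<in> lat \<tau>"
  shows "4 * weierstrass_p (lat \<tau>) z ^ 3 - 60 * eisenstein_G 4 (lat \<tau>) 0 * weierstrass_p (lat \<tau>) z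
     - 140 * eisenstein_G 6 (lat \<tau>) 0 = 0"
  using weierstrass_ode(1)[OF Im assms(1)] eisenstein_G3_half_period[OF assms] by simp

text \<open>For half periods \<open>a\<close> and \<open>z\<close>, the points \<open>z + a\<close>
  and \<open>z - a\<close> are congruent modulo the lattice, and their theta values agree. The
  numerator of \<open>weierstrass_p_diff\<close> therefore becomes the square of the third theta
  value.\<close>

lemma half_period_differences:
  fixes t1 t2 t3 s P :: complex
  defines "t1 \<equiv> lat_theta \<tau> (1/2)" and "t2 \<equiv> lat_theta \<tau> (\<tau>/2)" and "t3 \<equiv> lat_theta \<tau> ((1 + \<tau>)/2)"
    and "s \<equiv> nome (\<tau>/2)" and "P \<equiv> euler_phi (nome \<tau>)"
  shows "weierstrass_p (lat \<tau>) (\<tau>/2) - weierstrass_p (lat \<tau>) (1/2) = - 4 * pi^2 * P^4 * t3^2 / (t1^2 * t2^2)"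
    and "weierstrass_p (lat \<tau>) ((1 + \<tau>)/2) - weierstrass_p (lat \<tau>) (1/2) = - 4 * pi^2 * P^4 * t2^2 / (t1^2 * t3^2)"
    and "weierstrass_p (lat \<tau>) ((1 + \<tau>)/2) - weierstrass_p (lat \<tau>) (\<tau>/2) = 4 * pi^2 * P^4 * s * t1^2 / (t2^2 * t3^2)"
proof -
  have "lat_theta \<tau> (\<tau>/2 + 1/2) = t3" "lat_theta \<tau> (\<tau>/2 - 1/2) = t3"
    using lat_theta_plus_1[of \<tau> "\<tau>/2 - 1/2"] Im by (simp_all add: t3_def add_divide_distrib add.commute)
  then show "weierstrass_p (lat \<tau>) (\<tau>/2) - weierstrass_p (lat \<tau>) (1/2) = - 4 * pi^2 * P^4 * t3^2 / (t1^2 * t2^2)"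
    using weierstrass_p_diff[OF Im half_periods_not_in_lat(1,2)]
    by (simp add: P_def t1_def t2_def power2_eq_square mult_ac)
  have "lat_theta \<tau> ((1 + \<tau>)/2 + 1/2) = t2" "lat_theta \<tau> ((1 + \<tau>)/2 - 1/2) = t2"
    using lat_theta_plus_1[of \<tau> "\<tau>/2"] Im by (simp_all add: t2_def field_simps)
  then show "weierstrass_p (lat \<tau>) ((1 + \<tau>)/2) - weierstrass_p (lat \<tau>) (1/2) = - 4 * pi^2 * P^4 * t2^2 / (t1^2 * t3^2)"
    using weierstrass_p_diff[OF Im half_periods_not_in_lat(1,3)]
    by (simp add: P_def t1_def t3_def power2_eq_square mult_ac)
  have "lat_theta \<tau> ((1 + \<tau>)/2 + \<tau>/2) = t1" "lat_theta \<tau> ((1 + \<tau>)/2 - \<tau>/2) = t1"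
    using lat_theta_plus_tau[OF Im, of "1/2"] by (simp_all add: t1_def add_divide_distrib add.commute[of "1/2" \<tau>])
  then show "weierstrass_p (lat \<tau>) ((1 + \<tau>)/2) - weierstrass_p (lat \<tau>) (\<tau>/2) = 4 * pi^2 * P^4 * s * t1^2 / (t2^2 * t3^2)"
    using weierstrass_p_diff[OF Im half_periods_not_in_lat(2,3)]
    by (simp add: P_def t2_def t3_def s_def power2_eq_square mult_ac)
qed

lemma half_period_theta:
  shows "lat_theta \<tau> (1/2) * lat_theta \<tau> (\<tau>/2) * lat_theta \<tau> ((1 + \<tau>)/2) = 2"
    and "lat_theta \<tau> (1/2) * euler_phi (nome \<tau>) ^ 2 = 2 * euler_phi (nome \<tau> ^ 2) ^ 2"
proof -
  have s: "nome (\<tau>/2) ^ 2 = nome \<tau>"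
    using nome_of_nat_mult[of 2 "\<tau>/2"] by simp
  have "nome ((1 + \<tau>)/2) = - nome (\<tau>/2)"
    by (simp add: add_divide_distrib nome_add)
  then show "lat_theta \<tau> (1/2) * lat_theta \<tau> (\<tau>/2) * lat_theta \<tau> ((1 + \<tau>)/2) = 2"
    using theta_half_periods[OF norm_nome_less_1[OF Im] s]
    by (simp add: lat_theta_def mult_ac)
  show "lat_theta \<tau> (1/2) * euler_phi (nome \<tau>) ^ 2 = 2 * euler_phi (nome \<tau> ^ 2) ^ 2"
    using theta_minus_1[OF norm_nome_less_1[OF Im]] by (simp add: lat_theta_def)
qed

text \<open>The discriminant of the cubic is 16 times the squared product of the root differences.
  In that product the theta values occur only through \<open>t1 * t2 * t3 = 2\<close>, so all of
  them disappear. In \<open>(b - a) * (c - a)\<close> only \<open>t1\<close> remains, which is an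
  eta quotient.\<close>

lemma discriminant_product:
  "(60 * eisenstein_G 4 (lat \<tau>) 0)^3 - 27 * (140 * eisenstein_G 6 (lat \<tau>) 0)^2
     = 4096 * pi^12 * nome \<tau> * euler_phi (nome \<tau>) ^ 24"
  and eisenstein_G4_half_product:
  "3 * eisenstein_G 4 (lat \<tau>) (1/2) * euler_phi (nome \<tau> ^ 2) ^ 8 = pi^4 * euler_phi (nome \<tau>) ^ 16"
proof -
  define t1 t2 t3 where "t1 = lat_theta \<tau> (1/2)" and "t2 = lat_theta \<tau> (\<tau>/2)"
    and "t3 = lat_theta \<tau> ((1 + \<tau>)/2)"
  define s P P2 where "s = nome (\<tau>/2)" and "P = euler_phi (nome \<tau>)" and "P2 = euler_phi (nome \<tau> ^ 2)"
  define a b c where "a = weierstrass_p (lat \<tau>) (1/2)" and "b = weierstrass_p (lat \<tau>) (\<tau>/2)"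
    and "c = weierstrass_p (lat \<tau>) ((1 + \<tau>)/2)"
  define g h where "g = 60 * eisenstein_G 4 (lat \<tau>) 0" and "h = 140 * eisenstein_G 6 (lat \<tau>) 0"
  have nz: "t1 \<noteq> 0" "t2 \<noteq> 0" "t3 \<noteq> 0" "s \<noteq> 0" "P \<noteq> 0"
    using lat_theta_nonzero[OF Im] half_periods_not_in_lat euler_phi_nonzero[OF norm_nome_less_1[OF Im]]
    by (auto simp: t1_def t2_def t3_def s_def P_def)
  have d: "b - a = - 4 * pi^2 * P^4 * t3^2 / (t1^2 * t2^2)" "c - a = - 4 * pi^2 * P^4 * t2^2 / (t1^2 * t3^2)"
     "c - b = 4 * pi^2 * P^4 * s * t1^2 / (t2^2 * t3^2)"
    unfolding a_def b_def c_def P_def s_def t1_def t2_def t3_def by (rule half_period_differences)+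
  have t: "t1 * t2 * t3 = 2" "t1 * P^2 = 2 * P2^2"
    unfolding t1_def t2_def t3_def P_def P2_def by (rule half_period_theta)+
  have ne: "a \<noteq> b" "a \<noteq> c" "b \<noteq> c"
    using d nz by auto
  have roots: "4 * a^3 - g * a - h = 0" "4 * b^3 - g * b - h = 0" "4 * c^3 - g * c - h = 0"
  proof -
    have "2 * (1/2) \<in> lat \<tau>" "2 * (\<tau>/2) \<in> lat \<tau>" "2 * ((1 + \<tau>)/2) \<in> lat \<tau>"
      using lat_periods[of \<tau>] lat_add_iff[OF lat_periods(2)[of \<tau>], of 1]
      by (simp_all only: times_divide_eq_right nonzero_mult_div_cancel_left[OF zero_neq_numeral[symmetric]])
    then show "4 * a^3 - g * a - h = 0" "4 * b^3 - g * b - h = 0" "4 * c^3 - g * c - h = 0"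
      unfolding a_def b_def c_def g_def h_def
      using half_period_roots half_periods_not_in_lat by blast+
  qed
  note abc = depressed_cubic_roots[OF ne roots]
  have s2: "s^2 = nome \<tau>"
    using nome_of_nat_mult[of 2 "\<tau>/2"] by (simp add: s_def)
  have "g^3 - 27 * h^2 = 16 * ((b - a) * (c - a) * (c - b))^2"
    using abc by algebra
  also have "(b - a) * (c - a) * (c - b) = 64 * pi^6 * P^12 * s / (t1 * t2 * t3)^2"
    unfolding d using nz by (simp add: field_simps eval_nat_numeral)
  also have "16 * (64 * pi^6 * P^12 * s / (t1 * t2 * t3)^2)^2 = 4096 * pi^12 * nome \<tau> * P^24"
    unfolding t by (simp add: power_mult_distrib power_divide s2 flip: power_mult)
  finally show "(60 * eisenstein_G 4 (lat \<tau>) 0)^3 - 27 * (140 * eisenstein_G 6 (lat \<tau>) 0)^2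
     = 4096 * pi^12 * nome \<tau> * euler_phi (nome \<tau>) ^ 24"
    by (simp add: g_def h_def P_def)
  have "eisenstein_G 4 (lat \<tau>) (1/2) = a^2 - g / 12"
    unfolding a_def g_def by (subst weierstrass_ode(2)[OF Im half_periods_not_in_lat(1)]) simp
  \<comment> \<open>\<open>3 G_4(1/2)\<close> is half of the second derivative of the p-function at
    1/2; differentiating \<open>\<wp>'^2 = 4 (\<wp> - a) (\<wp> - b) (\<wp> - c)\<close> shows why
    it is this product.\<close>
  then have "3 * eisenstein_G 4 (lat \<tau>) (1/2) = (b - a) * (c - a)"
    using abc(1,2) by algebra
  also have "\<dots> = 16 * pi^4 * P^8 / t1^4"
    unfolding d using nz by (simp add: field_simps eval_nat_numeral)
  finally have *: "3 * eisenstein_G 4 (lat \<tau>) (1/2) * t1^4 = 16 * pi^4 * P^8"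
    using nz by (simp add: field_simps)
  have "3 * eisenstein_G 4 (lat \<tau>) (1/2) * (t1 * P^2)^4 = 3 * eisenstein_G 4 (lat \<tau>) (1/2) * t1^4 * P^8"
    by (simp add: power_mult_distrib flip: power_mult)
  also have "\<dots> = 16 * pi^4 * P^16"
    unfolding * by (simp flip: power_add)
  finally have "3 * eisenstein_G 4 (lat \<tau>) (1/2) * (t1 * P^2)^4 = 16 * pi^4 * P^16" .
  then show "3 * eisenstein_G 4 (lat \<tau>) (1/2) * euler_phi (nome \<tau> ^ 2) ^ 8 = pi^4 * euler_phi (nome \<tau>) ^ 16"
    unfolding t by (simp add: power_mult_distrib P_def P2_def mult.assoc flip: power_mult)
qed

lemma nome_third: "nome (1/3)^2 + nome (1/3) + 1 = 0" "nome (1/3) \<noteq> 1"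
proof -
  show *: "nome (1/3) \<noteq> 1"
    unfolding nome_eq_1_iff
  proof
    assume "(1/3 :: complex) \<in> \<int>"
    then obtain n :: int where n: "1/3 = (of_int n :: complex)" by (auto elim: Ints_cases)
    from arg_cong[OF n, of Re] have "(1/3 :: real) = of_int n" by simp
    then show False using third_not_int by (metis Ints_of_int)
  qed
  have "nome (1/3) ^ 3 = 1"
    using nome_of_nat_mult[of 3 "1/3"] by simp
  then have "(nome (1/3) - 1) * (nome (1/3)^2 + nome (1/3) + 1) = 0"
    by algebra
  then show "nome (1/3)^2 + nome (1/3) + 1 = 0"
    using * by auto
qed

text \<open>The point 2/3 is congruent to -1/3, so the theta value in the numerator of the product
  for the derivative is that at 1/3 up to a factor. One power cancels, and
  \<open>theta_cube_root_1\<close> evaluates the remaining cube.\<close>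

lemma eisenstein_G3_third_product:
  "eisenstein_G 3 (lat \<tau>) (1/3) * (1 - nome (1/3))^3 * euler_phi (nome \<tau> ^ 3) ^ 3
     = - 4 * pi^3 * \<i> * euler_phi (nome \<tau>) ^ 9"
proof -
  define P P3 \<rho> t where "P = euler_phi (nome \<tau>)" and "P3 = euler_phi (nome \<tau> ^ 3)"
    and "\<rho> = nome (1/3)" and "t = lat_theta \<tau> (1/3)"
  have t0: "t \<noteq> 0"
    using lat_theta_nonzero[OF Im third_period_not_in_lat] by (simp add: t_def)
  have \<rho>0: "\<rho> \<noteq> 0" by (simp add: \<rho>_def)
  have "lat_theta \<tau> (2 * (1/3)) = - t / \<rho>"
    using lat_theta_plus_1[of \<tau> "- (1/3)"] lat_theta_minus[OF Im, of "1/3"] Im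
    by (simp add: t_def \<rho>_def)
  then have "2 * eisenstein_G 3 (lat \<tau>) (1/3) = 8 * pi^3 * \<i> * P^6 * \<rho> * (- t / \<rho>) / t^4"
    using weierstrass_p_deriv_product[OF Im third_period_not_in_lat]
    by (simp add: P_def \<rho>_def t_def)
  then have "eisenstein_G 3 (lat \<tau>) (1/3) * t^3 = - 4 * pi^3 * \<i> * P^6"
    using t0 \<rho>0 by (simp add: field_simps eval_nat_numeral)
  then have *: "eisenstein_G 3 (lat \<tau>) (1/3) * (t * P)^3 = - 4 * pi^3 * \<i> * P^9"
    by (simp add: power_mult_distrib flip: mult.assoc)
  have "t * P = (1 - \<rho>) * P3"
    using theta_cube_root_1[OF norm_nome_less_1[OF Im] nome_third(1)]
    by (simp add: t_def lat_theta_def P_def P3_def \<rho>_def)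
  with * show ?thesis
    by (metis P_def P3_def \<rho>_def mult.assoc power_mult_distrib)
qed

section \<open>The logarithmic derivative of theta and the point of order three\<close>

definition theta_logderiv :: "complex \<Rightarrow> complex" where
  "theta_logderiv z = deriv (lat_theta \<tau>) z / lat_theta \<tau> z"

lemma theta_logderiv_holomorphic: "theta_logderiv holomorphic_on - lat \<tau>"
proof -
  have "lat_theta \<tau> holomorphic_on - lat \<tau>"
    using lat_theta_holomorphic[OF Im, of "\<lambda>z. z"] by simp
  then show ?thesis
    unfolding theta_logderiv_def[abs_def] using lat_theta_nonzero[OF Im] open_minus_lat(1)[OF Im]
    by (intro holomorphic_intros) auto
qed

lemma theta_logderiv_plus_1: "theta_logderiv (z + 1) = theta_logderiv z"
proof -
  have "deriv (lat_theta \<tau>) (z + 1) = deriv (lat_theta \<tau>) z"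
    using lat_theta_holomorphic[OF Im, of "\<lambda>z. z" UNIV] lat_theta_plus_1[OF Im]
    by (intro deriv_shift[of _ UNIV _ _ 0]) auto
  then show ?thesis
    using lat_theta_plus_1[OF Im] by (simp add: theta_logderiv_def)
qed

text \<open>Translation by \<open>\<tau>\<close> and reflection have the same right-hand side in the
  functional equations of theta, so one derivative serves both.\<close>

lemma lat_theta_nome_deriv:
  "((\<lambda>z. - lat_theta \<tau> z / nome z) has_field_derivative
      - (deriv (lat_theta \<tau>) z - 2 * pi * \<i> * lat_theta \<tau> z) / nome z) (at z)"
proof -
  have "((\<lambda>z. - lat_theta \<tau> z / nome z) has_field_derivative
     (- deriv (lat_theta \<tau>) z * nome z - (- lat_theta \<tau> z) * (2 * pi * \<i> * nome z)) / (nome z * nome z)) (at z)"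
    by (intro DERIV_divide DERIV_minus lat_theta_has_field_derivative[OF Im] has_field_derivative_nome) simp
  then show ?thesis
    by (rule DERIV_cong) (simp add: field_simps)
qed

lemma theta_logderiv_plus_tau:
  assumes "z \<notin> lat \<tau>"
  shows "theta_logderiv (z + \<tau>) = theta_logderiv z - 2 * pi * \<i>"
proof -
  have "((\<lambda>z. lat_theta \<tau> (z + \<tau>)) has_field_derivative deriv (lat_theta \<tau>) (z + \<tau>) * 1) (at z)"
    by (rule DERIV_chain2[where g = "\<lambda>x. x + \<tau>", OF lat_theta_has_field_derivative[OF Im]])
       (auto intro!: derivative_eq_intros)
  then have eq: "deriv (lat_theta \<tau>) (z + \<tau>) = - (deriv (lat_theta \<tau>) z - 2 * pi * \<i> * lat_theta \<tau> z) / nome z"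
    unfolding lat_theta_plus_tau[OF Im] using DERIV_unique[OF _ lat_theta_nome_deriv] by fastforce
  show ?thesis
    unfolding theta_logderiv_def lat_theta_plus_tau[OF Im] eq
    using lat_theta_nonzero[OF Im assms] by (simp add: field_simps)
qed

lemma theta_logderiv_minus:
  assumes "z \<notin> lat \<tau>"
  shows "theta_logderiv (- z) = 2 * pi * \<i> - theta_logderiv z"
proof -
  have "((\<lambda>z. lat_theta \<tau> (- z)) has_field_derivative deriv (lat_theta \<tau>) (- z) * (- 1)) (at z)"
    by (rule DERIV_chain2[where g = "\<lambda>x. - x", OF lat_theta_has_field_derivative[OF Im]])
       (auto intro!: derivative_eq_intros)
  then have "- deriv (lat_theta \<tau>) (- z) = - (deriv (lat_theta \<tau>) z - 2 * pi * \<i> * lat_theta \<tau> z) / nome z"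
    unfolding lat_theta_minus[OF Im] using DERIV_unique[OF _ lat_theta_nome_deriv] by fastforce
  then show ?thesis
    using lat_theta_nonzero[OF Im assms]
    by (simp add: theta_logderiv_def lat_theta_minus[OF Im] field_simps)
qed

text \<open>Both functions have a simple pole with residue 1 at each lattice point, and their
  derivatives are elliptic, so these differ by a constant. This constant \<open>c\<close> is the
  increment of zeta along the period 1; it stays undetermined, because it cancels where the lemma is
  applied.\<close>

lemma theta_logderiv_weierstrass_zeta:
  obtains c where
    "\<And>z. z \<notin> lat \<tau> \<Longrightarrow> weierstrass_zeta (lat \<tau>) z = theta_logderiv z - pi * \<i> + c * z"
    "\<And>z. z \<notin> lat \<tau> \<Longrightarrow> deriv theta_logderiv z = - weierstrass_p (lat \<tau>) z - c"
proof -
  let ?M = theta_logderiv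
  have Md: "(?M has_field_derivative deriv ?M z) (at z)" if "z \<notin> lat \<tau>" for z
    using theta_logderiv_holomorphic open_minus_lat(1)[OF Im] that by (auto intro: holomorphic_derivI)
  obtain r1 U where r1: "r1 > 0" "ball 0 r1 \<inter> lat \<tau> = {0}" "U holomorphic_on ball 0 r1"
    and U: "\<And>z. z \<in> ball 0 r1 \<Longrightarrow> lat_theta \<tau> z = z * U z" "\<And>z. z \<in> ball 0 r1 \<Longrightarrow> U z \<noteq> 0"
    by (rule lat_theta_near_0[OF Im]) (rule that; assumption)
  obtain r2 S where r2: "r2 > 0" "S holomorphic_on ball 0 r2"
    and p: "\<And>z. z \<in> ball 0 r2 \<Longrightarrow> z \<notin> lat \<tau> \<Longrightarrow> weierstrass_p (lat \<tau>) z = 1 / z^2 +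
        z^2 * (3 * eisenstein_G 4 (lat \<tau>) 0 + 5 * eisenstein_G 6 (lat \<tau>) 0 * z^2 - z^4 * S z)"
    by (rule zsum_derivs_taylor[OF Im]) (rule that; assumption)
  define r where "r = min r1 r2"
  have r: "r > 0" "ball 0 r \<subseteq> ball 0 r1" "ball 0 r \<subseteq> ball 0 r2"
    using r1(1) r2(1) by (auto simp: r_def)
  define W where "W = (\<lambda>z. deriv U z / U z)"
  have W: "W holomorphic_on ball 0 r1"
    unfolding W_def using r1(3) U(2) by (intro holomorphic_intros) auto
  have M_near: "?M z = 1 / z + W z" if "z \<in> ball 0 r1 - {0}" for z
  proof -
    have z: "z \<in> ball 0 r1" "z \<noteq> 0" using that by auto
    have "(U has_field_derivative deriv U z) (at z)"
      using r1(3) z(1) by (auto intro: holomorphic_derivI)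
    then have "((\<lambda>z. z * U z) has_field_derivative (1 * U z + deriv U z * z)) (at z)"
      by (rule DERIV_mult[OF DERIV_ident])
    then have "(lat_theta \<tau> has_field_derivative (1 * U z + deriv U z * z)) (at z)"
      by (rule has_field_derivative_transform_within_open[OF _ open_ball[of 0 r1] z(1)]) (use U(1) in auto)
    then have "deriv (lat_theta \<tau>) z = U z + deriv U z * z"
      by (simp add: DERIV_imp_deriv)
    then show ?thesis
      using U[OF z(1)] z(2) by (simp add: theta_logderiv_def W_def field_simps)
  qed
  have dM_near: "deriv ?M z = - 1 / z^2 + deriv W z" if "z \<in> ball 0 r1 - {0}" for z
  proof (rule DERIV_imp_deriv, rule has_field_derivative_transform_within_open[OF _ _ that])
    have z: "z \<in> ball 0 r1" "z \<noteq> 0" using that by auto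
    have "(W has_field_derivative deriv W z) (at z)"
      using W z(1) by (auto intro: holomorphic_derivI)
    moreover have "((\<lambda>z. 1 / z) has_field_derivative - 1 / z^2) (at z)"
      using z(2) by (auto intro!: derivative_eq_intros simp: power2_eq_square)
    ultimately show "((\<lambda>z. 1 / z + W z) has_field_derivative - 1 / z^2 + deriv W z) (at z)"
      by (intro DERIV_add)
  qed (use M_near in auto)
  let ?h = "\<lambda>z. - weierstrass_p (lat \<tau>) z - deriv ?M z"
  let ?g = "\<lambda>z. - (z^2 * (3 * eisenstein_G 4 (lat \<tau>) 0 + 5 * eisenstein_G 6 (lat \<tau>) 0 * z^2 - z^4 * S z)) - deriv W z"
  define c where "c = ?g 0"
  have c: "?h z = c" if "z \<notin> lat \<tau>" for z
    unfolding c_def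
  proof (rule elliptic_constant[OF Im _ _ _ r(1) _ _ that, of ?h ?g])
    show "?h holomorphic_on - lat \<tau>"
      by (intro holomorphic_intros weierstrass_p_holomorphic[OF Im] theta_logderiv_holomorphic open_minus_lat(1)[OF Im])
    show "?g holomorphic_on ball 0 r"
      using holomorphic_on_subset[OF r2(2) r(3)] holomorphic_on_subset[OF W r(2)]
      by (intro holomorphic_intros) auto
    fix z assume z: "z \<notin> lat \<tau>"
    show "?h (z + 1) = ?h z"
      using weierstrass_p_periodic[OF Im z] z lat_add_iff[OF lat_periods(1)[of \<tau>]]
        deriv_shift[OF theta_logderiv_holomorphic open_minus_lat(1)[OF Im], of z 1 0] theta_logderiv_plus_1
      by auto
    show "?h (z + \<tau>) = ?h z"
      using weierstrass_p_periodic[OF Im z] z lat_add_iff[OF lat_periods(2)[of \<tau>]]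
        deriv_shift[OF theta_logderiv_holomorphic open_minus_lat(1)[OF Im], of z \<tau> "- 2 * pi * \<i>"]
        theta_logderiv_plus_tau
      by auto
  next
    fix z assume z: "z \<in> ball 0 r" "z \<notin> lat \<tau>"
    then have "z \<noteq> 0" using lat_zero by auto
    then have z': "z \<in> ball 0 r1 - {0}" "z \<in> ball 0 r2" using z(1) r(2,3) by blast+
    show "?h z = ?g z"
      using dM_near[OF z'(1)] p[OF z'(2) z(2)] by simp
  qed
  obtain d where d: "\<And>z. z \<notin> lat \<tau> \<Longrightarrow> weierstrass_zeta (lat \<tau>) z - ?M z - c * z = d"
  proof (rule constant_on_minus_lat[OF Im])
    fix z assume z: "z \<notin> lat \<tau>"
    have "((\<lambda>z. weierstrass_zeta (lat \<tau>) z - ?M z - c * z) has_field_derivative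
       - weierstrass_p (lat \<tau>) z - deriv ?M z - c * 1) (at z)"
      by (intro DERIV_diff has_field_derivative_weierstrass_zeta[OF Im z] Md[OF z] DERIV_cmult DERIV_ident)
    then show "((\<lambda>z. weierstrass_zeta (lat \<tau>) z - ?M z - c * z) has_field_derivative 0) (at z)"
      using c[OF z] by simp
  qed (rule that)
  \<comment> \<open>Zeta is odd, whereas the values of the logarithmic derivative at
    \<open>z\<close> and \<open>- z\<close> add up to \<open>2 * pi * \<i>\<close>. Adding the
    relations at 1/2 and -1/2 therefore isolates \<open>d\<close>.\<close>
  have h: "1 / 2 \<notin> lat \<tau>" "- (1 / 2) \<notin> lat \<tau>"
    using half_periods_not_in_lat(1) by auto
  have "2 * d = (weierstrass_zeta (lat \<tau>) (1/2) - ?M (1/2) - c * (1/2))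
      + (weierstrass_zeta (lat \<tau>) (- (1/2)) - ?M (- (1/2)) - c * - (1/2))"
    unfolding d[OF h(1)] d[OF h(2)] by simp
  also have "\<dots> = 2 * (- (pi * \<i>))"
    unfolding weierstrass_zeta_minus[OF Im] theta_logderiv_minus[OF h(1)] by simp
  finally have "d = - (pi * \<i>)"
    by (metis mult_cancel_left zero_neq_numeral)
  then show ?thesis
    using d c by (intro that[of c]) (force simp: algebra_simps)+
qed

text \<open>The logarithmic derivative of the product formula for \<open>G_3\<close>: the three
  terms of the bracket come from \<open>nome z\<close>, from the theta value at
  \<open>2 * z\<close>, and from the fourth power in the denominator. The left side is the
  derivative of \<open>G_3\<close>.\<close>

lemma eisenstein_G3_logderiv:
  assumes "z \<notin> lat \<tau>" "2 * z \<notin> lat \<tau>"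
  shows "- 3 * eisenstein_G 4 (lat \<tau>) z =
    eisenstein_G 3 (lat \<tau>) z * (2 * pi * \<i> + 2 * theta_logderiv (2 * z) - 4 * theta_logderiv z)"
proof -
  define T where "T = lat_theta \<tau>"
  define C where "C = 4 * pi^3 * \<i> * euler_phi (nome \<tau>) ^ 6"
  have T: "T z \<noteq> 0" "T (2 * z) \<noteq> 0" using lat_theta_nonzero[OF Im] assms by (auto simp: T_def)
  have Td: "(T has_field_derivative deriv T x) (at x)" for x
    using lat_theta_has_field_derivative[OF Im] by (simp add: T_def)
  have eq: "C * nome x * T (2 * x) / T x ^ 4 = eisenstein_G 3 (lat \<tau>) x" if "x \<in> - lat \<tau>" for x
  proof -
    have "2 * eisenstein_G 3 (lat \<tau>) x = 2 * (C * nome x * T (2 * x) / T x ^ 4)"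
      using weierstrass_p_deriv_product[OF Im, of x] that by (simp add: C_def T_def)
    then show ?thesis by (metis mult_cancel_left zero_neq_numeral)
  qed
  have 1: "((\<lambda>x. C * nome x) has_field_derivative C * (2 * pi * \<i> * nome z)) (at z)"
    by (intro DERIV_cmult has_field_derivative_nome)
  have 2: "((\<lambda>x. T (2 * x)) has_field_derivative deriv T (2 * z) * 2) (at z)"
    by (rule DERIV_chain2[where g = "\<lambda>x. 2 * x", OF Td]) (auto intro!: derivative_eq_intros)
  have 3: "((\<lambda>x. T x ^ 4) has_field_derivative 4 * T z ^ 3 * deriv T z) (at z)"
    using DERIV_power[OF Td, of 4 z] by (simp add: mult_ac)
  have "((\<lambda>x. C * nome x * T (2 * x) / T x ^ 4) has_field_derivative
     ((C * (2 * pi * \<i> * nome z) * T (2 * z) + deriv T (2 * z) * 2 * (C * nome z)) * T z ^ 4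
       - C * nome z * T (2 * z) * (4 * T z ^ 3 * deriv T z)) / (T z ^ 4 * T z ^ 4)) (at z)"
    using T by (intro DERIV_divide DERIV_mult 1 2 3) auto
  then have "(eisenstein_G 3 (lat \<tau>) has_field_derivative
     ((C * (2 * pi * \<i> * nome z) * T (2 * z) + deriv T (2 * z) * 2 * (C * nome z)) * T z ^ 4
       - C * nome z * T (2 * z) * (4 * T z ^ 3 * deriv T z)) / (T z ^ 4 * T z ^ 4)) (at z)"
    by (rule has_field_derivative_transform_within_open[OF _ open_minus_lat(1)[OF Im]])
       (use assms eq in auto)
  moreover have "(eisenstein_G 3 (lat \<tau>) has_field_derivative - 3 * eisenstein_G 4 (lat \<tau>) z) (at z)"
    using has_field_derivative_eisenstein_G[OF Im assms(1), of 2] by simp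
  ultimately have "- 3 * eisenstein_G 4 (lat \<tau>) z =
     ((C * (2 * pi * \<i> * nome z) * T (2 * z) + deriv T (2 * z) * 2 * (C * nome z)) * T z ^ 4
       - C * nome z * T (2 * z) * (4 * T z ^ 3 * deriv T z)) / (T z ^ 4 * T z ^ 4)"
    by (metis DERIV_unique)
  also have "\<dots> = (C * nome z * T (2 * z) / T z ^ 4) *
       (2 * pi * \<i> + 2 * (deriv T (2 * z) / T (2 * z)) - 4 * (deriv T z / T z))"
    using T by (simp add: divide_simps) (simp add: algebra_simps eval_nat_numeral)
  also have "C * nome z * T (2 * z) / T z ^ 4 = eisenstein_G 3 (lat \<tau>) z"
    using eq assms by simp
  finally show ?thesis
    by (simp add: theta_logderiv_def T_def)
qed

text \<open>At 1/3 the bracket of \<open>eisenstein_G3_logderiv\<close> is \<open>- 6 * s\<close>,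
  which gives \<open>G_4\<close>. Differentiating that relation at 1/3 gives \<open>G_5\<close>;
  comparing with \<open>G_5\<close> from the formula for the second derivative of the p-function
  gives \<open>x\<close>, after cancelling \<open>G\<close>.\<close>

lemma third_period_relations:
  defines "x \<equiv> weierstrass_p (lat \<tau>) (1/3)"
    and "s \<equiv> weierstrass_zeta (lat \<tau>) (1/3) - 2/3 * weierstrass_zeta (lat \<tau>) (1/2)"
    and "G \<equiv> eisenstein_G 3 (lat \<tau>) (1/3)"
  shows "eisenstein_G 4 (lat \<tau>) (1/3) = 2 * s * G" "x = 3 * s^2" "G \<noteq> 0"
proof -
  let ?M = theta_logderiv
  obtain c where z: "\<And>z. z \<notin> lat \<tau> \<Longrightarrow> weierstrass_zeta (lat \<tau>) z = ?M z - pi * \<i> + c * z"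
    and dM: "\<And>z. z \<notin> lat \<tau> \<Longrightarrow> deriv ?M z = - weierstrass_p (lat \<tau>) z - c"
    by (rule theta_logderiv_weierstrass_zeta) (rule that; assumption)
  have third: "1/3 \<notin> lat \<tau>" "- (1/3) \<notin> lat \<tau>" "2 * (1/3) \<notin> lat \<tau>" "- (1/2) \<notin> lat \<tau>"
    using third_period_not_in_lat half_periods_not_in_lat(1)
      lat_add_iff[OF lat_periods(1)[of \<tau>], of "- (1/3)"] lat_uminus_iff[of "1/3" \<tau>] lat_uminus_iff[of "1/2" \<tau>]
    by simp_all
  have M2: "?M (2 * (1/3)) = 2 * pi * \<i> - ?M (1/3)"
    using theta_logderiv_plus_1[of "- (1/3)"] theta_logderiv_minus[OF third(1)] by simp
  have "?M (1/2) = 2 * pi * \<i> - ?M (1/2)"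
    using theta_logderiv_plus_1[of "- (1/2)"] theta_logderiv_minus[OF half_periods_not_in_lat(1)] by simp
  then have "?M (1/2) + ?M (1/2) = 2 * pi * \<i>" by (simp only: eq_diff_eq)
  then have M_half: "?M (1/2) = pi * \<i>" by simp
  \<comment> \<open>The coefficient of \<open>c\<close> is 1/3 - 2/3 times 1/2 = 0, and the bracket
    at 1/2 contributes nothing because \<open>M_half\<close> equals the constant
    \<open>pi * \<i>\<close>.\<close>
  have s: "s = ?M (1/3) - pi * \<i>"
    unfolding s_def z[OF third(1)] z[OF half_periods_not_in_lat(1)] M_half by simp
  show G4: "eisenstein_G 4 (lat \<tau>) (1/3) = 2 * s * G"
    using eisenstein_G3_logderiv[OF third(1,3)] M2 s unfolding G_def of_real_mult of_real_numeral by algebra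
  have "G * (1 - nome (1/3))^3 * euler_phi (nome \<tau> ^ 3) ^ 3 \<noteq> 0"
    unfolding G_def eisenstein_G3_third_product
    using euler_phi_nonzero[OF norm_nome_less_1[OF Im]] by simp
  then show G0: "G \<noteq> 0" by auto
  \<comment> \<open>To be differentiated, the relation must hold on an open set around 1/3; it
    requires both \<open>z\<close> and \<open>2 * z\<close> to avoid the lattice.\<close>
  define D where "D = {z. z \<notin> lat \<tau> \<and> 2 * z \<notin> lat \<tau>}"
  have "D = - lat \<tau> \<inter> (\<lambda>z. 2 * z) -` (- lat \<tau>)"
    by (auto simp: D_def)
  moreover have "open ((\<lambda>z. 2 * z) -` (- lat \<tau>))"
    by (rule open_vimage[OF open_minus_lat(1)[OF Im]]) (intro continuous_intros)
  ultimately have D: "open D" "1/3 \<in> D"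
    using open_minus_lat(1)[OF Im] third(1,3) by (auto simp: D_def)
  have Md: "(?M has_field_derivative deriv ?M z) (at z)" if "z \<notin> lat \<tau>" for z
    using theta_logderiv_holomorphic open_minus_lat(1)[OF Im] that by (auto intro: holomorphic_derivI)
  have Md2: "((\<lambda>z. ?M (2 * z)) has_field_derivative deriv ?M (2 * (1/3)) * 2) (at (1/3))"
    by (rule DERIV_chain2[where g = "\<lambda>x. 2 * x", OF Md[OF third(3)]]) (auto intro!: derivative_eq_intros)
  \<comment> \<open>The bracket of the relation. Its derivative at 1/3 is four times the difference
    of the derivatives of \<open>?M\<close> at 2/3 and 1/3; by \<open>dM\<close> this vanishes,
    because the p-function is even and has period 1.\<close>
  define N where "N = (\<lambda>z. 2 * pi * \<i> + 2 * ?M (2 * z) - 4 * ?M z)"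
  have "(N has_field_derivative 0 + 2 * (deriv ?M (2 * (1/3)) * 2) - 4 * deriv ?M (1/3)) (at (1/3))"
    unfolding N_def by (intro DERIV_add DERIV_diff DERIV_cmult DERIV_const Md2 Md third(1))
  moreover have "weierstrass_p (lat \<tau>) (2 * (1/3)) = weierstrass_p (lat \<tau>) (1/3)"
    using weierstrass_p_periodic(1)[OF Im third(2)] weierstrass_p_minus[OF Im, of "1/3"] by simp
  ultimately have N': "(N has_field_derivative 0) (at (1/3))"
    using dM[OF third(1)] dM[OF third(3)] by simp
  have G3': "(eisenstein_G 3 (lat \<tau>) has_field_derivative - 3 * eisenstein_G 4 (lat \<tau>) (1/3)) (at (1/3))"
    using has_field_derivative_eisenstein_G[OF Im third(1), of 2] by simp
  have G4': "(eisenstein_G 4 (lat \<tau>) has_field_derivative - 4 * eisenstein_G 5 (lat \<tau>) (1/3)) (at (1/3))"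
    using has_field_derivative_eisenstein_G[OF Im third(1), of 3] by simp
  have "((\<lambda>z. eisenstein_G 3 (lat \<tau>) z * N z) has_field_derivative
      - 3 * eisenstein_G 4 (lat \<tau>) (1/3) * N (1/3) + 0 * G) (at (1/3))"
    unfolding G_def by (intro DERIV_mult G3' N')
  then have "((\<lambda>z. - 3 * eisenstein_G 4 (lat \<tau>) z) has_field_derivative
      - 3 * eisenstein_G 4 (lat \<tau>) (1/3) * N (1/3) + 0 * G) (at (1/3))"
  proof (rule has_field_derivative_transform_within_open[OF _ D])
    show "eisenstein_G 3 (lat \<tau>) z * N z = - 3 * eisenstein_G 4 (lat \<tau>) z" if "z \<in> D" for z
      unfolding N_def by (rule eisenstein_G3_logderiv[symmetric]) (use that in \<open>auto simp: D_def\<close>)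
  qed
  moreover have "((\<lambda>z. - 3 * eisenstein_G 4 (lat \<tau>) z) has_field_derivative
      - 3 * (- 4 * eisenstein_G 5 (lat \<tau>) (1/3))) (at (1/3))"
    by (intro DERIV_cmult G4')
  ultimately have e1: "- 3 * eisenstein_G 4 (lat \<tau>) (1/3) * N (1/3) + 0 * G
      = - 3 * (- 4 * eisenstein_G 5 (lat \<tau>) (1/3))"
    by (rule DERIV_unique)
  \<comment> \<open>Second evaluation of \<open>G_5(1/3)\<close>: the square of the p-function
    differs from \<open>G_4\<close> by a constant.\<close>
  have "((\<lambda>z. weierstrass_p (lat \<tau>) z * weierstrass_p (lat \<tau>) z - 5 * eisenstein_G 4 (lat \<tau>) 0)
      has_field_derivative (- 2 * G * x + - 2 * G * x) - 0) (at (1/3))"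
    unfolding G_def x_def
    by (intro DERIV_diff DERIV_mult has_field_derivative_weierstrass_p[OF Im third(1)] DERIV_const)
  then have "(eisenstein_G 4 (lat \<tau>) has_field_derivative (- 2 * G * x + - 2 * G * x) - 0) (at (1/3))"
    by (rule has_field_derivative_transform_within_open[OF _ open_minus_lat(1)[OF Im]])
       (use third weierstrass_ode(2)[OF Im] in \<open>auto simp: power2_eq_square\<close>)
  from DERIV_unique[OF this G4'] have e2: "eisenstein_G 5 (lat \<tau>) (1/3) = x * G"
    by (simp add: algebra_simps)
  have "N (1/3) = - 6 * s"
    unfolding N_def M2 s by simp
  with e1 e2 G4 have "12 * (x * G) = 36 * s^2 * G"
    by algebra
  then show "x = 3 * s^2"
    using G0 by simp
qed

end

subsection \<open>Discriminants and the eta function\<close>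

lemma csqrt_of_pos_real_mult:
  assumes "r > 0"
  shows "csqrt (of_real r * z) = of_real (sqrt r) * csqrt z"
proof (rule csqrt_unique)
  show "(of_real (sqrt r) * csqrt z)\<^sup>2 = of_real r * z"
    using assms by (simp add: power_mult_distrib flip: of_real_power)
  show "0 < Re (of_real (sqrt r) * csqrt z) \<or> Re (of_real (sqrt r) * csqrt z) = 0 \<and> 0 \<le> Im (of_real (sqrt r) * csqrt z)"
    using csqrt_principal[of z] assms by (auto simp: zero_less_mult_iff)
qed

section \<open>Homogeneity in the lattice\<close>

lemma period_lattice_scale:
  assumes "a \<noteq> 0"
  shows "period_lattice (a, b) = (*) a ` lat (b / a)"
proof -
  have "of_int m * a + of_int n * b = a * (of_int m * 1 + of_int n * (b / a))" for m n :: int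
    using assms by (simp add: field_simps)
  then show ?thesis
    unfolding period_lattice_def by (auto simp: image_iff)
qed

text \<open>The change of basis behind the inversion: this basis spans the same lattice, and its
  ratio is \<open>- 1 / \<tau>\<close>.\<close>

lemma period_lattice_rotate: "period_lattice (\<tau>, - 1) = lat \<tau>"
proof -
  have "of_int m * \<tau> + of_int n * (- 1) = of_int (- n) * 1 + of_int m * \<tau>" for m n :: int
    by simp
  then have "x \<in> lat \<tau>" if "x \<in> period_lattice (\<tau>, - 1)" for x
    using that unfolding period_lattice_def by blast
  moreover have "of_int m * 1 + of_int n * \<tau> = of_int n * \<tau> + of_int (- m) * (- 1)" for m n :: int
    by simp
  then have "x \<in> period_lattice (\<tau>, - 1)" if "x \<in> lat \<tau>" for x
    using that unfolding period_lattice_def by blast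
  ultimately show ?thesis by blast
qed

context
  fixes a b :: complex
  assumes a: "a \<noteq> 0"
begin

lemma infsum_period_lattice:
  fixes f :: "complex \<Rightarrow> complex"
  shows "infsum f (period_lattice (a, b)) = infsum (\<lambda>x. f (a * x)) (lat (b / a))"
    and "infsum f (period_lattice (a, b) - {0}) = infsum (\<lambda>x. f (a * x)) (lat (b / a) - {0})"
proof -
  have inj: "inj_on ((*) a) S" for S
    using a by (auto simp: inj_on_def)
  show "infsum f (period_lattice (a, b)) = infsum (\<lambda>x. f (a * x)) (lat (b / a))"
    unfolding period_lattice_scale[OF a] by (subst infsum_reindex[OF inj]) (simp add: o_def)
  have "period_lattice (a, b) - {0} = (*) a ` (lat (b / a) - {0})"
    using a by (auto simp: period_lattice_scale[OF a])
  then show "infsum f (period_lattice (a, b) - {0}) = infsum (\<lambda>x. f (a * x)) (lat (b / a) - {0})"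
    by (simp add: infsum_reindex[OF inj] o_def)
qed

lemma eisenstein_G_scale:
  "eisenstein_G m (period_lattice (a, b)) (a * z) = eisenstein_G m (lat (b / a)) z / a ^ m"
proof -
  have "1 / (a * x + a * z) ^ m = (1 / a ^ m) * (1 / (x + z) ^ m)" "1 / (a * x) ^ m = (1 / a ^ m) * (1 / x ^ m)"
    for x by (simp_all add: power_mult_distrib flip: distrib_left)
  then show ?thesis
    using a by (simp only: eisenstein_G_def infsum_period_lattice infsum_cmult_right') simp
qed

lemma weierstrass_p_scale:
  "weierstrass_p (period_lattice (a, b)) (a * z) = weierstrass_p (lat (b / a)) z / a ^ 2"
proof -
  have "1 / (a * z - a * x)^2 - 1 / (a * x)^2 = (1 / a ^ 2) * (1 / (z - x)^2 - 1 / x^2)" for x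
  proof -
    have "(a * z - a * x)^2 = a^2 * (z - x)^2"
      by (simp add: power_mult_distrib flip: right_diff_distrib)
    then show ?thesis
      by (simp add: power_mult_distrib right_diff_distrib)
  qed
  then show ?thesis
    using a by (simp only: weierstrass_p_def infsum_period_lattice infsum_cmult_right')
               (simp add: power_mult_distrib add_divide_distrib)
qed

lemma weierstrass_zeta_scale:
  "weierstrass_zeta (period_lattice (a, b)) (a * z) = weierstrass_zeta (lat (b / a)) z / a"
proof -
  have "1 / (a * z - a * x) + 1 / (a * x) + a * z / (a * x)^2 = (1 / a) * (1 / (z - x) + 1 / x + z / x^2)" for x
  proof -
    have "1 / (a * z - a * x) = (1 / a) * (1 / (z - x))"
      by (simp flip: right_diff_distrib)
    moreover have "a * z / (a * x)^2 = (1 / a) * (z / x^2)"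
      using a by (simp add: power2_eq_square)
    ultimately show ?thesis by (simp add: distrib_left)
  qed
  then show ?thesis
    using a by (simp only: weierstrass_zeta_def infsum_period_lattice infsum_cmult_right')
               (simp add: add_divide_distrib)
qed

lemma g_s_scale:
  "g_s 3 (a, b) = g_s 3 (1, b / a) / a ^ 4"
  "g_s 4 (a, b) = g_s 4 (1, b / a) / a ^ 2"
  "g_s 6 (a, b) = g_s 6 (1, b / a) / a"
  using eisenstein_G_scale[of 4 0] weierstrass_p_scale[of "1/2"] weierstrass_zeta_scale[of "1/2"]
    weierstrass_zeta_scale[of "1/3"]
  by (simp_all add: g_s_def Let_def diff_divide_distrib)

lemma g_l_scale:
  "g_l 3 (a, b) = g_l 3 (1, b / a) / a ^ 6"
  "g_l 4 (a, b) = g_l 4 (1, b / a) / a ^ 4"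
  "g_l 6 (a, b) = g_l 6 (1, b / a) / a ^ 3"
  using eisenstein_G_scale[of 6 0] eisenstein_G_scale[of 4 0] eisenstein_G_scale[of 4 "1/2"]
    weierstrass_p_scale[of "1/2"] eisenstein_G_scale[of 3 "1/3"]
  by (simp_all add: g_l_def Let_def diff_divide_distrib add_divide_distrib power_divide g_s_scale(3)
        mult.commute flip: power_mult)

lemma discr_scale:
  assumes "p \<in> {3, 4, 6}"
  shows "discr p (g_s p (a, b)) (g_l p (a, b)) = discr p (g_s p (1, b / a)) (g_l p (1, b / a)) / a ^ 12"
    and "discr_red p (g_s p (a, b)) (g_l p (a, b)) = discr_red p (g_s p (1, b / a)) (g_l p (1, b / a)) / a ^ (2 * wt p)"
proof -
  have 4: "(x / a^4 + (y / a^2)^2) * (- x / a^4 + (y / a^2)^2)^2 = (x + y^2) * (- x + y^2)^2 / a^12" for x y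
  proof -
    have "(y / a^2)^2 = y^2 / a^4" by (simp add: power_divide flip: power_mult)
    then have "(x / a^4 + (y / a^2)^2) * (- x / a^4 + (y / a^2)^2)^2 = ((x + y^2) / a^4) * ((- x + y^2) / a^4)^2"
      by (simp only: add_divide_distrib)
    then show ?thesis by (simp add: power_divide flip: power_mult power_add)
  qed
  have r4: "(y / a^2)^4 - 64 * (x / a^4)^2 = (y^4 - 64 * x^2) / a^8" for x y
    by (simp add: power_divide diff_divide_distrib flip: power_mult)
  have 6: "(x / a^3 + 2 * (y / a)^3) * (- x / a^3 + 2 * (y / a)^3)^3 = (x + 2 * y^3) * (- x + 2 * y^3)^3 / a^12" for x y
  proof -
    have "2 * (y / a)^3 = 2 * y^3 / a^3" by (simp add: power_divide)
    then have "(x / a^3 + 2 * (y / a)^3) * (- x / a^3 + 2 * (y / a)^3)^3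
        = ((x + 2 * y^3) / a^3) * ((- x + 2 * y^3) / a^3)^3"
      by (simp only: add_divide_distrib)
    then show ?thesis by (simp add: power_divide flip: power_mult power_add)
  qed
  have r6: "4 * (y / a)^6 - (x / a^3)^2 = (4 * y^6 - x^2) / a^6" for x y
    by (simp add: power_divide diff_divide_distrib flip: power_mult)
  have 3: "(y / a^4)^3 - 27 * (x / a^6)^2 = (y^3 - 27 * x^2) / a^12" for x y
    by (simp add: power_divide diff_divide_distrib flip: power_mult)
  show "discr p (g_s p (a, b)) (g_l p (a, b)) = discr p (g_s p (1, b / a)) (g_l p (1, b / a)) / a ^ 12"
    using assms 3 4[of "8 * g_l 4 (1, b / a)" "g_s 4 (1, b / a)"] 6[of "g_l 6 (1, b / a)" "g_s 6 (1, b / a)"]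
    by (auto simp: discr_def g_s_scale g_l_scale)
  show "discr_red p (g_s p (a, b)) (g_l p (a, b)) = discr_red p (g_s p (1, b / a)) (g_l p (1, b / a)) / a ^ (2 * wt p)"
    using assms 3 r4 r6 by (auto simp: discr_red_def g_s_scale g_l_scale wt_def)
qed

end

section \<open>The eta function and its inversion formula\<close>

lemma dedekind_eta_eq:
  assumes "Im \<tau> > 0"
  shows "dedekind_eta \<tau> = nome (\<tau> / 24) * euler_phi (nome \<tau>)"
  using assms by (simp add: dedekind_eta_def upper_half_plane_def nome_def qpoch_def)

lemma dedekind_eta_power_24:
  assumes "Im \<tau> > 0"
  shows "dedekind_eta \<tau> ^ 24 = nome \<tau> * euler_phi (nome \<tau>) ^ 24"
  using nome_of_nat_mult[of 24 "\<tau> / 24"] by (simp add: dedekind_eta_eq[OF assms] power_mult_distrib)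

lemma modular_discr_eq_eta:
  assumes "Im \<tau> > 0"
  shows "modular_discr \<tau> = dedekind_eta \<tau> ^ 24"
proof -
  have "modular_discr \<tau> = nome \<tau> * prodinf (\<lambda>n. (1 - nome \<tau> * nome \<tau> ^ n) ^ 24)"
    by (simp add: modular_discr_def nome_def)
  also have "prodinf (\<lambda>n. (1 - nome \<tau> * nome \<tau> ^ n) ^ 24) = euler_phi (nome \<tau>) ^ 24"
    unfolding qpoch_def by (rule prodinf_power[OF convergent_prod_qpoch[OF norm_nome_less_1[OF assms]]])
  finally show ?thesis
    by (simp add: dedekind_eta_power_24[OF assms])
qed

lemma dedekind_eta_nonzero: "Im \<tau> > 0 \<Longrightarrow> dedekind_eta \<tau> \<noteq> 0"
  using euler_phi_nonzero[OF norm_nome_less_1] by (simp add: dedekind_eta_eq)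

lemma dedekind_eta_holomorphic:
  assumes "f holomorphic_on A" "\<And>z. z \<in> A \<Longrightarrow> Im (f z) > 0"
  shows "(\<lambda>z. dedekind_eta (f z)) holomorphic_on A"
proof -
  have "(\<lambda>z. euler_phi (nome (f z))) holomorphic_on A"
    by (rule holomorphic_on_compose_gen[where g = euler_phi and f = "\<lambda>z. nome (f z)" and t = "ball 0 1",
          unfolded o_def])
       (use assms norm_nome_less_1 holomorphic_euler_phi in \<open>auto intro!: holomorphic_intros\<close>)
  then have "(\<lambda>z. nome (f z / 24) * euler_phi (nome (f z))) holomorphic_on A"
    using assms(1) by (intro holomorphic_intros) auto
  then show ?thesis
    by (rule holomorphic_transform) (use assms(2) dedekind_eta_eq in auto)
qed

lemma Im_minus_inverse_pos: "Im \<tau> > 0 \<Longrightarrow> Im (- 1 / \<tau>) > 0"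
  by (simp add: Im_divide add_nonneg_pos)

lemma dedekind_eta_24_transform:
  assumes "Im \<tau> > 0"
  shows "dedekind_eta (- 1 / \<tau>) ^ 24 = \<tau> ^ 12 * dedekind_eta \<tau> ^ 24"
proof -
  have \<tau>: "\<tau> \<noteq> 0" using assms by auto
  have G: "eisenstein_G m (lat \<tau>) 0 = eisenstein_G m (lat (- 1 / \<tau>)) 0 / \<tau> ^ m" for m
    using eisenstein_G_scale[OF \<tau>, of m "- 1" 0] by (simp add: period_lattice_rotate)
  have *: "4096 * pi^12 * dedekind_eta \<tau> ^ 24 =
      (60 * eisenstein_G 4 (lat \<tau>) 0)^3 - 27 * (140 * eisenstein_G 6 (lat \<tau>) 0)^2" if "Im \<tau> > 0" for \<tau>
    using discriminant_product[OF that] by (simp add: dedekind_eta_power_24[OF that])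
  have "4096 * pi^12 * dedekind_eta \<tau> ^ 24 = 4096 * pi^12 * (dedekind_eta (- 1 / \<tau>) ^ 24 / \<tau> ^ 12)"
    unfolding *[OF assms] using *[OF Im_minus_inverse_pos[OF assms]]
    by (simp add: G power_divide diff_divide_distrib flip: power_mult)
  then show ?thesis using \<tau> by (simp add: field_simps)
qed

lemma dedekind_eta_transform:
  assumes "Im \<tau> > 0"
  shows "dedekind_eta (- 1 / \<tau>) = csqrt (- \<i> * \<tau>) * dedekind_eta \<tau>"
proof -
  define h where "h = (\<lambda>\<tau>. dedekind_eta (- 1 / \<tau>) / (csqrt (- \<i> * \<tau>) * dedekind_eta \<tau>))"
  have nz: "csqrt (- \<i> * \<tau>) * dedekind_eta \<tau> \<noteq> 0" if "Im \<tau> > 0" for \<tau>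
    using dedekind_eta_nonzero[OF that] that by auto
  have 24: "h \<tau> ^ 24 = 1" if "Im \<tau> > 0" for \<tau>
  proof -
    have "csqrt (- \<i> * \<tau>) ^ 24 = ((csqrt (- \<i> * \<tau>))^2)^12"
      by (simp only: power_mult[symmetric]) simp
    also have "\<dots> = \<tau> ^ 12"
      by (simp only: power2_csqrt power_mult_distrib) (simp flip: power_mult)
    finally have "(csqrt (- \<i> * \<tau>) * dedekind_eta \<tau>) ^ 24 = \<tau> ^ 12 * dedekind_eta \<tau> ^ 24"
      by (simp add: power_mult_distrib)
    then show ?thesis
      unfolding h_def power_divide dedekind_eta_24_transform[OF that]
      using nz[OF that] by (metis divide_self power_not_zero)
  qed
  have "h constant_on upper_half_plane"
  proof (rule continuous_finite_range_constant)
    show "connected upper_half_plane"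
      unfolding upper_half_plane_def by (intro convex_connected) (simp add: convex_halfspace_Im_gt)
    have "h holomorphic_on upper_half_plane"
      unfolding h_def upper_half_plane_def
    proof (intro holomorphic_intros dedekind_eta_holomorphic)
      show "- \<i> * z \<notin> \<real>\<^sub>\<le>\<^sub>0" if "z \<in> {\<tau>. 0 < Im \<tau>}" for z
        using that by (auto simp: complex_nonpos_Reals_iff)
    qed (use nz Im_minus_inverse_pos in auto)
    then show "continuous_on upper_half_plane h"
      by (rule holomorphic_on_imp_continuous_on)
    have "h ` upper_half_plane \<subseteq> {z. z ^ 24 = 1}"
      using 24 by (auto simp: upper_half_plane_def)
    then show "finite (h ` upper_half_plane)"
      by (rule finite_subset) (simp add: finite_nth_roots)
  qed
  then obtain c where c: "\<And>\<tau>. Im \<tau> > 0 \<Longrightarrow> h \<tau> = c"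
    by (auto simp: constant_on_def upper_half_plane_def)
  \<comment> \<open>\<open>\<i>\<close> is the fixed point of the inversion, and the square root
    there is that of 1.\<close>
  have "h \<i> = 1"
    using dedekind_eta_nonzero[of \<i>] by (simp add: h_def)
  then have "h \<tau> = 1"
    using c[OF assms] c[of \<i>] by simp
  then show ?thesis
    using nz[OF assms] by (simp add: h_def field_simps)
qed

section \<open>The product \<open>lambda_form\<close> and the discriminants\<close>

lemma lambda_form_eq:
  assumes "Im \<tau> > 0" "level p > 0"
  shows "lambda_form p \<tau> = nome ((1 + of_nat (level p)) * \<tau> / 24) *
    euler_phi (nome \<tau>) * euler_phi (nome \<tau> ^ level p)"
proof -
  have Im2: "Im (of_nat (level p) * \<tau>) > 0" using assms by simp
  have "nome ((1 + of_nat (level p)) * \<tau> / 24) = nome (\<tau> / 24) * nome (of_nat (level p) * \<tau> / 24)"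
    by (simp add: distrib_right add_divide_distrib nome_add)
  then show ?thesis
    unfolding lambda_form_def dedekind_eta_eq[OF assms(1)] dedekind_eta_eq[OF Im2] nome_of_nat_mult
    by simp
qed

lemma level_values: "level 3 = 1" "level 4 = 2" "level 6 = 3"
  by (simp_all add: level_def)

text \<open>In all three cases \<open>(1 + level p) * wt p = 12\<close>, so the fractional exponent
  of q in \<open>lambda_form\<close> becomes exactly 1.\<close>

lemma lambda_form_power:
  assumes "Im \<tau> > 0" "p \<in> {3, 4, 6}"
  shows "lambda_form p \<tau> ^ (2 * wt p) = nome \<tau> *
    euler_phi (nome \<tau>) ^ (2 * wt p) * euler_phi (nome \<tau> ^ level p) ^ (2 * wt p)"
proof -
  have l: "level p > 0" using assms(2) by (auto simp: level_def)
  have "nome ((1 + of_nat (level p)) * \<tau> / 24) ^ (2 * wt p) =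
      nome (of_nat (2 * wt p) * ((1 + of_nat (level p)) * \<tau> / 24))"
    by (simp only: nome_of_nat_mult)
  also have "of_nat (2 * wt p) * ((1 + of_nat (level p)) * \<tau> / 24) = \<tau>"
    using assms(2) by (auto simp: level_def wt_def)
  finally show ?thesis
    by (simp add: lambda_form_eq[OF assms(1) l] power_mult_distrib)
qed

text \<open>Pure algebra over the relations at the point of order one, two or three. For p = 4 the
  unknowns are \<open>e\<close> and \<open>Y = G_4(1/2)\<close>, for p = 6 \<open>s\<close> and
  \<open>G = G_3(1/3)\<close>, and \<open>D\<close> factors in them. The power of \<open>Y\<close>
  or \<open>G\<close> by which the reduced discriminant differs from \<open>D\<close> stands on the
  left, which avoids a division.\<close>

lemma discr_values:
  assumes "Im \<tau> > 0"
  defines "D \<equiv> (60 * eisenstein_G 4 (lat \<tau>) 0)^3 - 27 * (140 * eisenstein_G 6 (lat \<tau>) 0)^2"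
  shows "discr 3 (g_s 3 (1, \<tau>)) (g_l 3 (1, \<tau>)) = D / 4096"
    and "discr_red 3 (g_s 3 (1, \<tau>)) (g_l 3 (1, \<tau>)) = D / 4096"
    and "discr 4 (g_s 4 (1, \<tau>)) (g_l 4 (1, \<tau>)) = D / 8"
    and "48 * eisenstein_G 4 (lat \<tau>) (1/2) * discr_red 4 (g_s 4 (1, \<tau>)) (g_l 4 (1, \<tau>)) = D"
    and "discr 6 (g_s 6 (1, \<tau>)) (g_l 6 (1, \<tau>)) = D / 432"
    and "432 * eisenstein_G 3 (lat \<tau>) (1/3) ^ 2 * discr_red 6 (g_s 6 (1, \<tau>)) (g_l 6 (1, \<tau>)) = D"
proof -
  define A B where "A = eisenstein_G 4 (lat \<tau>) 0" and "B = eisenstein_G 6 (lat \<tau>) 0"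
  have D: "D = (60 * A)^3 - 27 * (140 * B)^2"
    by (simp add: D_def A_def B_def)
  have 3: "g_s 3 (1, \<tau>) = 15 / 4 * A" "g_l 3 (1, \<tau>) = 35 / 16 * B"
    by (simp_all add: g_s_def g_l_def A_def B_def)
  show "discr 3 (g_s 3 (1, \<tau>)) (g_l 3 (1, \<tau>)) = D / 4096"
    and "discr_red 3 (g_s 3 (1, \<tau>)) (g_l 3 (1, \<tau>)) = D / 4096"
    unfolding D 3 discr_def discr_red_def by (simp_all add: power_mult_distrib power_divide)
  define e Y where "e = weierstrass_p (lat \<tau>) (1/2)" and "Y = eisenstein_G 4 (lat \<tau>) (1/2)"
  note half = half_periods_not_in_lat(1)[OF assms(1)]
  have "2 * (1 / 2) \<in> lat \<tau>" using lat_periods[of \<tau>] by simp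
  then have B4: "140 * B = 4 * e^3 - 60 * A * e"
    using half_period_roots[OF assms(1) half] by (simp add: e_def A_def B_def algebra_simps)
  have A4: "5 * A = e^2 - Y"
    using weierstrass_ode(2)[OF assms(1) half] by (simp add: e_def A_def Y_def)
  have D4: "D = 432 * Y^2 * (3 * e^2 - 4 * Y)"
    unfolding D B4 using A4 by algebra
  have "8 * g_l 4 (1, \<tau>) = 5 / 4 * e^2 + (5 * A) - 5 * Y"
    by (simp add: g_l_def A_def e_def Y_def Let_def)
  then have 4: "g_s 4 (1, \<tau>) ^ 2 = 9 / 4 * e^2" "8 * g_l 4 (1, \<tau>) = 9 / 4 * e^2 - 6 * Y"
    unfolding A4 by (simp_all add: g_s_def e_def power_mult_distrib power_divide)
  show "discr 4 (g_s 4 (1, \<tau>)) (g_l 4 (1, \<tau>)) = D / 8"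
  proof -
    have "discr 4 (g_s 4 (1, \<tau>)) (g_l 4 (1, \<tau>)) =
        (8 * g_l 4 (1, \<tau>) + g_s 4 (1, \<tau>) ^ 2) * (g_s 4 (1, \<tau>) ^ 2 - 8 * g_l 4 (1, \<tau>))^2"
      by (simp add: discr_def)
    also have "\<dots> = 54 * Y^2 * (3 * e^2 - 4 * Y)"
      unfolding 4 by (simp add: algebra_simps power2_eq_square)
    finally show ?thesis by (simp add: D4)
  qed
  show "48 * eisenstein_G 4 (lat \<tau>) (1/2) * discr_red 4 (g_s 4 (1, \<tau>)) (g_l 4 (1, \<tau>)) = D"
  proof -
    have "discr_red 4 (g_s 4 (1, \<tau>)) (g_l 4 (1, \<tau>)) =
        (g_s 4 (1, \<tau>) ^ 2)^2 - (8 * g_l 4 (1, \<tau>))^2"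
      by (simp add: discr_red_def power_mult_distrib flip: power_mult)
    also have "\<dots> = 9 * Y * (3 * e^2 - 4 * Y)"
      unfolding 4 by (simp add: algebra_simps power2_eq_square)
    finally show ?thesis by (simp add: D4 power2_eq_square flip: Y_def)
  qed
  define x s G where "x = weierstrass_p (lat \<tau>) (1/3)"
    and "s = weierstrass_zeta (lat \<tau>) (1/3) - 2/3 * weierstrass_zeta (lat \<tau>) (1/2)"
    and "G = eisenstein_G 3 (lat \<tau>) (1/3)"
  note third = third_period_not_in_lat[OF assms(1)]
  have x: "x = 3 * s^2" and G4: "eisenstein_G 4 (lat \<tau>) (1/3) = 2 * s * G"
    unfolding x_def s_def G_def using third_period_relations[OF assms(1)] by simp_all
  have A6: "5 * A = x^2 - 2 * s * G"
    using weierstrass_ode(2)[OF assms(1) third] G4 by (simp add: x_def A_def)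
  have B6: "140 * B = 4 * x^3 - 60 * A * x - (2 * G)^2"
    using weierstrass_ode(1)[OF assms(1) third] by (simp add: x_def A_def B_def G_def)
  \<comment> \<open>This factorization needs \<open>x = 3 * s^2\<close>: the terms with fewer than
    three factors \<open>G\<close> then cancel.\<close>
  have D6: "D = 432 * G^3 * (4 * s^3 - G)"
    unfolding D B6 using A6 x by algebra
  have 6: "g_s 6 (1, \<tau>) = s" "g_l 6 (1, \<tau>) = 2 * s^3 - G"
    by (simp_all add: g_s_def g_l_def s_def G_def Let_def)
  show "discr 6 (g_s 6 (1, \<tau>)) (g_l 6 (1, \<tau>)) = D / 432"
    unfolding 6 D6 discr_def by (simp add: algebra_simps)
  have "4 * s^6 - (2 * s^3 - G)^2 = G * (4 * s^3 - G)"
    by algebra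
  then show "432 * eisenstein_G 3 (lat \<tau>) (1/3) ^ 2 * discr_red 6 (g_s 6 (1, \<tau>)) (g_l 6 (1, \<tau>)) = D"
    unfolding 6 D6 discr_red_def G_def[symmetric] by (simp add: power2_eq_square power3_eq_cube)
qed

lemma discr_proportional:
  assumes "p \<in> {3, 4, 6}"
  shows "\<exists>C::complex. C \<noteq> 0 \<and>
        (\<forall>(\<omega>0, \<omega>1) \<in> H_tilde.
           discr p (g_s p (\<omega>0, \<omega>1)) (g_l p (\<omega>0, \<omega>1)) = C * modular_discr (\<omega>1 / \<omega>0) * \<omega>0 powi (- 12))"
proof -
  define c :: complex where "c = (if p = 3 then 4096 else if p = 4 then 8 else 432)"
  have "discr p (g_s p (\<omega>0, \<omega>1)) (g_l p (\<omega>0, \<omega>1))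
      = 4096 * pi^12 / c * modular_discr (\<omega>1 / \<omega>0) * \<omega>0 powi (- 12)" if "(\<omega>0, \<omega>1) \<in> H_tilde" for \<omega>0 \<omega>1
  proof -
    have Im: "Im (\<omega>1 / \<omega>0) > 0" and w0: "\<omega>0 \<noteq> 0"
      using that by (auto simp: H_tilde_def)
    have "discr p (g_s p (1, \<omega>1 / \<omega>0)) (g_l p (1, \<omega>1 / \<omega>0)) =
        ((60 * eisenstein_G 4 (lat (\<omega>1 / \<omega>0)) 0)^3 - 27 * (140 * eisenstein_G 6 (lat (\<omega>1 / \<omega>0)) 0)^2) / c"
      using assms discr_values(1,3,5)[OF Im] by (auto simp: c_def)
    also have "\<dots> = 4096 * pi^12 * modular_discr (\<omega>1 / \<omega>0) / c"
      unfolding discriminant_product[OF Im] modular_discr_eq_eta[OF Im] dedekind_eta_power_24[OF Im]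
      by (simp add: mult.assoc)
    finally have "discr p (g_s p (1, \<omega>1 / \<omega>0)) (g_l p (1, \<omega>1 / \<omega>0)) = 4096 * pi^12 * modular_discr (\<omega>1 / \<omega>0) / c" .
    then show ?thesis
      by (simp add: discr_scale[OF w0 assms] power_int_minus divide_inverse mult_ac)
  qed
  then show ?thesis
    by (intro exI[of _ "4096 * pi^12 / c"]) (auto simp: c_def)
qed

text \<open>Dividing \<open>q P^24\<close> by the products for \<open>Y\<close> or
  \<open>G^2\<close> leaves \<open>q P^8 Q^8\<close> or \<open>q P^6 Q^6\<close>, where
  \<open>P\<close> and \<open>Q\<close> are the Euler products at q and at its N-th power. For p = 6
  the constant is \<open>16 * pi^6\<close>, since the sixth power of \<open>1 - nome (1/3)\<close>
  is -27; only its being non-zero matters.\<close>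

lemma discr_red_value:
  assumes "Im \<tau> > 0" "p \<in> {3, 4, 6}"
  defines "c \<equiv> (if p = 3 then pi^12 else if p = 4 then 256 * pi^8
     else - 16 * pi^6 * (1 - nome (1/3))^6 / 27 :: complex)"
  shows "discr_red p (g_s p (1, \<tau>)) (g_l p (1, \<tau>)) = c * lambda_form p \<tau> ^ (2 * wt p)"
proof -
  define q P where "q = nome \<tau>" and "P = euler_phi (nome \<tau>)"
  have P: "P \<noteq> 0" "euler_phi (q ^ 2) \<noteq> 0" "euler_phi (q ^ 3) \<noteq> 0"
    using norm_nome_less_1[OF assms(1)] euler_phi_nonzero
    by (simp_all add: P_def q_def norm_power power_less_one_iff)
  have D: "(60 * eisenstein_G 4 (lat \<tau>) 0)^3 - 27 * (140 * eisenstein_G 6 (lat \<tau>) 0)^2 = 4096 * pi^12 * q * P^24"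
    using discriminant_product[OF assms(1)] by (simp add: P_def q_def)
  note V = discr_values[OF assms(1), unfolded D]
  consider "p = 3" | "p = 4" | "p = 6" using assms(2) by auto
  then show ?thesis
  proof cases
    case 1
    have "lambda_form 3 \<tau> ^ 12 = q * P^24"
      using lambda_form_power[OF assms(1), of 3]
      by (simp add: wt_def level_values P_def q_def flip: power_add)
    then show ?thesis
      using V(2) 1 by (simp add: c_def wt_def)
  next
    case 2
    define Y Q where "Y = eisenstein_G 4 (lat \<tau>) (1/2)" and "Q = euler_phi (q ^ 2)"
    have Y: "3 * Y * Q^8 = pi^4 * P^16"
      using eisenstein_G4_half_product[OF assms(1)] by (simp add: Y_def Q_def q_def P_def)
    have l: "lambda_form 4 \<tau> ^ 8 = q * P^8 * Q^8"
      using lambda_form_power[OF assms(1), of 4]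
      by (simp add: wt_def level_values P_def q_def Q_def)
    have "(16 * pi^4 * P^16) * discr_red 4 (g_s 4 (1, \<tau>)) (g_l 4 (1, \<tau>))
        = 16 * (3 * Y * Q^8) * discr_red 4 (g_s 4 (1, \<tau>)) (g_l 4 (1, \<tau>))"
      unfolding Y by simp
    also have "\<dots> = (48 * Y * discr_red 4 (g_s 4 (1, \<tau>)) (g_l 4 (1, \<tau>))) * Q^8"
      by simp
    also have "\<dots> = 4096 * pi^12 * q * P^24 * Q^8"
      using V(4) by (simp add: Y_def)
    also have "\<dots> = 16 * 256 * (pi^4 * pi^8) * q * (P^16 * P^8) * Q^8"
      by (simp flip: of_real_mult power_add)
    also have "\<dots> = (16 * pi^4 * P^16) * (256 * pi^8 * (q * P^8 * Q^8))"
      by (simp only: of_real_mult mult_ac)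
    finally show ?thesis
      using P 2 l by (simp add: c_def wt_def)
  next
    case 3
    define G Q \<rho> where "G = eisenstein_G 3 (lat \<tau>) (1/3)" and "Q = euler_phi (q ^ 3)" and "\<rho> = nome (1/3)"
    have G: "G * (1 - \<rho>)^3 * Q^3 = - 4 * pi^3 * \<i> * P^9"
      using eisenstein_G3_third_product[OF assms(1)] by (simp add: G_def Q_def q_def P_def \<rho>_def)
    have l: "lambda_form 6 \<tau> ^ 6 = q * P^6 * Q^6"
      using lambda_form_power[OF assms(1), of 6]
      by (simp add: wt_def level_values P_def q_def Q_def)
    have "(- 6912 * pi^6 * P^18) * discr_red 6 (g_s 6 (1, \<tau>)) (g_l 6 (1, \<tau>))
        = 432 * (- 4 * pi^3 * \<i> * P^9)^2 * discr_red 6 (g_s 6 (1, \<tau>)) (g_l 6 (1, \<tau>))"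
      by (simp add: power_mult_distrib flip: power_mult)
    also have "\<dots> = 432 * (G * (1 - \<rho>)^3 * Q^3)^2 * discr_red 6 (g_s 6 (1, \<tau>)) (g_l 6 (1, \<tau>))"
      unfolding G ..
    also have "\<dots> = (432 * G^2 * discr_red 6 (g_s 6 (1, \<tau>)) (g_l 6 (1, \<tau>))) * (1 - \<rho>)^6 * Q^6"
      by (simp add: power_mult_distrib flip: power_mult)
    also have "\<dots> = 4096 * pi^12 * q * P^24 * (1 - \<rho>)^6 * Q^6"
      using V(6) by (simp add: G_def)
    also have "\<dots> = (- 6912 * pi^6 * P^18) * (- 16 * pi^6 * (1 - \<rho>)^6 / 27 * (q * P^6 * Q^6))"
    proof -
      have "4096 * x^12 * q * P^24 * u * Q^6 = (- 6912 * x^6 * P^18) * (- 16 * x^6 * u / 27 * (q * P^6 * Q^6))"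
        for x u :: complex by algebra
      from this[of "of_real pi" "(1 - \<rho>)^6"] show ?thesis
        by (simp only: of_real_power of_real_mult of_real_numeral of_real_neg_numeral)
    qed
    finally have "discr_red 6 (g_s 6 (1, \<tau>)) (g_l 6 (1, \<tau>)) = - 16 * pi^6 * (1 - \<rho>)^6 / 27 * (q * P^6 * Q^6)"
    proof (rule mult_left_cancel[THEN iffD1, rotated])
      show "complex_of_real (- 6912 * pi^6) * P^18 \<noteq> 0" using P(1) by simp
    qed
    then show ?thesis
      unfolding l[symmetric] using 3 by (simp add: c_def wt_def \<rho>_def)
  qed
qed

lemma discr_red_proportional:
  assumes "p \<in> {3, 4, 6}"
  shows "\<exists>C::complex. C \<noteq> 0 \<and>
        (\<forall>(\<omega>0, \<omega>1) \<in> H_tilde.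
           discr_red p (g_s p (\<omega>0, \<omega>1)) (g_l p (\<omega>0, \<omega>1))
             = C * lambda_form p (\<omega>1 / \<omega>0) ^ (2 * wt p) * \<omega>0 powi (- int (2 * wt p)))"
proof -
  define c :: complex where "c = (if p = 3 then pi^12 else if p = 4 then 256 * pi^8
     else - 16 * pi^6 * (1 - nome (1/3))^6 / 27)"
  have "discr_red p (g_s p (\<omega>0, \<omega>1)) (g_l p (\<omega>0, \<omega>1))
      = c * lambda_form p (\<omega>1 / \<omega>0) ^ (2 * wt p) * \<omega>0 powi (- int (2 * wt p))" if "(\<omega>0, \<omega>1) \<in> H_tilde" for \<omega>0 \<omega>1
  proof -
    have Im: "Im (\<omega>1 / \<omega>0) > 0" and w0: "\<omega>0 \<noteq> 0"
      using that by (auto simp: H_tilde_def)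
    show ?thesis
      unfolding discr_scale[OF w0 assms] discr_red_value[OF Im assms, folded c_def]
      by (simp only: power_int_minus power_int_of_nat divide_inverse)
  qed
  moreover have "c \<noteq> 0"
    using nome_third(2)[of \<i>] by (simp add: c_def)
  ultimately show ?thesis by blast
qed

text \<open>The Fricke involution exchanges the two eta factors. The square roots of both inversion
  formulas differ by a positive real factor, so their product is free of any choice of
  branch.\<close>

lemma lambda_form_fricke:
  assumes "Im \<tau> > 0" "level p > 0"
  shows "lambda_form p (- 1 / (of_nat (level p) * \<tau>)) =
     - \<i> * of_real (sqrt (level p)) * \<tau> * lambda_form p \<tau>"
proof -
  define N where "N = level p"
  have N: "N > 0" "(of_nat N :: complex) \<noteq> 0" using assms(2) by (auto simp: N_def)
  have \<tau>: "\<tau> \<noteq> 0" using assms(1) by auto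
  have Im2: "Im (of_nat N * \<tau>) > 0" using assms(1) N by simp
  have "of_nat N * (- 1 / (of_nat N * \<tau>)) = - 1 / \<tau>"
    using N \<tau> by (simp add: field_simps)
  then have "lambda_form p (- 1 / (of_nat N * \<tau>)) = dedekind_eta (- 1 / (of_nat N * \<tau>)) * dedekind_eta (- 1 / \<tau>)"
    by (simp add: lambda_form_def N_def)
  also have "\<dots> = csqrt (- \<i> * (of_nat N * \<tau>)) * csqrt (- \<i> * \<tau>) * lambda_form p \<tau>"
    unfolding dedekind_eta_transform[OF assms(1)] dedekind_eta_transform[OF Im2]
    by (simp add: lambda_form_def N_def)
  also have "csqrt (- \<i> * (of_nat N * \<tau>)) = of_real (sqrt N) * csqrt (- \<i> * \<tau>)"
    using csqrt_of_pos_real_mult[of "real N" "- \<i> * \<tau>"] N by (simp add: mult_ac)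
  also have "of_real (sqrt N) * csqrt (- \<i> * \<tau>) * csqrt (- \<i> * \<tau>) = of_real (sqrt N) * (- \<i> * \<tau>)"
    by (simp only: mult.assoc power2_csqrt flip: power2_eq_square)
  finally show ?thesis by (simp add: N_def mult_ac)
qed

no_notation fps_nth (infixl "$" 75)

subsection \<open>The congruence groups\<close>

definition mat2 :: "int \<Rightarrow> int \<Rightarrow> int \<Rightarrow> int \<Rightarrow> int^2^2" where
  "mat2 a b c d = vector [vector [a, b], vector [c, d]]"

lemma mat2_entries [simp]:
  "mat2 a b c d $ 1 $ 1 = a" "mat2 a b c d $ 1 $ 2 = b" "mat2 a b c d $ 2 $ 1 = c" "mat2 a b c d $ 2 $ 2 = d"
  by (simp_all add: mat2_def)

lemma mat2_eq_iff:
  fixes A B :: "int^2^2"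
  shows "A = B \<longleftrightarrow> A $ 1 $ 1 = B $ 1 $ 1 \<and> A $ 1 $ 2 = B $ 1 $ 2 \<and> A $ 2 $ 1 = B $ 2 $ 1 \<and> A $ 2 $ 2 = B $ 2 $ 2"
  by (auto simp: vec_eq_iff forall_2)

lemma mat2_cases: obtains a b c d where "(\<gamma> :: int^2^2) = mat2 a b c d"
proof
  show "\<gamma> = mat2 (\<gamma> $ 1 $ 1) (\<gamma> $ 1 $ 2) (\<gamma> $ 2 $ 1) (\<gamma> $ 2 $ 2)"
    by (simp add: mat2_eq_iff)
qed

lemma mat2_mult [simp]:
  "mat2 a b c d ** mat2 a' b' c' d' = mat2 (a * a' + b * c') (a * b' + b * d') (c * a' + d * c') (c * b' + d * d')"
  by (simp add: mat2_eq_iff matrix_matrix_mult_def sum_2)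

lemma mat2_uminus [simp]: "- mat2 a b c d = mat2 (- a) (- b) (- c) (- d)"
  by (simp add: mat2_eq_iff)

lemma mat2_SL2Z [simp]: "mat2 a b c d \<in> SL2Z \<longleftrightarrow> a * d - b * c = 1"
  by (simp add: SL2Z_def det_2)

lemma mat2_Gamma1:
  "mat2 a b c d \<in> Gamma1 N \<longleftrightarrow> a * d - b * c = 1 \<and> [a = 1] (mod int N) \<and> [d = 1] (mod int N) \<and> [c = 0] (mod int N)"
  by (simp add: Gamma1_def)

lemma mat_A_mat2: "mat_A N = mat2 1 0 (- int N) 1" and mat_B_mat2: "mat_B = mat2 1 1 0 1"
  by (simp_all add: mat_A_def mat_B_def mat2_def)

lemma Gamma1_SL2Z: "\<gamma> \<in> Gamma1 N \<Longrightarrow> \<gamma> \<in> SL2Z"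
  by (simp add: Gamma1_def)

lemma Gamma1_mult:
  assumes "\<gamma> \<in> Gamma1 N" "\<gamma>' \<in> Gamma1 N"
  shows "\<gamma> ** \<gamma>' \<in> Gamma1 N"
proof -
  obtain a b c d where g: "\<gamma> = mat2 a b c d" by (rule mat2_cases)
  obtain a' b' c' d' where g': "\<gamma>' = mat2 a' b' c' d'" by (rule mat2_cases)
  have 1: "a * d - b * c = 1" "[a = 1] (mod int N)" "[d = 1] (mod int N)" "[c = 0] (mod int N)"
    using assms(1) by (simp_all add: g mat2_Gamma1)
  have 2: "a' * d' - b' * c' = 1" "[a' = 1] (mod int N)" "[d' = 1] (mod int N)" "[c' = 0] (mod int N)"
    using assms(2) by (simp_all add: g' mat2_Gamma1)
  have "(a * a' + b * c') * (c * b' + d * d') - (a * b' + b * d') * (c * a' + d * c')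
      = (a * d - b * c) * (a' * d' - b' * c')"
    by (simp add: algebra_simps)
  moreover have "[a * a' + b * c' = 1 * 1 + b * 0] (mod int N)" "[c * b' + d * d' = 0 * b' + 1 * 1] (mod int N)"
    "[c * a' + d * c' = 0 * a' + d * 0] (mod int N)"
    using 1 2 by (intro cong_add cong_mult cong_refl; simp)+
  ultimately show ?thesis
    using 1(1) 2(1) by (simp add: g g' mat2_Gamma1)
qed

text \<open>A remainder of at most half the modulus, obtained by choosing between
  \<open>d mod m\<close> and \<open>d mod m - m\<close>; the usual remainder would not give enough
  descent for N = 2 and 3.\<close>

lemma centered_remainder:
  fixes d m :: int
  assumes "m \<noteq> 0"
  obtains j where "2 * \<bar>d + m * j\<bar> \<le> \<bar>m\<bar>"
proof -
  define r where "r = d mod m"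
  have r: "d + m * (- (d div m)) = r" "d + m * (- (d div m) - 1) = r - m"
    unfolding r_def by (simp_all add: minus_mult_div_eq_mod[symmetric] algebra_simps)
  have "2 * \<bar>r\<bar> \<le> \<bar>m\<bar> \<or> 2 * \<bar>r - m\<bar> \<le> \<bar>m\<bar>"
  proof (cases "m > 0")
    case True
    then show ?thesis
      using pos_mod_sign[OF True, of d, folded r_def] pos_mod_bound[OF True, of d, folded r_def] by arith
  next
    case False
    then have "m < 0" using assms by simp
    then show ?thesis
      using neg_mod_sign[of m d, folded r_def] neg_mod_bound[of m d, folded r_def] by arith
  qed
  then show ?thesis
    using that r by metis
qed

text \<open>Division with centered remainder of the bottom row, alternately by \<open>c\<close> and by \<open>N d\<close>,
  decreases \<open>\<bar>c\<bar>\<close> because \<open>N / 4 < 1\<close>.\<close>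

lemma Gamma1_induct:
  assumes "N \<in> {1, 2, 3}" "\<gamma> \<in> Gamma1 N"
    and one: "P (mat2 1 0 0 1)"
    and B: "\<And>\<gamma>. \<gamma> \<in> Gamma1 N \<Longrightarrow> P \<gamma> \<Longrightarrow> P (\<gamma> ** mat2 1 1 0 1)"
    and B': "\<And>\<gamma>. \<gamma> \<in> Gamma1 N \<Longrightarrow> P \<gamma> \<Longrightarrow> P (\<gamma> ** mat2 1 (- 1) 0 1)"
    and A: "\<And>\<gamma>. \<gamma> \<in> Gamma1 N \<Longrightarrow> P \<gamma> \<Longrightarrow> P (\<gamma> ** mat2 1 0 (- int N) 1)"
    and A': "\<And>\<gamma>. \<gamma> \<in> Gamma1 N \<Longrightarrow> P \<gamma> \<Longrightarrow> P (\<gamma> ** mat2 1 0 (int N) 1)"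
  shows "P \<gamma>"
proof -
  have gB: "mat2 1 j 0 1 \<in> Gamma1 N" and gA: "mat2 1 0 (int N * j) 1 \<in> Gamma1 N" for j
    by (simp_all add: mat2_Gamma1 cong_0_iff)
  have PB: "P (\<gamma> ** mat2 1 j 0 1)" if "\<gamma> \<in> Gamma1 N" "P \<gamma>" for \<gamma> j
  proof (induction j rule: int_induct[of _ 0])
    case base
    then show ?case using that(2) by (cases \<gamma> rule: mat2_cases) simp
  next
    case (step1 i)
    have "P (\<gamma> ** mat2 1 i 0 1 ** mat2 1 1 0 1)"
      using step1 that gB by (intro B Gamma1_mult)
    then show ?case by (simp flip: matrix_mul_assoc add: add.commute)
  next
    case (step2 i)
    have "P (\<gamma> ** mat2 1 i 0 1 ** mat2 1 (- 1) 0 1)"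
      using step2 that gB by (intro B' Gamma1_mult)
    then show ?case by (simp flip: matrix_mul_assoc)
  qed
  have PA: "P (\<gamma> ** mat2 1 0 (int N * j) 1)" if "\<gamma> \<in> Gamma1 N" "P \<gamma>" for \<gamma> j
  proof (induction j rule: int_induct[of _ 0])
    case base
    then show ?case using that(2) by (cases \<gamma> rule: mat2_cases) simp
  next
    case (step1 i)
    have "P (\<gamma> ** mat2 1 0 (int N * i) 1 ** mat2 1 0 (int N) 1)"
      using step1 that gA by (intro A' Gamma1_mult)
    then show ?case by (simp flip: matrix_mul_assoc add: algebra_simps)
  next
    case (step2 i)
    have "P (\<gamma> ** mat2 1 0 (int N * i) 1 ** mat2 1 0 (- int N) 1)"
      using step2 that gA by (intro A Gamma1_mult)
    then show ?case by (simp flip: matrix_mul_assoc add: algebra_simps)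
  qed
  have one_in: "mat2 1 0 0 1 \<in> Gamma1 N"
    using gB[of 0] .
  have "P \<gamma>" if "\<gamma> \<in> Gamma1 N" "nat \<bar>\<gamma> $ 2 $ 1\<bar> = n" for n \<gamma>
    using that
  proof (induction n arbitrary: \<gamma> rule: less_induct)
    case (less n)
    obtain a b c d where g: "\<gamma> = mat2 a b c d" by (rule mat2_cases)
    have det: "a * d - b * c = 1" and cong: "[a = 1] (mod int N)" "[d = 1] (mod int N)" "[c = 0] (mod int N)"
      using less.prems(1) by (simp_all add: g mat2_Gamma1)
    show ?case
    proof (cases "c = 0")
      case True
      then have "a * d = 1" using det by simp
      then consider "a = 1" "d = 1" | "a = - 1" "d = - 1"
        using zmult_eq_1_iff by auto
      then show ?thesis
      proof cases
        case 1
        then show ?thesis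
          using PB[OF one_in one, of b] True by (simp add: g)
      next
        case 2
        have "N = 1 \<or> N = 2"
          using assms(1) cong(2) 2 by (auto simp: cong_def)
        \<comment> \<open>\<open>-1\<close> as a word in the generators: \<open>A B\<close> has
          trace \<open>2 - N\<close>, so its square is \<open>-1\<close> for N = 2 and its cube is
          \<open>-1\<close> for N = 1. The word \<open>?m\<close> is the square, \<open>?m'\<close>
          below the cube.\<close>
        moreover have P1: "P (mat2 1 0 0 1 ** mat2 1 0 (int N * (- 1)) 1 ** mat2 1 1 0 1 ** mat2 1 0 (int N * (- 1)) 1 ** mat2 1 1 0 1)"
          (is "P ?m")
          by (intro PA PB one Gamma1_mult one_in gA gB)
        have m1: "?m \<in> Gamma1 N"
          by (intro one_in Gamma1_mult gA gB)
        moreover have "P (?m ** mat2 1 0 (int N * (- 1)) 1 ** mat2 1 1 0 1)" (is "P ?m'")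
          by (intro PA PB P1 m1 Gamma1_mult one_in gA gB)
        ultimately have "P (mat2 (- 1) 0 0 (- 1))"
          using P1 by auto
        moreover have "mat2 (- 1) 0 0 (- 1) \<in> Gamma1 N"
          using less.prems(1) 2 by (auto simp: mat2_Gamma1 g)
        ultimately show ?thesis
          using PB[of "mat2 (- 1) 0 0 (- 1)" "- b"] True 2 by (simp add: g)
      qed
    next
      case False
      obtain j where j: "2 * \<bar>d + c * j\<bar> \<le> \<bar>c\<bar>"
        using centered_remainder[OF False] by blast
      \<comment> \<open>Both moves are undone by moves of the same kind, so \<open>P\<close> can be
        pulled back from a matrix with smaller lower left entry.\<close>
      have step: "P \<gamma>" if "nat \<bar>(\<gamma> ** mat2 1 j 0 1 ** mat2 1 0 (int N * k) 1) $ 2 $ 1\<bar> < n" for j k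
      proof -
        have in_G: "\<gamma> ** mat2 1 j 0 1 ** mat2 1 0 (int N * k) 1 \<in> Gamma1 N"
          by (intro Gamma1_mult gA gB less.prems(1))
        have "P (\<gamma> ** mat2 1 j 0 1 ** mat2 1 0 (int N * k) 1)"
          by (rule less.IH[OF that in_G refl])
        then have "P (\<gamma> ** mat2 1 j 0 1 ** mat2 1 0 (int N * k) 1 ** mat2 1 0 (int N * (- k)) 1 ** mat2 1 (- j) 0 1)"
          by (rule PB[OF Gamma1_mult[OF in_G gA] PA[OF in_G]])
        then show ?thesis by (simp add: g algebra_simps)
      qed
      have n: "nat \<bar>c\<bar> = n" using less.prems(2) by (simp add: g)
      show ?thesis
      proof (cases "d + c * j = 0")
        case True
        then have d: "d = - (c * j)" by simp
        have "c * (- (a * j) - b) = 1" using det by (simp add: d algebra_simps)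
        then have "c dvd 1" by (metis dvd_triv_left)
        then have "int N dvd 1"
          using cong(3) dvd_trans by (auto simp only: cong_0_iff)
        then have "N = 1"
          using assms(1) by auto
        \<comment> \<open>With \<open>j\<close> the lower right entry would become 0 and the second
          division would be void. With \<open>j + 1\<close> the bottom row is \<open>(c, c)\<close>,
          and for N = 1 one further move makes the left entry 0.\<close>
        then have "P \<gamma>"
          using step[of "j + 1" "- 1"] False n by (simp add: g d algebra_simps)
        then show ?thesis .
      next
        case False
        define m where "m = int N * (d + c * j)"
        have "m \<noteq> 0" using False assms(1) by (auto simp: m_def)
        then obtain k where k: "2 * \<bar>c + m * k\<bar> \<le> \<bar>m\<bar>"
          using centered_remainder by blast
        have "\<bar>m\<bar> \<le> 3 * \<bar>d + c * j\<bar>"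
          using assms(1) by (auto simp: m_def abs_mult)
        then have "\<bar>c + m * k\<bar> < \<bar>c\<bar>"
        proof -
          have "x < C" if "M \<le> 3 * D" "2 * D \<le> C" "2 * x \<le> M" "0 < C" for x M D C :: int
            using that by linarith
          then show ?thesis using j k \<open>\<bar>m\<bar> \<le> 3 * \<bar>d + c * j\<bar>\<close> \<open>c \<noteq> 0\<close> by (metis zero_less_abs_iff)
        qed
        moreover have "(\<gamma> ** mat2 1 j 0 1 ** mat2 1 0 (int N * k) 1) $ 2 $ 1 = c + m * k"
          by (simp add: g m_def algebra_simps)
        ultimately show ?thesis
          using step[of j k] n by simp
      qed
    qed
  qed
  then show ?thesis using assms(2) by blast
qed

lemma aut_factor_nonzero:
  assumes "\<gamma> \<in> SL2Z" "Im \<tau> > 0"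
  shows "aut_factor \<gamma> \<tau> \<noteq> 0"
proof
  assume 0: "aut_factor \<gamma> \<tau> = 0"
  obtain a b c d where g: "\<gamma> = mat2 a b c d" by (rule mat2_cases)
  have "of_int c * Im \<tau> = 0" "of_int c * Re \<tau> + of_int d = 0"
    using 0 by (simp_all add: aut_factor_def g complex_eq_iff)
  then have "c = 0" "d = 0" using assms(2) by auto
  then show False using assms(1) by (simp add: g)
qed

lemma moebius_upper_half_plane:
  assumes "\<gamma> \<in> SL2Z" "Im \<tau> > 0"
  shows "Im (moebius \<gamma> \<tau>) > 0"
proof -
  obtain a b c d where g: "\<gamma> = mat2 a b c d" by (rule mat2_cases)
  have det: "real_of_int (a * d - b * c) = 1" using assms(1) by (simp add: g)
  have nz: "of_int c * \<tau> + of_int d \<noteq> 0"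
    using aut_factor_nonzero[OF assms] by (simp add: aut_factor_def g)
  have "Im (moebius \<gamma> \<tau>) = real_of_int (a * d - b * c) * Im \<tau> / (norm (of_int c * \<tau> + of_int d))^2"
    unfolding cmod_power2 by (simp add: moebius_def g Im_divide algebra_simps)
  then show ?thesis
    using nz assms(2) unfolding det by simp
qed

lemma aut_factor_mult:
  assumes "\<gamma>' \<in> SL2Z" "Im \<tau> > 0"
  shows "aut_factor (\<gamma> ** \<gamma>') \<tau> = aut_factor \<gamma> (moebius \<gamma>' \<tau>) * aut_factor \<gamma>' \<tau>"
proof -
  obtain a b c d where g: "\<gamma> = mat2 a b c d" by (rule mat2_cases)
  obtain a' b' c' d' where g': "\<gamma>' = mat2 a' b' c' d'" by (rule mat2_cases)
  have "of_int c' * \<tau> + of_int d' \<noteq> 0"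
    using aut_factor_nonzero[OF assms] by (simp add: aut_factor_def g')
  then show ?thesis
    by (simp add: aut_factor_def moebius_def g g' field_simps)
qed

lemma moebius_mult:
  assumes "\<gamma>' \<in> SL2Z" "Im \<tau> > 0"
  shows "moebius (\<gamma> ** \<gamma>') \<tau> = moebius \<gamma> (moebius \<gamma>' \<tau>)"
proof -
  obtain a b c d where g: "\<gamma> = mat2 a b c d" by (rule mat2_cases)
  obtain a' b' c' d' where g': "\<gamma>' = mat2 a' b' c' d'" by (rule mat2_cases)
  define m n where "m = of_int a' * \<tau> + of_int b'" and "n = of_int c' * \<tau> + of_int d'"
  have n: "n \<noteq> 0"
    using aut_factor_nonzero[OF assms] by (simp add: aut_factor_def g' n_def)
  have "moebius \<gamma> (moebius \<gamma>' \<tau>) = (of_int a * (m / n) + of_int b) / (of_int c * (m / n) + of_int d)"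
    by (simp add: moebius_def g g' m_def n_def)
  also have "\<dots> = ((of_int a * m + of_int b * n) / n) / ((of_int c * m + of_int d * n) / n)"
    using n by (simp add: add_divide_distrib)
  also have "\<dots> = (of_int a * m + of_int b * n) / (of_int c * m + of_int d * n)"
    using n by simp
  also have "\<dots> = moebius (\<gamma> ** \<gamma>') \<tau>"
    by (simp add: moebius_def g g' m_def n_def algebra_simps)
  finally show ?thesis by simp
qed

lemma character_unique:
  assumes "N \<in> {1, 2, 3}" "is_character (Gamma1 N) \<psi>" "is_character (Gamma1 N) \<psi>'"
    and "\<psi> (mat_A N) = \<psi>' (mat_A N)" "\<psi> mat_B = \<psi>' mat_B" "\<gamma> \<in> Gamma1 N"
  shows "\<psi> \<gamma> = \<psi>' \<gamma>"
proof -
  have G: "mat2 1 0 0 1 \<in> Gamma1 N" "mat2 1 1 0 1 \<in> Gamma1 N" "mat2 1 (- 1) 0 1 \<in> Gamma1 N"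
    "mat2 1 0 (- int N) 1 \<in> Gamma1 N" "mat2 1 0 (int N) 1 \<in> Gamma1 N"
    by (simp_all add: mat2_Gamma1 cong_0_iff)
  have one: "\<phi> (mat2 1 0 0 1) = 1" if "is_character (Gamma1 N) \<phi>" for \<phi>
  proof -
    have "\<phi> (mat2 1 0 0 1 ** mat2 1 0 0 1) = \<phi> (mat2 1 0 0 1) * \<phi> (mat2 1 0 0 1)" "\<phi> (mat2 1 0 0 1) \<noteq> 0"
      using that G by (auto simp: is_character_def simp del: mat2_mult)
    then show ?thesis by simp
  qed
  have mult: "\<phi> (\<gamma> ** \<gamma>') = \<phi> \<gamma> * \<phi> \<gamma>'" if "is_character (Gamma1 N) \<phi>" "\<gamma> \<in> Gamma1 N" "\<gamma>' \<in> Gamma1 N" for \<phi> \<gamma> \<gamma>'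
    using that by (auto simp: is_character_def)
  have inv: "\<phi> (mat2 1 (- 1) 0 1) = 1 / \<phi> (mat2 1 1 0 1)" "\<phi> (mat2 1 0 (int N) 1) = 1 / \<phi> (mat2 1 0 (- int N) 1)"
    if "is_character (Gamma1 N) \<phi>" for \<phi>
  proof -
    have nz: "\<phi> (mat2 1 1 0 1) \<noteq> 0" "\<phi> (mat2 1 0 (- int N) 1) \<noteq> 0"
      using that G by (auto simp: is_character_def)
    have "\<phi> (mat2 1 (- 1) 0 1 ** mat2 1 1 0 1) = \<phi> (mat2 1 (- 1) 0 1) * \<phi> (mat2 1 1 0 1)"
      "\<phi> (mat2 1 0 (int N) 1 ** mat2 1 0 (- int N) 1) = \<phi> (mat2 1 0 (int N) 1) * \<phi> (mat2 1 0 (- int N) 1)"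
      by (intro mult that G)+
    then show "\<phi> (mat2 1 (- 1) 0 1) = 1 / \<phi> (mat2 1 1 0 1)" "\<phi> (mat2 1 0 (int N) 1) = 1 / \<phi> (mat2 1 0 (- int N) 1)"
      using one[OF that] nz by (simp_all add: field_simps)
  qed
  note AB = assms(4,5)[unfolded mat_A_mat2 mat_B_mat2]
  have step: "\<psi> (\<gamma> ** g) = \<psi>' (\<gamma> ** g)"
    if "\<gamma> \<in> Gamma1 N" "\<psi> \<gamma> = \<psi>' \<gamma>" "g \<in> Gamma1 N" "\<psi> g = \<psi>' g" for \<gamma> g
    using mult[OF assms(2)] mult[OF assms(3)] that by simp
  show ?thesis
  proof (rule Gamma1_induct[OF assms(1,6), where P = "\<lambda>\<gamma>. \<psi> \<gamma> = \<psi>' \<gamma>"])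
    show "\<psi> (mat2 1 0 0 1) = \<psi>' (mat2 1 0 0 1)"
      using one[OF assms(2)] one[OF assms(3)] by simp
  qed (rule step; use AB inv[OF assms(2)] inv[OF assms(3)] G in simp)+
qed

subsection \<open>The character and the weight one form\<close>

lemma level_cases: "p \<in> {3, 4, 6} \<Longrightarrow> level p \<in> {1, 2, 3}"
  by (auto simp: level_def)

lemma lambda_form_nonzero:
  assumes "Im \<tau> > 0" "level p > 0"
  shows "lambda_form p \<tau> \<noteq> 0"
  using assms by (simp add: lambda_form_def dedekind_eta_nonzero)

lemma lambda_form_plus_1:
  assumes "Im \<tau> > 0" "p \<in> {3, 4, 6}"
  shows "lambda_form p (\<tau> + 1) = exp (pi * \<i> / of_nat (wt p)) * lambda_form p \<tau>"
proof -
  have l: "level p > 0" using assms(2) by (auto simp: level_def)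
  have "lambda_form p (\<tau> + 1) = nome ((1 + of_nat (level p)) / 24) * lambda_form p \<tau>"
    using assms(1) by (simp add: lambda_form_eq l distrib_left add_divide_distrib nome_add)
  also have "nome ((1 + of_nat (level p)) / 24) = exp (pi * \<i> / of_nat (wt p))"
    using assms(2) by (auto simp: nome_def level_def wt_def mult.commute)
  finally show ?thesis .
qed

lemma lambda_form_transform_A:
  assumes "Im \<tau> > 0" "p \<in> {3, 4, 6}"
  shows "lambda_form p (\<tau> / (1 - of_nat (level p) * \<tau>)) =
     exp (pi * \<i> / of_nat (wt p)) * (1 - of_nat (level p) * \<tau>) * lambda_form p \<tau>"
proof -
  define N where "N = level p"
  have N: "N > 0" "(of_nat N :: complex) \<noteq> 0" using assms(2) by (auto simp: level_def N_def)
  have \<tau>: "\<tau> \<noteq> 0" using assms(1) by auto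
  define \<sigma> where "\<sigma> = - 1 / (of_nat N * \<tau>)"
  have \<sigma>: "Im \<sigma> > 0"
    unfolding \<sigma>_def using assms(1) N by (intro Im_minus_inverse_pos) simp
  then have \<sigma>1: "Im (\<sigma> + 1) > 0" by simp
  have "\<tau> / (1 - of_nat N * \<tau>) = - 1 / (of_nat N * (\<sigma> + 1))"
    unfolding \<sigma>_def using N \<tau> by (cases "1 - of_nat N * \<tau> = 0") (auto simp: field_simps)
  then have "lambda_form p (\<tau> / (1 - of_nat N * \<tau>)) =
      - \<i> * of_real (sqrt N) * (\<sigma> + 1) * (exp (pi * \<i> / of_nat (wt p)) *
        (- \<i> * of_real (sqrt N) * \<tau> * lambda_form p \<tau>))"
    using lambda_form_fricke[OF \<sigma>1, of p] lambda_form_plus_1[OF \<sigma> assms(2)] lambda_form_fricke[OF assms(1), of p] N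
    by (simp add: \<sigma>_def N_def)
  also have "\<dots> = - ((of_real (sqrt N))^2 * (\<sigma> + 1) * \<tau>) * (exp (pi * \<i> / of_nat (wt p)) * lambda_form p \<tau>)"
    using power2_i by algebra
  also have "(of_real (sqrt N))^2 = (of_nat N :: complex)"
    by (simp flip: of_real_power)
  also have "- (of_nat N * (\<sigma> + 1) * \<tau>) = 1 - of_nat N * \<tau>"
    unfolding \<sigma>_def using N \<tau> by (simp add: field_simps)
  finally show ?thesis by (simp add: N_def mult_ac)
qed

text \<open>A multiplier for the factors extends to a product, and to inverses, so the generators suffice.\<close>

lemma lambda_form_transform:
  assumes "p \<in> {3, 4, 6}" "\<gamma> \<in> Gamma1 (level p)"
  shows "\<exists>c. c \<noteq> 0 \<and> (\<forall>\<tau>. Im \<tau> > 0 \<longrightarrow> lambda_form p (moebius \<gamma> \<tau>) = c * aut_factor \<gamma> \<tau> * lambda_form p \<tau>)"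
proof -
  define T where "T = (\<lambda>\<gamma> c. c \<noteq> 0 \<and> (\<forall>\<tau>. Im \<tau> > 0 \<longrightarrow> lambda_form p (moebius \<gamma> \<tau>) = c * aut_factor \<gamma> \<tau> * lambda_form p \<tau>))"
  let ?N = "level p"
  let ?e = "exp (pi * \<i> / of_nat (wt p))"
  have mult: "\<exists>c. T (\<gamma> ** g) c" if ex: "\<exists>c. T \<gamma> c" and "T g d" "g \<in> SL2Z" for \<gamma> g d
  proof -
    obtain c where c: "T \<gamma> c" using ex by blast
    have "lambda_form p (moebius (\<gamma> ** g) \<tau>) = (c * d) * aut_factor (\<gamma> ** g) \<tau> * lambda_form p \<tau>" if "Im \<tau> > 0" for \<tau>
      using c \<open>T g d\<close> moebius_upper_half_plane[OF \<open>g \<in> SL2Z\<close> that] that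
      by (simp add: T_def moebius_mult[OF \<open>g \<in> SL2Z\<close> that] aut_factor_mult[OF \<open>g \<in> SL2Z\<close> that])
    then show ?thesis using c \<open>T g d\<close> by (intro exI[of _ "c * d"]) (auto simp: T_def)
  qed
  have inv: "T h (1 / d)" if "T g d" "g \<in> SL2Z" "h \<in> SL2Z" "g ** h = mat2 1 0 0 1" for g h d
    unfolding T_def
  proof (intro conjI allI impI)
    fix \<tau> :: complex assume \<tau>: "Im \<tau> > 0"
    have "moebius g (moebius h \<tau>) = \<tau>" "aut_factor g (moebius h \<tau>) * aut_factor h \<tau> = 1"
      using moebius_mult[OF that(3) \<tau>, of g] aut_factor_mult[OF that(3) \<tau>, of g]
      unfolding that(4) by (simp_all add: moebius_def aut_factor_def)
    moreover have "lambda_form p (moebius g (moebius h \<tau>)) = d * aut_factor g (moebius h \<tau>) * lambda_form p (moebius h \<tau>)"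
      using that(1) moebius_upper_half_plane[OF that(3) \<tau>] by (simp add: T_def)
    ultimately have "lambda_form p \<tau> * aut_factor h \<tau> = d * lambda_form p (moebius h \<tau>)"
      by (simp add: algebra_simps)
    then show "lambda_form p (moebius h \<tau>) = 1 / d * aut_factor h \<tau> * lambda_form p \<tau>"
      using that(1) by (simp add: T_def field_simps)
  qed (use that(1) in \<open>simp add: T_def\<close>)
  have TB: "T (mat2 1 1 0 1) ?e"
    using lambda_form_plus_1[OF _ assms(1)] by (simp add: T_def moebius_def aut_factor_def)
  have TA: "T (mat2 1 0 (- int ?N) 1) ?e"
    using lambda_form_transform_A[OF _ assms(1)] by (simp add: T_def moebius_def aut_factor_def add.commute)
  have TB': "T (mat2 1 (- 1) 0 1) (1 / ?e)" and TA': "T (mat2 1 0 (int ?N) 1) (1 / ?e)"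
    by (rule inv[OF TB] inv[OF TA]; simp)+
  have "\<exists>c. T \<gamma> c"
  proof (rule Gamma1_induct[OF level_cases[OF assms(1)] assms(2), where P = "\<lambda>\<gamma>. \<exists>c. T \<gamma> c"])
    have "T (mat2 1 0 0 1) 1" by (simp add: T_def moebius_def aut_factor_def)
    then show "\<exists>c. T (mat2 1 0 0 1) c" by blast
  qed (rule mult[OF _ TB] mult[OF _ TB'] mult[OF _ TA] mult[OF _ TA']; simp)+
  then show ?thesis by (simp add: T_def)
qed

text \<open>The multiplier of \<open>lambda_form\<close> is the witness for the description of
  \<open>vartheta\<close>. It is a character by the cocycle property of \<open>aut_factor\<close>;
  restriction to the group makes it extensional, so that the description is unique.\<close>

lemma vartheta_properties:
  assumes p: "p \<in> {3, 4, 6}"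
  shows "is_character (Gamma1 (level p)) (vartheta p)"
    and "vartheta p (mat_A (level p)) = exp (pi * \<i> / of_nat (wt p))"
    and "vartheta p mat_B = exp (pi * \<i> / of_nat (wt p))"
    and "\<And>\<gamma> \<tau>. \<gamma> \<in> Gamma1 (level p) \<Longrightarrow> Im \<tau> > 0 \<Longrightarrow>
       lambda_form p (moebius \<gamma> \<tau>) = vartheta p \<gamma> * aut_factor \<gamma> \<tau> * lambda_form p \<tau>"
proof -
  let ?G = "Gamma1 (level p)"
  let ?e = "exp (pi * \<i> / of_nat (wt p))"
  have l: "level p > 0" using p by (auto simp: level_def)
  obtain c where c: "\<And>\<gamma>. \<gamma> \<in> ?G \<Longrightarrow> c \<gamma> \<noteq> 0"
    "\<And>\<gamma> \<tau>. \<gamma> \<in> ?G \<Longrightarrow> Im \<tau> > 0 \<Longrightarrow> lambda_form p (moebius \<gamma> \<tau>) = c \<gamma> * aut_factor \<gamma> \<tau> * lambda_form p \<tau>"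
    using lambda_form_transform[OF p] by metis
  \<comment> \<open>Neither \<open>lambda_form\<close> nor \<open>aut_factor\<close> vanishes at
    \<open>\<i>\<close>, so this one point determines the multiplier.\<close>
  have c_eq: "c \<gamma> = d" if "\<gamma> \<in> ?G" "lambda_form p (moebius \<gamma> \<i>) = d * aut_factor \<gamma> \<i> * lambda_form p \<i>" for \<gamma> d
    using c(2)[OF that(1), of \<i>] that lambda_form_nonzero[OF _ l, of \<i>] aut_factor_nonzero[OF Gamma1_SL2Z[OF that(1)], of \<i>]
    by simp
  define \<psi> where "\<psi> = restrict c ?G"
  have AB: "mat_A (level p) \<in> ?G" "mat_B \<in> ?G"
    by (simp_all add: mat_A_mat2 mat_B_mat2 mat2_Gamma1 cong_0_iff)
  have char: "is_character ?G \<psi>"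
    unfolding is_character_def
  proof (intro conjI ballI)
    fix \<gamma> \<gamma>' assume g: "\<gamma> \<in> ?G" "\<gamma>' \<in> ?G"
    note S = Gamma1_SL2Z[OF g(2)]
    have i: "Im \<i> > 0" by simp
    have "c (\<gamma> ** \<gamma>') = c \<gamma> * c \<gamma>'"
      by (rule c_eq[OF Gamma1_mult[OF g]])
         (simp add: moebius_mult[OF S i] aut_factor_mult[OF S i] c(2) g moebius_upper_half_plane[OF S i])
    then show "\<psi> (\<gamma> ** \<gamma>') = \<psi> \<gamma> * \<psi> \<gamma>'"
      using g Gamma1_mult[OF g] by (simp add: \<psi>_def)
  qed (simp add: \<psi>_def c(1))
  have "c (mat_A (level p)) = ?e"
    by (rule c_eq[OF AB(1)])
       (use lambda_form_transform_A[OF _ p, of \<i>] in \<open>simp add: mat_A_mat2 moebius_def aut_factor_def add.commute\<close>)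
  moreover have "c mat_B = ?e"
    by (rule c_eq[OF AB(2)])
       (use lambda_form_plus_1[OF _ p, of \<i>] in \<open>simp add: mat_B_mat2 moebius_def aut_factor_def\<close>)
  ultimately have \<psi>AB: "\<psi> (mat_A (level p)) = ?e" "\<psi> mat_B = ?e"
    using AB by (simp_all add: \<psi>_def)
  have "vartheta p = \<psi>"
    unfolding vartheta_def
  proof (rule the_equality)
    show "\<psi> \<in> extensional ?G \<and> is_character ?G \<psi> \<and> \<psi> (mat_A (level p)) = ?e \<and> \<psi> mat_B = ?e"
      using char \<psi>AB by (simp add: \<psi>_def)
    fix \<phi> assume \<phi>: "\<phi> \<in> extensional ?G \<and> is_character ?G \<phi> \<and> \<phi> (mat_A (level p)) = ?e \<and> \<phi> mat_B = ?e"
    show "\<phi> = \<psi>"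
    proof (rule extensionalityI)
      show "\<phi> \<gamma> = \<psi> \<gamma>" if "\<gamma> \<in> ?G" for \<gamma>
        by (rule character_unique[OF level_cases[OF p] _ char _ _ that]) (use \<phi> \<psi>AB in auto)
    qed (use \<phi> in \<open>auto simp: \<psi>_def\<close>)
  qed
  then show "is_character ?G (vartheta p)" "vartheta p (mat_A (level p)) = ?e" "vartheta p mat_B = ?e"
    "\<And>\<gamma> \<tau>. \<gamma> \<in> ?G \<Longrightarrow> Im \<tau> > 0 \<Longrightarrow>
       lambda_form p (moebius \<gamma> \<tau>) = vartheta p \<gamma> * aut_factor \<gamma> \<tau> * lambda_form p \<tau>"
    using char \<psi>AB c(2) by (simp_all add: \<psi>_def)
qed

lemma theta_char_properties:
  assumes p: "p \<in> {3, 4, 6}"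
  shows "is_character (Gamma1 (level p)) (theta_char p)"
    and "theta_char p (mat_A (level p)) = - 1" "theta_char p mat_B = - 1"
proof -
  show "is_character (Gamma1 (level p)) (theta_char p)"
    using vartheta_properties(1)[OF p] by (simp add: is_character_def theta_char_def power_mult_distrib)
  have w: "wt p > 0" by (simp add: wt_def)
  have "exp (pi * \<i> / of_nat (wt p)) ^ wt p = exp (of_nat (wt p) * (pi * \<i> / of_nat (wt p)))"
    by (rule exp_of_nat_mult[symmetric])
  also have "\<dots> = - 1"
    using w by (simp add: exp_pi_i)
  finally show "theta_char p (mat_A (level p)) = - 1" "theta_char p mat_B = - 1"
    by (simp_all add: theta_char_def vartheta_properties[OF p])
qed

subsection \<open>Expansions at the cusps\<close>

text \<open>The weight k slash operator; holomorphy at the cusps is a condition on all its values on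
  \<open>SL2Z\<close>.\<close>

definition slash :: "int \<Rightarrow> (complex \<Rightarrow> complex) \<Rightarrow> int^2^2 \<Rightarrow> complex \<Rightarrow> complex" where
  "slash k f \<gamma> \<tau> = aut_factor \<gamma> \<tau> powi (- k) * f (moebius \<gamma> \<tau>)"

text \<open>The number \<open>h\<close> need not be the width of the cusp: a multiple of it works as
  well, after substituting a power of the parameter into \<open>g\<close>. This lets two series
  share a parameter.\<close>

definition cusp_series :: "(complex \<Rightarrow> complex) \<Rightarrow> bool" where
  "cusp_series f \<longleftrightarrow> (\<exists>h::nat. h > 0 \<and> (\<exists>g. g holomorphic_on ball 0 1 \<and>
     (\<forall>\<tau>. Im \<tau> > 0 \<longrightarrow> f \<tau> = g (nome (\<tau> / of_nat h)))))"

lemma holomorphic_at_cusps_iff: "holomorphic_at_cusps k f \<longleftrightarrow> (\<forall>\<gamma>\<in>SL2Z. cusp_series (slash k f \<gamma>))"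
  by (simp add: holomorphic_at_cusps_def cusp_series_def slash_def upper_half_plane_def nome_def)

lemma cusp_seriesI:
  assumes "h > 0" "g holomorphic_on ball 0 1" "\<And>\<tau>. Im \<tau> > 0 \<Longrightarrow> f \<tau> = g (nome (\<tau> / of_nat h))"
  shows "cusp_series f"
  using assms unfolding cusp_series_def by blast

lemma cusp_series_cong:
  assumes "cusp_series f" "\<And>\<tau>. Im \<tau> > 0 \<Longrightarrow> f \<tau> = f' \<tau>"
  shows "cusp_series f'"
  using assms unfolding cusp_series_def by metis

lemma cusp_series_const: "cusp_series (\<lambda>_. c)"
  by (rule cusp_seriesI[of 1 "\<lambda>_. c"]) auto

lemma nome_in_ball: "Im \<tau> > 0 \<Longrightarrow> h > 0 \<Longrightarrow> nome (\<tau> / of_nat h) \<in> ball 0 1"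
  using norm_nome_less_1[of "\<tau> / of_nat h"] by (simp add: Im_divide_of_nat)

lemma holomorphic_on_ball_power:
  fixes g :: "complex \<Rightarrow> complex"
  assumes "g holomorphic_on ball 0 1" "n > 0"
  shows "(\<lambda>t. g (t ^ n)) holomorphic_on ball 0 1"
proof (rule holomorphic_on_compose_gen[where f = "\<lambda>t. t ^ n" and g = g and t = "ball 0 1", unfolded o_def])
  show "(\<lambda>t. t ^ n) ` ball 0 1 \<subseteq> ball (0 :: complex) 1"
    using assms(2) by (auto simp: norm_power power_less_one_iff)
qed (use assms(1) in \<open>auto intro!: holomorphic_intros\<close>)

lemma nome_divide_power:
  assumes "n > 0"
  shows "nome (\<tau> / of_nat (m * n)) ^ n = nome (\<tau> / of_nat m)"
  using assms by (simp flip: nome_of_nat_mult)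

lemma cusp_series_mult:
  assumes "cusp_series f" "cusp_series f'"
  shows "cusp_series (\<lambda>\<tau>. f \<tau> * f' \<tau>)"
proof -
  obtain h g where h: "h > 0" "g holomorphic_on ball 0 1" "\<And>\<tau>. Im \<tau> > 0 \<Longrightarrow> f \<tau> = g (nome (\<tau> / of_nat h))"
    using assms(1) unfolding cusp_series_def by blast
  obtain h' g' where h': "h' > 0" "g' holomorphic_on ball 0 1" "\<And>\<tau>. Im \<tau> > 0 \<Longrightarrow> f' \<tau> = g' (nome (\<tau> / of_nat h'))"
    using assms(2) unfolding cusp_series_def by blast
  show ?thesis
  proof (rule cusp_seriesI[of "h * h'" "\<lambda>t. g (t ^ h') * g' (t ^ h)"])
    show "(\<lambda>t. g (t ^ h') * g' (t ^ h)) holomorphic_on ball 0 1"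
      using h h' by (intro holomorphic_on_mult holomorphic_on_ball_power)
    show "f \<tau> * f' \<tau> = g (nome (\<tau> / of_nat (h * h')) ^ h') * g' (nome (\<tau> / of_nat (h * h')) ^ h)" if "Im \<tau> > 0" for \<tau>
      using h h' that nome_divide_power[of h' \<tau> h] nome_divide_power[of h \<tau> h'] by (simp add: mult.commute)
  qed (use h h' in simp)
qed

lemma cusp_series_cmult: "cusp_series f \<Longrightarrow> cusp_series (\<lambda>\<tau>. c * f \<tau>)"
  by (rule cusp_series_mult[OF cusp_series_const])

lemma cusp_series_power: "cusp_series f \<Longrightarrow> cusp_series (\<lambda>\<tau>. f \<tau> ^ n)"
  by (induction n) (auto intro: cusp_series_const cusp_series_mult)

text \<open>Dividing by \<open>N\<close> multiplies \<open>h\<close> by \<open>N\<close>, and the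
  shift by \<open>j\<close> rotates the parameter by a root of unity, which preserves the unit
  disc.\<close>

lemma cusp_series_affine:
  assumes "cusp_series f" "N > 0"
  shows "cusp_series (\<lambda>\<tau>. f ((\<tau> + of_int j) / of_nat N))"
proof -
  obtain h g where h: "h > 0" "g holomorphic_on ball 0 1" "\<And>\<tau>. Im \<tau> > 0 \<Longrightarrow> f \<tau> = g (nome (\<tau> / of_nat h))"
    using assms(1) unfolding cusp_series_def by blast
  define \<zeta> where "\<zeta> = nome (of_int j / of_nat (N * h))"
  have \<zeta>: "norm \<zeta> = 1" by (simp add: \<zeta>_def nome_def Im_divide_of_nat)
  show ?thesis
  proof (rule cusp_seriesI[of "N * h" "\<lambda>t. g (\<zeta> * t)"])
    show "(\<lambda>t. g (\<zeta> * t)) holomorphic_on ball 0 1"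
      by (rule holomorphic_on_compose_gen[where f = "\<lambda>t. \<zeta> * t" and g = g and t = "ball 0 1", unfolded o_def])
         (use h(2) \<zeta> in \<open>auto intro!: holomorphic_intros simp: norm_mult\<close>)
    show "f ((\<tau> + of_int j) / of_nat N) = g (\<zeta> * nome (\<tau> / of_nat (N * h)))" if "Im \<tau> > 0" for \<tau>
    proof -
      have "nome ((\<tau> + of_int j) / of_nat N / of_nat h) = \<zeta> * nome (\<tau> / of_nat (N * h))"
        by (simp add: \<zeta>_def add_divide_distrib mult.commute flip: nome_add)
      then show ?thesis
        using h(3)[of "(\<tau> + of_int j) / of_nat N"] that assms(2) by (simp add: Im_divide_of_nat)
    qed
  qed (use h(1) assms(2) in simp)
qed

text \<open>Antiperiodicity kills the Taylor coefficients of low order in the local parameter.\<close>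

lemma cusp_series_antiperiodic:
  assumes "cusp_series f" "M > 0" and anti: "\<And>\<tau>. Im \<tau> > 0 \<Longrightarrow> f (\<tau> + of_nat M) = - f \<tau>"
  shows "cusp_series (\<lambda>\<tau>. f \<tau> * nome (- \<tau> / (2 * of_nat M)))"
proof -
  obtain h g where h: "h > 0" "g holomorphic_on ball 0 1" "\<And>\<tau>. Im \<tau> > 0 \<Longrightarrow> f \<tau> = g (nome (\<tau> / of_nat h))"
    using assms(1) unfolding cusp_series_def by blast
  \<comment> \<open>With this \<open>H\<close> the old parameter is the power \<open>2 * M\<close>
    of the new one, and the factor to be divided out is its power \<open>h\<close>.\<close>
  define H where "H = h * (2 * M)"
  have H: "H > 0" using h(1) assms(2) by (simp add: H_def)
  define g2 where "g2 = (\<lambda>t. g (t ^ (2 * M)))"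
  have g2: "g2 holomorphic_on ball 0 1"
    unfolding g2_def using h(2) assms(2) by (intro holomorphic_on_ball_power) auto
  have fg2: "f \<tau> = g2 (nome (\<tau> / of_nat H))" if "Im \<tau> > 0" for \<tau>
    using h(3)[OF that] nome_divide_power[of "2 * M" \<tau> h] assms(2) by (simp add: g2_def H_def)
  define \<zeta> where "\<zeta> = nome (of_nat M / of_nat H)"
  have \<zeta>: "norm \<zeta> = 1" by (simp add: \<zeta>_def nome_def Im_divide_of_nat)
  \<comment> \<open>Every non-zero point of the disc is a value of the parameter, by the logarithm;
    the centre is the cusp itself and is reached by continuity.\<close>
  have g2_anti_nz: "g2 (\<zeta> * t) = - g2 t" if t: "t \<in> ball 0 1" "t \<noteq> 0" for t
  proof -
    define \<tau> where "\<tau> = of_nat H * (Ln t / (2 * pi * \<i>))"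
    have "nome (\<tau> / of_nat H) = t"
      using H t(2) by (simp add: nome_def \<tau>_def)
    moreover have "Im \<tau> > 0"
    proof -
      have "Im \<tau> = - (of_nat H * ln (norm t) / (2 * pi))"
        using t(2) by (simp add: \<tau>_def Im_divide power2_eq_square)
      moreover have "ln (norm t) < 0" using t by simp
      ultimately show ?thesis using H by (simp add: mult_less_0_iff divide_less_0_iff)
    qed
    moreover have "nome ((\<tau> + of_nat M) / of_nat H) = \<zeta> * nome (\<tau> / of_nat H)"
      by (simp add: \<zeta>_def add_divide_distrib nome_add)
    ultimately show ?thesis
      using anti[of \<tau>] fg2[of \<tau>] fg2[of "\<tau> + of_nat M"] by simp
  qed
  have hol\<zeta>: "(\<lambda>t. g2 (\<zeta> * t)) holomorphic_on ball 0 1"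
    by (rule holomorphic_on_compose_gen[where f = "\<lambda>t. \<zeta> * t" and g = g2 and t = "ball 0 1", unfolded o_def])
       (use g2 \<zeta> in \<open>auto intro!: holomorphic_intros simp: norm_mult\<close>)
  have "g2 0 = - g2 0"
  proof -
    have "isCont (\<lambda>t. g2 (\<zeta> * t) + g2 t) 0"
      using hol\<zeta> g2 by (intro continuous_intros)
        (auto intro: holomorphic_on_imp_continuous_on continuous_on_interior)
    then have "((\<lambda>t. g2 (\<zeta> * t) + g2 t) \<longlongrightarrow> g2 (\<zeta> * 0) + g2 0) (at 0)"
      by (simp add: isCont_def)
    moreover have "\<forall>\<^sub>F t in at 0. g2 (\<zeta> * t) + g2 t = 0"
      using eventually_at_in_open[of "ball 0 1" "0::complex"] by (auto elim!: eventually_mono simp: g2_anti_nz)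
    then have "((\<lambda>t. g2 (\<zeta> * t) + g2 t) \<longlongrightarrow> 0) (at 0)"
      by (rule tendsto_eventually)
    ultimately have "g2 (\<zeta> * 0) + g2 0 = 0"
      by (rule tendsto_unique[OF trivial_limit_at])
    then show ?thesis by (simp add: add_eq_0_iff)
  qed
  then have g2_anti: "g2 (\<zeta> * t) = (- 1) * g2 t" if "t \<in> ball 0 1" for t
    using g2_anti_nz[OF that] by (cases "t = 0") auto
  have zero: "(deriv ^^ n) g2 0 = 0" if "n < h" for n
  proof -
    have "\<zeta> ^ n * (deriv ^^ n) g2 (\<zeta> * 0) = (deriv ^^ n) (\<lambda>t. g2 (\<zeta> * t)) 0"
      by (rule higher_deriv_compose_linear[OF g2, symmetric, of "ball 0 1"]) (use \<zeta> in \<open>auto simp: norm_mult\<close>)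
    also have "\<dots> = (deriv ^^ n) (\<lambda>t. (- 1) * g2 t) 0"
      by (rule higher_deriv_transform_within_open[OF hol\<zeta> _ open_ball])
         (use g2 g2_anti in \<open>auto intro!: holomorphic_intros\<close>)
    also have "\<dots> = (- 1) * (deriv ^^ n) g2 0"
      by (rule higher_deriv_cmult[OF g2]) auto
    finally have "(\<zeta> ^ n + 1) * (deriv ^^ n) g2 0 = 0"
      by (simp add: algebra_simps)
    \<comment> \<open>\<open>\<zeta> ^ n\<close> is the exponential of \<open>n / (2 * h)\<close>
      full turns. As \<open>n < h\<close>, this is less than half a turn and misses -1.\<close>
    moreover have "\<zeta> ^ n \<noteq> - 1"
    proof
      assume "\<zeta> ^ n = - 1"
      have eq: "\<zeta> ^ n = nome (of_real (real n / real (2 * h)))"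
        using assms(2) by (simp add: \<zeta>_def H_def mult.commute flip: nome_of_nat_mult)
      have "nome (of_real (real n / real (2 * h)) + 1/2) = 1"
        unfolding nome_add nome_half eq[symmetric] \<open>\<zeta> ^ n = - 1\<close> by simp
      then obtain k :: int where "of_real (real n / real (2 * h)) + 1/2 = (of_int k :: complex)"
        by (auto simp: nome_eq_1_iff elim: Ints_cases)
      from arg_cong[OF this, of Re] have "real n / real (2 * h) + 1/2 = of_int k" by simp
      moreover have "0 \<le> real n / real (2 * h)" "real n / real (2 * h) < 1/2"
        using that by (auto simp: field_simps)
      ultimately have "0 < real_of_int k" "real_of_int k < 1" by linarith+
      then have "0 < k" "k < 1" by simp_all
      then show False by simp
    qed
    ultimately show ?thesis by (auto simp: add_eq_0_iff2)
  qed
  obtain g3 where g3: "g3 holomorphic_on ball 0 1"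
    "\<And>t. t \<in> ball 0 1 \<Longrightarrow> g2 t = (\<Sum>i<h. (deriv ^^ i) g2 0 / fact i * t ^ i) + t ^ h * g3 t"
    by (rule holomorphic_taylor_remainder[OF g2, of h]) (rule that; assumption)
  show ?thesis
  proof (rule cusp_seriesI[OF H g3(1)])
    fix \<tau> :: complex assume \<tau>: "Im \<tau> > 0"
    have "f \<tau> = nome (\<tau> / of_nat H) ^ h * g3 (nome (\<tau> / of_nat H))"
      using fg2[OF \<tau>] g3(2)[OF nome_in_ball[OF \<tau> H]] zero by simp
    also have "nome (\<tau> / of_nat H) ^ h = nome (\<tau> / (2 * of_nat M))"
      using h(1) by (simp add: H_def flip: nome_of_nat_mult)
    finally show "f \<tau> * nome (- \<tau> / (2 * of_nat M)) = g3 (nome (\<tau> / of_nat H))"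
      by (simp add: nome_minus)
  qed
qed

lemma cusp_series_euler_phi_inverse:
  assumes "N > 0"
  shows "cusp_series (\<lambda>\<tau>. 1 / (euler_phi (nome \<tau>) * euler_phi (nome \<tau> ^ N)))"
proof (rule cusp_seriesI[of 1 "\<lambda>t. 1 / (euler_phi t * euler_phi (t ^ N))"])
  have "(\<lambda>t. euler_phi (t ^ N)) holomorphic_on ball 0 1"
    by (rule holomorphic_on_ball_power[OF holomorphic_euler_phi assms])
  moreover have "euler_phi t * euler_phi (t ^ N) \<noteq> 0" if "t \<in> ball 0 1" for t
    using that assms euler_phi_nonzero[of t] euler_phi_nonzero[of "t ^ N"]
    by (simp add: norm_power power_less_one_iff)
  ultimately show "(\<lambda>t. 1 / (euler_phi t * euler_phi (t ^ N))) holomorphic_on ball 0 1"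
    using holomorphic_euler_phi by (intro holomorphic_intros) auto
qed auto

text \<open>The exponent \<open>(1 + N) / 24\<close> of q explains the choice \<open>h = 24\<close>;
  the numerator becomes the order of vanishing in the parameter.\<close>

lemma cusp_series_lambda_form:
  assumes "level p > 0"
  shows "cusp_series (lambda_form p)"
proof (rule cusp_seriesI[of 24 "\<lambda>t. t ^ (1 + level p) * euler_phi (t ^ 24) * euler_phi (t ^ (24 * level p))"])
  show "(\<lambda>t. t ^ (1 + level p) * euler_phi (t ^ 24) * euler_phi (t ^ (24 * level p))) holomorphic_on ball 0 1"
    using assms by (intro holomorphic_intros holomorphic_on_ball_power holomorphic_euler_phi) auto
  show "lambda_form p \<tau> = nome (\<tau> / of_nat 24) ^ (1 + level p) * euler_phi (nome (\<tau> / of_nat 24) ^ 24) *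
      euler_phi (nome (\<tau> / of_nat 24) ^ (24 * level p))" if "Im \<tau> > 0" for \<tau>
  proof -
    have "nome (\<tau> / of_nat 24) ^ 24 = nome \<tau>"
      using nome_of_nat_mult[of 24 "\<tau> / 24"] by simp
    moreover have "nome (\<tau> / of_nat 24) ^ (1 + level p) = nome ((1 + of_nat (level p)) * \<tau> / 24)"
      using nome_of_nat_mult[of "1 + level p" "\<tau> / 24"] by (simp del: power_Suc)
    ultimately show ?thesis
      by (simp add: lambda_form_eq[OF that assms] power_mult del: power_Suc)
  qed
qed simp

section \<open>Reduction to the cusps infinity and 0\<close>

lemma slash_mult:
  assumes "\<gamma>' \<in> SL2Z" "Im \<tau> > 0"
  shows "slash k f (\<gamma> ** \<gamma>') \<tau> = slash k f \<gamma> (moebius \<gamma>' \<tau>) * aut_factor \<gamma>' \<tau> powi (- k)"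
  by (simp add: slash_def moebius_mult[OF assms] aut_factor_mult[OF assms] power_int_mult_distrib)

lemma slash_uminus: "slash k f (- \<gamma>) \<tau> = (- 1) powi (- k) * slash k f \<gamma> \<tau>"
proof -
  have "aut_factor (- \<gamma>) \<tau> = - 1 * aut_factor \<gamma> \<tau>"
    by (simp add: aut_factor_def)
  moreover have "moebius (- \<gamma>) \<tau> = moebius \<gamma> \<tau>"
  proof -
    have "moebius (- \<gamma>) \<tau> = (- (of_int (\<gamma>$1$1) * \<tau> + of_int (\<gamma>$1$2))) / (- (of_int (\<gamma>$2$1) * \<tau> + of_int (\<gamma>$2$2)))"
      by (simp add: moebius_def)
    then show ?thesis
      unfolding minus_divide_divide by (simp add: moebius_def)
  qed
  ultimately show ?thesis
    by (simp only: slash_def power_int_mult_distrib mult.assoc)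
qed

text \<open>Modulo 1, 2 or 3 the only units are 1 and -1, so up to sign only the divisibility of the
  lower left entry by N matters. The matrices \<open>mat2 0 (- 1) 1 j\<close> carry infinity to the
  cusp 0.\<close>

lemma cusp_representatives:
  assumes N: "N \<in> {1, 2, 3}" and "\<gamma> \<in> SL2Z"
  obtains (infinity) \<gamma>' where "\<gamma>' \<in> Gamma1 N" "\<gamma> = \<gamma>' \<or> \<gamma> = - \<gamma>'"
    | (zero) \<gamma>' j where "\<gamma>' \<in> Gamma1 N"
        "\<gamma> = \<gamma>' ** mat2 0 (- 1) 1 j \<or> \<gamma> = - (\<gamma>' ** mat2 0 (- 1) 1 j)"
proof -
  obtain a b c d where g: "\<gamma> = mat2 a b c d" by (rule mat2_cases)
  have det: "a * d - b * c = 1" using assms(2) by (simp add: g)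
  have pm: "[x = 1] (mod int N) \<or> [x = - 1] (mod int N)" if "\<not> int N dvd x \<or> N = 1" for x
    using N that by (auto simp: cong_def) presburger+
  \<comment> \<open>The determinant gives \<open>x * w = 1\<close> modulo N, so the sign that makes
    \<open>w\<close> congruent to 1 does the same for \<open>x\<close>.\<close>
  have both: "mat2 x y z w \<in> Gamma1 N \<or> - mat2 x y z w \<in> Gamma1 N"
    if "x * w - y * z = 1" "int N dvd z" for x y z w
  proof -
    have "\<not> int N dvd w \<or> N = 1"
    proof (rule ccontr)
      assume "\<not> ?thesis"
      then have "int N dvd x * w - y * z" "N \<noteq> 1" using that(2) by auto
      then show False using that(1) N by auto
    qed
    have xw: "[x * w = 1] (mod int N)"
      using that by (simp add: cong_iff_dvd_diff) (metis add.commute diff_add_cancel diff_diff_eq2 dvd_triv_right dvd_trans dvd_mult)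
    from pm[OF \<open>\<not> int N dvd w \<or> N = 1\<close>] show ?thesis
    proof
      assume w: "[w = 1] (mod int N)"
      have "[x = x * w] (mod int N)"
        using cong_mult[OF cong_refl[of x] w] by (simp add: cong_sym_eq)
      then have "[x = 1] (mod int N)" using xw by (rule cong_trans)
      then show ?thesis using that w by (simp add: mat2_Gamma1 cong_0_iff)
    next
      assume w: "[w = - 1] (mod int N)"
      have "[x * w = - x] (mod int N)"
        using cong_mult[OF cong_refl[of x] w] by simp
      then have "[- x = 1] (mod int N)"
        using xw cong_sym cong_trans by blast
      moreover have "[- w = 1] (mod int N)"
        using w cong_minus_minus_iff[of "- w" 1 "int N"] by simp
      ultimately have "[- x = 1] (mod int N)" "[- w = 1] (mod int N)" .
      then show ?thesis using that by (simp add: mat2_Gamma1 cong_0_iff)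
    qed
  qed
  show ?thesis
  proof (cases "int N dvd c")
    case True
    from both[OF det True] show ?thesis
      using infinity[of \<gamma>] infinity[of "- \<gamma>"] by (auto simp: g)
  next
    case False
    then obtain e where e: "e = 1 \<or> e = - 1" "[c = e] (mod int N)"
      using pm[of c] by auto
    \<comment> \<open>As \<open>c\<close> is congruent to \<open>e\<close> and
      \<open>e * e = 1\<close>, this \<open>j\<close> makes \<open>d - j * c\<close> divisible by N,
      which is up to sign the lower left entry of the left factor.\<close>
    define j where "j = d * e"
    have "[d - j * c = d - (d * e) * e] (mod int N)"
      unfolding j_def using e(2) by (intro cong_diff cong_mult cong_refl)
    then have "int N dvd d - j * c"
      using e(1) by (auto simp: cong_0_iff)
    then have "mat2 (a * j - b) a (c * j - d) c \<in> Gamma1 N \<or> - mat2 (a * j - b) a (c * j - d) c \<in> Gamma1 N"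
      using det by (intro both) (auto simp: algebra_simps dvd_diff_commute)
    moreover have "\<gamma> = mat2 (a * j - b) a (c * j - d) c ** mat2 0 (- 1) 1 j"
      by (simp add: g algebra_simps)
    ultimately show ?thesis
      using zero[of "mat2 (a * j - b) a (c * j - d) c" j] zero[of "- mat2 (a * j - b) a (c * j - d) c" j] by auto
  qed
qed

text \<open>The case and the shift \<open>j\<close> depend on \<open>\<gamma>\<close> alone and come
  before the quantifiers over \<open>k\<close>, \<open>f\<close> and \<open>\<psi>\<close>. Hence a
  form and \<open>delta_form\<close> can be expanded at the same cusp with the same \<open>j\<close>
  and divided.\<close>

lemma slash_cases:
  assumes N: "N \<in> {1, 2, 3}" and \<gamma>: "\<gamma> \<in> SL2Z"
  obtains
    (infinity) "\<And>k f \<psi>. is_character (Gamma1 N) \<psi> \<Longrightarrow>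
        (\<And>\<gamma> \<tau>. \<gamma> \<in> Gamma1 N \<Longrightarrow> Im \<tau> > 0 \<Longrightarrow> f (moebius \<gamma> \<tau>) = \<psi> \<gamma> * aut_factor \<gamma> \<tau> powi k * f \<tau>) \<Longrightarrow>
        \<exists>c. c \<noteq> 0 \<and> (\<forall>\<tau>. Im \<tau> > 0 \<longrightarrow> slash k f \<gamma> \<tau> = c * f \<tau>)"
  | (zero) j where "\<And>k f \<psi>. is_character (Gamma1 N) \<psi> \<Longrightarrow>
        (\<And>\<gamma> \<tau>. \<gamma> \<in> Gamma1 N \<Longrightarrow> Im \<tau> > 0 \<Longrightarrow> f (moebius \<gamma> \<tau>) = \<psi> \<gamma> * aut_factor \<gamma> \<tau> powi k * f \<tau>) \<Longrightarrow>
        \<exists>c. c \<noteq> 0 \<and> (\<forall>\<tau>. Im \<tau> > 0 \<longrightarrow> slash k f \<gamma> \<tau> = c * ((\<tau> + of_int j) powi (- k) * f (- 1 / (\<tau> + of_int j))))"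
proof -
  have slash_in: "slash k f \<gamma>' \<tau> = \<psi> \<gamma>' * f \<tau>"
    if "\<gamma>' \<in> Gamma1 N" "Im \<tau> > 0"
      "\<And>\<gamma> \<tau>. \<gamma> \<in> Gamma1 N \<Longrightarrow> Im \<tau> > 0 \<Longrightarrow> f (moebius \<gamma> \<tau>) = \<psi> \<gamma> * aut_factor \<gamma> \<tau> powi k * f \<tau>"
    for k f \<psi> \<gamma>' \<tau>
    using aut_factor_nonzero[OF Gamma1_SL2Z[OF that(1)] that(2)] that
    by (simp add: slash_def power_int_minus field_simps)
  from N \<gamma> show ?thesis
  proof (cases rule: cusp_representatives)
    case (infinity \<gamma>')
    show ?thesis
    proof (rule that(1))
      fix k f and \<psi> :: "int^2^2 \<Rightarrow> complex"
      assume \<psi>: "is_character (Gamma1 N) \<psi>"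
        and f: "\<And>\<gamma> \<tau>. \<gamma> \<in> Gamma1 N \<Longrightarrow> Im \<tau> > 0 \<Longrightarrow> f (moebius \<gamma> \<tau>) = \<psi> \<gamma> * aut_factor \<gamma> \<tau> powi k * f \<tau>"
      have "\<psi> \<gamma>' \<noteq> 0" using \<psi> infinity(1) by (auto simp: is_character_def)
      then show "\<exists>c. c \<noteq> 0 \<and> (\<forall>\<tau>. Im \<tau> > 0 \<longrightarrow> slash k f \<gamma> \<tau> = c * f \<tau>)"
        using infinity(2) slash_in[OF infinity(1) _ f] slash_uminus
        by (intro exI[of _ "(if \<gamma> = \<gamma>' then 1 else (- 1) powi (- k)) * \<psi> \<gamma>'"]) auto
    qed
  next
    case (zero \<gamma>' j)
    show ?thesis
    proof (rule that(2))
      fix k f and \<psi> :: "int^2^2 \<Rightarrow> complex"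
      assume \<psi>: "is_character (Gamma1 N) \<psi>"
        and f: "\<And>\<gamma> \<tau>. \<gamma> \<in> Gamma1 N \<Longrightarrow> Im \<tau> > 0 \<Longrightarrow> f (moebius \<gamma> \<tau>) = \<psi> \<gamma> * aut_factor \<gamma> \<tau> powi k * f \<tau>"
      define \<delta> where "\<delta> = mat2 0 (- 1) 1 j"
      have \<delta>: "\<delta> \<in> SL2Z" by (simp add: \<delta>_def)
      have "\<psi> \<gamma>' \<noteq> 0" using \<psi> zero(1) by (auto simp: is_character_def)
      moreover have "slash k f (\<gamma>' ** \<delta>) \<tau> = \<psi> \<gamma>' * ((\<tau> + of_int j) powi (- k) * f (- 1 / (\<tau> + of_int j)))" if "Im \<tau> > 0" for \<tau>
      proof -
        have "slash k f \<gamma>' (moebius \<delta> \<tau>) = \<psi> \<gamma>' * f (moebius \<delta> \<tau>)"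
          by (rule slash_in[OF zero(1) moebius_upper_half_plane[OF \<delta> that]]) (rule f)
        then show ?thesis
          unfolding slash_mult[OF \<delta> that] by (simp add: \<delta>_def moebius_def aut_factor_def mult_ac)
      qed
      ultimately show "\<exists>c. c \<noteq> 0 \<and> (\<forall>\<tau>. Im \<tau> > 0 \<longrightarrow> slash k f \<gamma> \<tau> = c * ((\<tau> + of_int j) powi (- k) * f (- 1 / (\<tau> + of_int j))))"
        using zero(2) slash_uminus unfolding \<delta>_def[symmetric]
        by (intro exI[of _ "(if \<gamma> = \<gamma>' ** \<delta> then 1 else (- 1) powi (- k)) * \<psi> \<gamma>'"]) auto
    qed
  qed
qed

lemma Im_plus_int: "Im \<tau> > 0 \<Longrightarrow> Im (\<tau> + of_int j) > 0"
  by simp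

lemma modular_form_iff:
  "modular_form k \<Gamma> \<psi> f \<longleftrightarrow> is_character \<Gamma> \<psi> \<and> (\<forall>\<tau>. Im \<tau> \<le> 0 \<longrightarrow> f \<tau> = 0) \<and> f holomorphic_on upper_half_plane \<and>
     (\<forall>\<gamma>\<in>\<Gamma>. \<forall>\<tau>. Im \<tau> > 0 \<longrightarrow> f (moebius \<gamma> \<tau>) = \<psi> \<gamma> * aut_factor \<gamma> \<tau> powi k * f \<tau>) \<and>
     (\<forall>\<gamma>\<in>SL2Z. cusp_series (slash k f \<gamma>))"
  by (auto simp: modular_form_def holomorphic_at_cusps_iff upper_half_plane_def not_less)

text \<open>The Fricke relation at \<open>\<sigma> / N\<close>: the expansion at the cusp 0 is the
  one at infinity with the argument divided by N.\<close>

lemma lambda_form_at_zero: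
  assumes "Im \<sigma> > 0" "level p > 0"
  shows "\<sigma> powi (- 1) * lambda_form p (- 1 / \<sigma>) =
    (- \<i> * of_real (sqrt (level p)) / of_nat (level p)) * lambda_form p (\<sigma> / of_nat (level p))"
proof -
  have "Im (\<sigma> / of_nat (level p)) > 0" using assms by (simp add: Im_divide_of_nat)
  from lambda_form_fricke[OF this assms(2)] show ?thesis
    using assms by (auto simp: power_int_minus field_simps)
qed

lemma modular_form_lambda_form:
  assumes p: "p \<in> {3, 4, 6}"
  shows "modular_form 1 (Gamma1 (level p)) (vartheta p) (lambda_form p)"
  unfolding modular_form_iff
proof (intro conjI ballI allI impI)
  have l: "level p > 0" using p by (auto simp: level_def)
  show "is_character (Gamma1 (level p)) (vartheta p)"
    by (rule vartheta_properties[OF p])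
  show "lambda_form p \<tau> = 0" if "Im \<tau> \<le> 0" for \<tau>
    using that by (simp add: lambda_form_def dedekind_eta_def upper_half_plane_def)
  show "lambda_form p holomorphic_on upper_half_plane"
    unfolding lambda_form_def using l
    by (intro holomorphic_intros dedekind_eta_holomorphic) (auto simp: upper_half_plane_def)
  show tr: "lambda_form p (moebius \<gamma> \<tau>) = vartheta p \<gamma> * aut_factor \<gamma> \<tau> powi 1 * lambda_form p \<tau>"
    if "\<gamma> \<in> Gamma1 (level p)" "Im \<tau> > 0" for \<gamma> \<tau>
    using vartheta_properties(4)[OF p that] by simp
  fix \<gamma> assume \<gamma>: "\<gamma> \<in> SL2Z"
  from level_cases[OF p] \<gamma> show "cusp_series (slash 1 (lambda_form p) \<gamma>)"
  proof (cases rule: slash_cases)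
    case infinity
    obtain c where "\<And>\<tau>. Im \<tau> > 0 \<Longrightarrow> slash 1 (lambda_form p) \<gamma> \<tau> = c * lambda_form p \<tau>"
      using infinity[OF vartheta_properties(1)[OF p] tr] by blast
    then show ?thesis
      by (intro cusp_series_cong[OF cusp_series_cmult[OF cusp_series_lambda_form[OF l], of c]]) simp
  next
    case (zero j)
    obtain c where c: "\<And>\<tau>. Im \<tau> > 0 \<Longrightarrow> slash 1 (lambda_form p) \<gamma> \<tau>
        = c * ((\<tau> + of_int j) powi (- 1) * lambda_form p (- 1 / (\<tau> + of_int j)))"
      using zero[OF vartheta_properties(1)[OF p] tr] by blast
    show ?thesis
      by (rule cusp_series_cong[OF cusp_series_cmult[OF cusp_series_affine[OF cusp_series_lambda_form[OF l] l, of j],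
            of "c * (- \<i> * of_real (sqrt (level p)) / of_nat (level p))"]])
         (simp only: c lambda_form_at_zero[OF _ l] Im_plus_int mult.assoc)
  qed
qed

section \<open>Products of modular forms and division by \<open>delta_form\<close>\<close>

lemma modular_form_zero: "is_character \<Gamma> \<psi> \<Longrightarrow> modular_form k \<Gamma> \<psi> (\<lambda>_. 0)"
  by (simp add: modular_form_iff slash_def[abs_def] cusp_series_const)

lemma modular_form_mult:
  assumes f: "modular_form k (Gamma1 N) \<psi> f" and f': "modular_form k' (Gamma1 N) \<psi>' f'"
  shows "modular_form (k + k') (Gamma1 N) (\<lambda>\<gamma>. \<psi> \<gamma> * \<psi>' \<gamma>) (\<lambda>\<tau>. f \<tau> * f' \<tau>)"
  unfolding modular_form_iff
proof (intro conjI ballI allI impI)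
  show "is_character (Gamma1 N) (\<lambda>\<gamma>. \<psi> \<gamma> * \<psi>' \<gamma>)"
    using assms by (simp add: modular_form_iff is_character_def mult_ac)
  show "(\<lambda>\<tau>. f \<tau> * f' \<tau>) holomorphic_on upper_half_plane"
    using assms by (intro holomorphic_intros) (simp_all add: modular_form_iff)
  show "f (moebius \<gamma> \<tau>) * f' (moebius \<gamma> \<tau>) = \<psi> \<gamma> * \<psi>' \<gamma> * aut_factor \<gamma> \<tau> powi (k + k') * (f \<tau> * f' \<tau>)"
    if "\<gamma> \<in> Gamma1 N" "Im \<tau> > 0" for \<gamma> \<tau>
    using assms that aut_factor_nonzero[OF Gamma1_SL2Z[OF that(1)] that(2)]
    by (simp add: modular_form_iff power_int_add mult_ac)
  show "cusp_series (slash (k + k') (\<lambda>\<tau>. f \<tau> * f' \<tau>) \<gamma>)" if "\<gamma> \<in> SL2Z" for \<gamma>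
  proof (rule cusp_series_cong)
    show "cusp_series (\<lambda>\<tau>. slash k f \<gamma> \<tau> * slash k' f' \<gamma> \<tau>)"
      using assms that by (intro cusp_series_mult) (simp_all add: modular_form_iff)
    show "slash k f \<gamma> \<tau> * slash k' f' \<gamma> \<tau> = slash (k + k') (\<lambda>\<tau>. f \<tau> * f' \<tau>) \<gamma> \<tau>" if "Im \<tau> > 0" for \<tau>
    proof -
      have "aut_factor \<gamma> \<tau> powi (- (k + k')) = aut_factor \<gamma> \<tau> powi (- k) * aut_factor \<gamma> \<tau> powi (- k')"
        using power_int_add[of "aut_factor \<gamma> \<tau>" "- k" "- k'"] aut_factor_nonzero[OF \<open>\<gamma> \<in> SL2Z\<close> that] by simp
      then show ?thesis
        unfolding slash_def by (simp only: mult_ac)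
    qed
  qed
qed (use assms in \<open>simp add: modular_form_iff\<close>)

text \<open>For \<open>n = 0\<close> the power is the constant 1, which violates the convention that
  forms are extended by 0 outside the upper half plane.\<close>

lemma modular_form_power:
  assumes f: "modular_form k (Gamma1 N) \<psi> f" and "n > 0"
  shows "modular_form (int n * k) (Gamma1 N) (\<lambda>\<gamma>. \<psi> \<gamma> ^ n) (\<lambda>\<tau>. f \<tau> ^ n)"
  using \<open>n > 0\<close>
proof (induction n rule: nat_induct_non_zero)
  case (Suc n)
  then show ?case
    using modular_form_mult[OF f Suc.IH] by (simp add: distrib_right)
qed (use f in simp)

lemma modular_form_delta_form:
  assumes p: "p \<in> {3, 4, 6}"
  shows "modular_form (int (wt p)) (Gamma1 (level p)) (theta_char p) (delta_form p)"
  using modular_form_power[OF modular_form_lambda_form[OF p], of "wt p"]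
  by (simp add: theta_char_def[abs_def] delta_form_def[abs_def] wt_def)

text \<open>From \<open>(1 + level p) * wt p = 12\<close> the leading exponent of q is 1/2, followed
  by a factor that is a zero-free function of q.\<close>

lemma delta_form_eq:
  assumes "Im \<tau> > 0" "p \<in> {3, 4, 6}"
  shows "delta_form p \<tau> = nome (\<tau> / 2) * (euler_phi (nome \<tau>) * euler_phi (nome \<tau> ^ level p)) ^ wt p"
proof -
  have l: "level p > 0" using assms(2) by (auto simp: level_def)
  have "nome ((1 + of_nat (level p)) * \<tau> / 24) ^ wt p = nome (of_nat (wt p) * ((1 + of_nat (level p)) * \<tau> / 24))"
    by (simp only: nome_of_nat_mult)
  also have "of_nat (wt p) * ((1 + of_nat (level p)) * \<tau> / 24) = \<tau> / 2"
    using assms(2) by (auto simp: level_def wt_def)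
  finally show ?thesis
    by (simp add: delta_form_def lambda_form_eq[OF assms(1) l] power_mult_distrib mult.assoc)
qed

lemma delta_form_nonzero:
  assumes "Im \<tau> > 0" "p \<in> {3, 4, 6}"
  shows "delta_form p \<tau> \<noteq> 0"
  using lambda_form_nonzero[OF assms(1), of p] assms(2) by (auto simp: delta_form_def level_def)

text \<open>Antiperiodicity under \<open>M\<close> frees exactly the factor
  \<open>nome (\<tau> / (2 * M))\<close> from \<open>f\<close>. The leading factor of the
  denominator is the same up to the constant caused by \<open>j\<close>, and the inverse Euler
  products are holomorphic in the parameter. The cusp infinity uses \<open>M = 1\<close>, the cusp 0
  uses \<open>M = N\<close>.\<close>

lemma cusp_series_div_delta_form:
  assumes p: "p \<in> {3, 4, 6}" and f: "cusp_series f" and "M > 0"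
    and anti: "\<And>\<tau>. Im \<tau> > 0 \<Longrightarrow> f (\<tau> + of_nat M) = - f \<tau>"
  shows "cusp_series (\<lambda>\<tau>. f \<tau> / delta_form p ((\<tau> + of_int j) / of_nat M))"
proof -
  have l: "level p > 0" using p by (auto simp: level_def)
  let ?u = "\<lambda>\<tau>. 1 / (euler_phi (nome \<tau>) * euler_phi (nome \<tau> ^ level p))"
  have "cusp_series (\<lambda>\<tau>. nome (- of_int j / (2 * of_nat M)) *
      ((f \<tau> * nome (- \<tau> / (2 * of_nat M))) * ?u ((\<tau> + of_int j) / of_nat M) ^ wt p))"
    using cusp_series_affine[OF cusp_series_euler_phi_inverse[OF l] \<open>M > 0\<close>, of j]
    by (intro cusp_series_cmult cusp_series_mult cusp_series_power cusp_series_antiperiodic assms)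
  then show ?thesis
  proof (rule cusp_series_cong)
    fix \<tau> :: complex assume \<tau>: "Im \<tau> > 0"
    define \<sigma> where "\<sigma> = (\<tau> + of_int j) / of_nat M"
    have \<sigma>: "Im \<sigma> > 0" using \<tau> \<open>M > 0\<close> by (simp add: \<sigma>_def Im_divide_of_nat)
    have "- of_int j / (2 * of_nat M) + - \<tau> / (2 * of_nat M) = - (\<sigma> / 2)"
      using \<open>M > 0\<close> by (simp add: \<sigma>_def field_simps)
    then have "nome (- of_int j / (2 * of_nat M)) * nome (- \<tau> / (2 * of_nat M)) = nome (- (\<sigma> / 2))"
      by (simp only: nome_add[symmetric])
    then have *: "nome (- of_int j / (2 * of_nat M)) * nome (- \<tau> / (2 * of_nat M)) = 1 / nome (\<sigma> / 2)"
      by (simp only: nome_minus)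
    have "nome (- of_int j / (2 * of_nat M)) * ((f \<tau> * nome (- \<tau> / (2 * of_nat M))) * ?u \<sigma> ^ wt p)
        = f \<tau> * (nome (- of_int j / (2 * of_nat M)) * nome (- \<tau> / (2 * of_nat M))) * ?u \<sigma> ^ wt p"
      by (simp only: mult_ac)
    also have "\<dots> = f \<tau> / delta_form p \<sigma>"
      unfolding * delta_form_eq[OF \<sigma> p] by (simp add: power_divide)
    finally show "nome (- of_int j / (2 * of_nat M)) *
        ((f \<tau> * nome (- \<tau> / (2 * of_nat M))) * ?u ((\<tau> + of_int j) / of_nat M) ^ wt p)
        = f \<tau> / delta_form p ((\<tau> + of_int j) / of_nat M)"
      by (simp only: \<sigma>_def)
  qed
qed

lemma modular_form_div_delta_form:
  assumes p: "p \<in> {3, 4, 6}" and f: "modular_form k (Gamma1 (level p)) (theta_char p) f"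
  shows "modular_form (k - int (wt p)) (Gamma1 (level p)) (\<lambda>_. 1) (\<lambda>\<tau>. f \<tau> / delta_form p \<tau>)"
  unfolding modular_form_iff
proof (intro conjI ballI allI impI)
  let ?N = "level p" and ?\<delta> = "delta_form p" and ?w = "int (wt p)"
  have l: "?N > 0" using p by (auto simp: level_def)
  note f' = f[unfolded modular_form_iff]
  note \<delta>' = modular_form_delta_form[OF p, unfolded modular_form_iff]
  have tr: "f (moebius \<gamma> \<tau>) = theta_char p \<gamma> * aut_factor \<gamma> \<tau> powi k * f \<tau>"
    and tr\<delta>: "?\<delta> (moebius \<gamma> \<tau>) = theta_char p \<gamma> * aut_factor \<gamma> \<tau> powi ?w * ?\<delta> \<tau>"
    if "\<gamma> \<in> Gamma1 ?N" "Im \<tau> > 0" for \<gamma> \<tau>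
    using f' \<delta>' that by auto
  note char = theta_char_properties(1)[OF p]
  show "is_character (Gamma1 ?N) (\<lambda>_. 1)" by (simp add: is_character_def)
  show "f \<tau> / ?\<delta> \<tau> = 0" if "Im \<tau> \<le> 0" for \<tau>
    using f' that by simp
  show "(\<lambda>\<tau>. f \<tau> / ?\<delta> \<tau>) holomorphic_on upper_half_plane"
    using f' \<delta>' delta_form_nonzero[OF _ p] by (intro holomorphic_intros) (auto simp: upper_half_plane_def)
  show "f (moebius \<gamma> \<tau>) / ?\<delta> (moebius \<gamma> \<tau>) = 1 * aut_factor \<gamma> \<tau> powi (k - ?w) * (f \<tau> / ?\<delta> \<tau>)"
    if "\<gamma> \<in> Gamma1 ?N" "Im \<tau> > 0" for \<gamma> \<tau>
  proof -
    have "theta_char p \<gamma> \<noteq> 0" using char that(1) by (auto simp: is_character_def)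
    then show ?thesis
      using aut_factor_nonzero[OF Gamma1_SL2Z[OF that(1)] that(2)]
      by (simp add: tr[OF that] tr\<delta>[OF that] power_int_diff)
  qed
  fix \<gamma> assume \<gamma>: "\<gamma> \<in> SL2Z"
  have quot: "slash (k - ?w) (\<lambda>\<tau>. f \<tau> / ?\<delta> \<tau>) \<gamma> \<tau> = slash k f \<gamma> \<tau> / slash ?w ?\<delta> \<gamma> \<tau>" if "Im \<tau> > 0" for \<tau>
    using aut_factor_nonzero[OF \<gamma> that] by (simp add: slash_def power_int_minus power_int_diff field_simps)
  have cf: "cusp_series (slash k f \<gamma>)" using f' \<gamma> by blast
  from level_cases[OF p] \<gamma> show "cusp_series (slash (k - ?w) (\<lambda>\<tau>. f \<tau> / ?\<delta> \<tau>) \<gamma>)"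
  proof (cases rule: slash_cases)
    case infinity
    obtain c where c: "c \<noteq> 0" "\<And>\<tau>. Im \<tau> > 0 \<Longrightarrow> slash k f \<gamma> \<tau> = c * f \<tau>"
      using infinity[OF char tr] by blast
    obtain d where d: "d \<noteq> 0" "\<And>\<tau>. Im \<tau> > 0 \<Longrightarrow> slash ?w ?\<delta> \<gamma> \<tau> = d * ?\<delta> \<tau>"
      using infinity[OF char tr\<delta>] by blast
    have anti: "slash k f \<gamma> (\<tau> + of_nat 1) = - slash k f \<gamma> \<tau>" if "Im \<tau> > 0" for \<tau>
    proof -
      have "mat_B \<in> Gamma1 ?N" by (simp add: mat_B_mat2 mat2_Gamma1 cong_0_iff)
      from tr[OF this that] have "f (\<tau> + 1) = - f \<tau>"
        unfolding theta_char_properties(3)[OF p] by (simp add: mat_B_mat2 moebius_def aut_factor_def)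
      then show ?thesis using c(2)[of "\<tau> + 1"] c(2)[of \<tau>] that by simp
    qed
    have "cusp_series (\<lambda>\<tau>. 1 / d * (slash k f \<gamma> \<tau> / ?\<delta> ((\<tau> + of_int 0) / of_nat 1)))"
      by (intro cusp_series_cmult cusp_series_div_delta_form p cf anti) auto
    then show ?thesis
      by (rule cusp_series_cong) (simp add: quot d(2))
  next
    case (zero j)
    obtain c where c: "c \<noteq> 0" "\<And>\<tau>. Im \<tau> > 0 \<Longrightarrow> slash k f \<gamma> \<tau> = c * ((\<tau> + of_int j) powi (- k) * f (- 1 / (\<tau> + of_int j)))"
      using zero[OF char tr] by blast
    obtain d where d: "d \<noteq> 0" "\<And>\<tau>. Im \<tau> > 0 \<Longrightarrow> slash ?w ?\<delta> \<gamma> \<tau> = d * ((\<tau> + of_int j) powi (- ?w) * ?\<delta> (- 1 / (\<tau> + of_int j)))"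
      using zero[OF char tr\<delta>] by blast
    define \<kappa> :: complex where "\<kappa> = (- \<i> * of_real (sqrt ?N) / of_nat ?N) ^ wt p"
    have \<kappa>: "\<sigma> powi (- ?w) * ?\<delta> (- 1 / \<sigma>) = \<kappa> * ?\<delta> (\<sigma> / of_nat ?N)" if "Im \<sigma> > 0" for \<sigma>
    proof -
      have "\<sigma> powi (- ?w) * ?\<delta> (- 1 / \<sigma>) = (\<sigma> powi (- 1) * lambda_form p (- 1 / \<sigma>)) ^ wt p"
        by (simp add: delta_form_def power_mult_distrib power_int_minus power_inverse)
      then show ?thesis
        unfolding lambda_form_at_zero[OF that l] by (simp only: delta_form_def \<kappa>_def power_mult_distrib)
    qed
    have anti: "slash k f \<gamma> (\<tau> + of_nat ?N) = - slash k f \<gamma> \<tau>" if "Im \<tau> > 0" for \<tau>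
    proof -
      define \<sigma> where "\<sigma> = \<tau> + of_int j"
      have \<sigma>: "Im \<sigma> > 0" "Im (\<sigma> + of_nat ?N) > 0" using that by (simp_all add: \<sigma>_def)
      then have nz: "\<sigma> \<noteq> 0" "\<sigma> + of_nat ?N \<noteq> 0" by (metis less_irrefl zero_complex.sel(2))+
      \<comment> \<open>\<open>mat_A\<close> sends \<open>- 1 / \<sigma>\<close> to
        \<open>- 1 / (\<sigma> + N)\<close>: at the cusp 0 this generator is translation by N, and
        its character value -1 gives the antiperiodicity.\<close>
      have "mat_A ?N \<in> Gamma1 ?N" by (simp add: mat_A_mat2 mat2_Gamma1 cong_0_iff)
      from tr[OF this Im_minus_inverse_pos[OF \<sigma>(1)]]
      have "f (moebius (mat_A ?N) (- 1 / \<sigma>)) = - (aut_factor (mat_A ?N) (- 1 / \<sigma>) powi k * f (- 1 / \<sigma>))"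
        unfolding theta_char_properties(2)[OF p] by simp
      moreover have "aut_factor (mat_A ?N) (- 1 / \<sigma>) = (\<sigma> + of_nat ?N) / \<sigma>"
        using nz by (simp add: mat_A_mat2 aut_factor_def field_simps)
      moreover have "moebius (mat_A ?N) (- 1 / \<sigma>) = - 1 / (\<sigma> + of_nat ?N)"
        using nz by (simp add: mat_A_mat2 moebius_def field_simps)
      ultimately have "f (- 1 / (\<sigma> + of_nat ?N)) = - (((\<sigma> + of_nat ?N) / \<sigma>) powi k * f (- 1 / \<sigma>))"
        by simp
      then have h1: "(\<sigma> + of_nat ?N) powi (- k) * f (- 1 / (\<sigma> + of_nat ?N)) = - (\<sigma> powi (- k) * f (- 1 / \<sigma>))"
        using nz by (simp add: power_int_divide_distrib power_int_minus field_simps)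
      have h2: "\<tau> + of_nat ?N + of_int j = \<sigma> + of_nat ?N"
        by (simp add: \<sigma>_def)
      have "Im (\<tau> + of_nat ?N) > 0"
        using that by simp
      from c(2)[OF this] have "slash k f \<gamma> (\<tau> + of_nat ?N) = c * ((\<sigma> + of_nat ?N) powi (- k) * f (- 1 / (\<sigma> + of_nat ?N)))"
        unfolding h2 .
      moreover have "slash k f \<gamma> \<tau> = c * (\<sigma> powi (- k) * f (- 1 / \<sigma>))"
        using c(2)[OF that] by (simp only: \<sigma>_def)
      ultimately show ?thesis
        by (simp only: h1 mult_minus_right)
    qed
    have "cusp_series (\<lambda>\<tau>. 1 / (d * \<kappa>) * (slash k f \<gamma> \<tau> / ?\<delta> ((\<tau> + of_int j) / of_nat ?N)))"
      by (intro cusp_series_cmult cusp_series_div_delta_form p cf anti l)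
    then show ?thesis
    proof (rule cusp_series_cong)
      fix \<tau> :: complex assume \<tau>: "Im \<tau> > 0"
      show "1 / (d * \<kappa>) * (slash k f \<gamma> \<tau> / ?\<delta> ((\<tau> + of_int j) / of_nat ?N)) = slash (k - ?w) (\<lambda>\<tau>. f \<tau> / ?\<delta> \<tau>) \<gamma> \<tau>"
        unfolding quot[OF \<tau>] d(2)[OF \<tau>] \<kappa>[OF Im_plus_int[OF \<tau>]] by simp
    qed
  qed
qed

text \<open>Convolution with one homogeneous element only shifts the weight. With integer weights
  the difference \<open>n - k\<close> is always available.\<close>

lemma lookup_mult_single:
  fixes r :: "int \<Rightarrow>\<^sub>0 'a :: semiring_0"
  shows "Poly_Mapping.lookup (r * Poly_Mapping.single k x) n = Poly_Mapping.lookup r (n - k) * x"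
proof -
  have "(Poly_Mapping.lookup (Poly_Mapping.single k x) q when n = l + q) =
      ((x when n = l + k) when q = k)" for l q
    by (auto simp: lookup_single when_def)
  then have "(\<Sum>q. Poly_Mapping.lookup (Poly_Mapping.single k x) q when n = l + q) = (x when n = l + k)" for l
    by simp
  then have "Poly_Mapping.lookup (r * Poly_Mapping.single k x) n
      = (\<Sum>l. Poly_Mapping.lookup r l * (x when n = l + k))"
    by (simp add: lookup_mult)
  also have "\<dots> = (\<Sum>l. (Poly_Mapping.lookup r l * x) when l = n - k)"
    by (intro Sum_any.cong) (auto simp: when_def)
  finally show ?thesis by simp
qed

lemma delta_form_module_generator:
  assumes p: "p \<in> {3, 4, 6}"
  shows "module_generator
       (graded_modular_forms (Gamma1 (level p)) (\<lambda>_. 1))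
       (graded_modular_forms (Gamma1 (level p)) (theta_char p))
       (Poly_Mapping.single (int (wt p)) (delta_form p))"
  unfolding module_generator_def
proof (intro conjI set_eqI iffI)
  let ?w = "int (wt p)" and ?\<delta> = "delta_form p"
  note \<delta> = modular_form_delta_form[OF p]
  have \<delta>0: "?\<delta> \<tau> = 0" if "Im \<tau> \<le> 0" for \<tau>
    using \<delta> that by (simp add: modular_form_iff)
  show "Poly_Mapping.single ?w ?\<delta> \<in> graded_modular_forms (Gamma1 (level p)) (theta_char p)"
    using \<delta> modular_form_zero[OF theta_char_properties(1)[OF p]]
    by (auto simp: graded_modular_forms_def lookup_single when_def zero_fun_def)
  fix F :: "int \<Rightarrow>\<^sub>0 (complex \<Rightarrow> complex)"
  show "F \<in> graded_modular_forms (Gamma1 (level p)) (theta_char p)"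
    if F: "F \<in> {r * Poly_Mapping.single ?w ?\<delta> |r. r \<in> graded_modular_forms (Gamma1 (level p)) (\<lambda>_. 1)}"
  proof -
    obtain r where r: "F = r * Poly_Mapping.single ?w ?\<delta>"
      "\<And>k. modular_form k (Gamma1 (level p)) (\<lambda>_. 1) (Poly_Mapping.lookup r k)"
      using F by (auto simp: graded_modular_forms_def)
    have "modular_form k (Gamma1 (level p)) (theta_char p) (Poly_Mapping.lookup F k)" for k
      using modular_form_mult[OF r(2)[of "k - ?w"] \<delta>] by (simp add: r(1) lookup_mult_single times_fun_def)
    then show ?thesis by (simp add: graded_modular_forms_def)
  qed
  show "F \<in> {r * Poly_Mapping.single ?w ?\<delta> |r. r \<in> graded_modular_forms (Gamma1 (level p)) (\<lambda>_. 1)}"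
    if "F \<in> graded_modular_forms (Gamma1 (level p)) (theta_char p)"
  proof -
    have F: "modular_form k (Gamma1 (level p)) (theta_char p) (Poly_Mapping.lookup F k)" for k
      using that by (simp add: graded_modular_forms_def)
    \<comment> \<open>The candidate cofactor, weight by weight: division lowers the weight by
      \<open>wt p\<close>, and finite support is inherited from \<open>F\<close>. Outside the upper
      half plane both sides are 0.\<close>
    define q where "q = (\<lambda>k \<tau>. Poly_Mapping.lookup F (k + ?w) \<tau> / ?\<delta> \<tau>)"
    have "{k. q k \<noteq> 0} \<subseteq> (\<lambda>k. k - ?w) ` {k. Poly_Mapping.lookup F k \<noteq> 0}"
    proof
      fix k assume "k \<in> {k. q k \<noteq> 0}"
      then have "Poly_Mapping.lookup F (k + ?w) \<noteq> 0" by (auto simp: q_def zero_fun_def)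
      then show "k \<in> (\<lambda>k. k - ?w) ` {k. Poly_Mapping.lookup F k \<noteq> 0}"
        by (intro image_eqI[of _ _ "k + ?w"]) auto
    qed
    then have fin: "finite {k. q k \<noteq> 0}"
      by (rule finite_subset) simp
    define r where "r = Poly_Mapping.Abs_poly_mapping q"
    have r: "Poly_Mapping.lookup r = q"
      unfolding r_def by (rule lookup_Abs_poly_mapping[OF fin])
    have "modular_form k (Gamma1 (level p)) (\<lambda>_. 1) (q k)" for k
      using modular_form_div_delta_form[OF p F[of "k + ?w"]] by (simp add: q_def)
    moreover have "F = r * Poly_Mapping.single ?w ?\<delta>"
    proof (rule poly_mapping_eqI)
      fix k
      have "Poly_Mapping.lookup F k \<tau> = q (k - ?w) \<tau> * ?\<delta> \<tau>" for \<tau>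
        using delta_form_nonzero[OF _ p, of \<tau>] F[of k] by (cases "Im \<tau> > 0") (auto simp: q_def modular_form_iff not_less)
      then show "Poly_Mapping.lookup F k = Poly_Mapping.lookup (r * Poly_Mapping.single ?w ?\<delta>) k"
        by (simp add: lookup_mult_single r times_fun_def fun_eq_iff)
    qed
    ultimately show ?thesis
      by (auto simp: graded_modular_forms_def r)
  qed
qed

theorem theorem11p1:
  fixes p :: nat
  assumes "p \<in> {3, 4, 6}"
  shows
    "modular_form 1 (Gamma1 (level p)) (vartheta p) (lambda_form p) \<and>
     module_generator
       (graded_modular_forms (Gamma1 (level p)) (\<lambda>_. 1))
       (graded_modular_forms (Gamma1 (level p)) (theta_char p))
       (Poly_Mapping.single (int (wt p)) (delta_form p)) \<and>
     (\<exists>C::complex. C \<noteq> 0 \<and>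
        (\<forall>(\<omega>0, \<omega>1) \<in> H_tilde.
           discr_red p (g_s p (\<omega>0, \<omega>1)) (g_l p (\<omega>0, \<omega>1))
             = C * lambda_form p (\<omega>1 / \<omega>0) ^ (2 * wt p) * \<omega>0 powi (- int (2 * wt p)))) \<and>
     (\<exists>C'::complex. C' \<noteq> 0 \<and>
        (\<forall>(\<omega>0, \<omega>1) \<in> H_tilde.
           discr p (g_s p (\<omega>0, \<omega>1)) (g_l p (\<omega>0, \<omega>1))
             = C' * modular_discr (\<omega>1 / \<omega>0) * \<omega>0 powi (- 12)))"
  using modular_form_lambda_form[OF assms] delta_form_module_generator[OF assms]
    discr_red_proportional[OF assms] discr_proportional[OF assms] by blast

end
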